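(* Let $K$ be a field, $S=K[x_1,\dots,x_m,y_1,\dots,y_n]$, $Q=(y_1,\dots,y_n)$. Let $\Delta$ be a simplicial complex with vertices $V\cup W$, $V=\{v_1,\dots,v_m\}$, $W=\{w_1,\dots,w_n\}$, let $K[\Delta]=S/I_\Delta$ be its Stanley--Reisner ring, and write $q=\operatorname{cd}(Q,K[\Delta])$. The following conditions are equivalent: (a) $\Delta$ is relative Cohen--Macaulay with respect to $Q$ over $K$, with $\operatorname{cd}(Q,K[\Delta])=q$; (b) $\widetilde H_i\big((\operatorname{link}_\Delta (F\cup G))_W;K\big)=0$ for all $F\in\Delta_W$, all $G\subset V$ and all $i<\dim\operatorname{link}_{\Delta_W}F$.
   Context: The vertices $v_1,\dots,v_m$ correspond to the variables $x_1,\dots,x_m$ and $w_1,\dots,w_n$ to $y_1,\dots,y_n$; $I_\Delta$ is the squarefree monomial ideal generated by the monomials corresponding to non-faces of $\Delta$. For a simplicial complex $\Gamma$ on $V\cup W$, $\Gamma_W=\{F\in\Gamma:F\subseteq W\}$. For a subset $F$ of the vertex set, $\operatorname{link}_\Gamma F=\{H\in\Gamma: F\cup H\in\Gamma,\ F\cap H=\emptyset\}$, which has no faces at all (and zero reduced homology) if $F\notin\Gamma$. $\widetilde H_i(\Gamma;K)$ is the $i$-th reduced simplicial homology with coefficients in $K$ (with $\widetilde H_{-1}(\{\emptyset\};K)=K$), and $\dim\{\emptyset\}=-1$. For a nonzero finitely generated bigraded $S$-module $M$ ($\deg x_i=(1,0)$, $\deg y_j=(0,1)$), $\operatorname{grade}(Q,M)$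 and $\operatorname{cd}(Q,M)$ are the least and the largest $i$ with $H^i_Q(M)\ne0$; $M$ is relative Cohen--Macaulay with respect to $Q$ if $\operatorname{grade}(Q,M)=\operatorname{cd}(Q,M)$. $\Delta$ is relative Cohen--Macaulay with respect to $Q$ over $K$ if $K[\Delta]$ is relative Cohen--Macaulay with respect to $Q$. *)

theory Defs
  imports "HOL-Library.Poly_Mapping" "HOL-Algebra.Module" "HOL-Algebra.QuotRing"
    "HOL-Algebra.Ideal_Product" "HOL-Algebra.Elementary_Groups"
begin

section \<open>Simplicial complexes\<close>

text \<open>A complex on the vertex set \<^term>\<open>Vs\<close> contains the empty face. Elements of
  \<^term>\<open>Vs\<close> are allowed not to be faces. The functions below are also applied to the
  complex without any faces, \<^term>\<open>{}\<close>, which arises as a link.\<close>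

definition simplicial_complex :: "'v set \<Rightarrow> 'v set set \<Rightarrow> bool" where
  "simplicial_complex Vs \<Delta> \<longleftrightarrow>
     {} \<in> \<Delta> \<and> (\<forall>F\<in>\<Delta>. F \<subseteq> Vs) \<and> (\<forall>F\<in>\<Delta>. \<forall>G. G \<subseteq> F \<longrightarrow> G \<in> \<Delta>)"

definition link :: "'v set set \<Rightarrow> 'v set \<Rightarrow> 'v set set" where
  "link \<Gamma> F = {H \<in> \<Gamma>. F \<union> H \<in> \<Gamma> \<and> F \<inter> H = {}}"

definition restriction :: "'v set set \<Rightarrow> 'v set \<Rightarrow> 'v set set" where
  "restriction \<Gamma> W = {F \<in> \<Gamma>. F \<subseteq> W}"

definition complex_dim :: "'v set set \<Rightarrow> int" where
  "complex_dim \<Gamma> = Max ((\<lambda>F. int (card F) - 1) ` \<Gamma>)"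


section \<open>Reduced simplicial homology\<close>

text \<open>Chains are finitely supported functions on faces; a face stands for the oriented simplex
  on its vertices listed in increasing order. The empty face has degree \<open>-1\<close>, so the
  differential from degree \<open>0\<close> is the augmentation.\<close>

definition chains :: "int \<Rightarrow> 'v set set \<Rightarrow> ('v set \<Rightarrow>\<^sub>0 'k::field) set" where
  "chains i \<Gamma> = {c. Poly_Mapping.keys c \<subseteq> {F \<in> \<Gamma>. finite F \<and> int (card F) = i + 1}}"

definition boundary :: "('v::linorder set \<Rightarrow>\<^sub>0 'k::field) \<Rightarrow> ('v set \<Rightarrow>\<^sub>0 'k)" where
  "boundary c = (\<Sum>F\<in>Poly_Mapping.keys c. \<Sum>v\<in>F.
     Poly_Mapping.single (F - {v}) ((-1) ^ card {u \<in> F. u < v} * Poly_Mapping.lookup c F))"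

definition reduced_homology ::
  "'k::field itself \<Rightarrow> int \<Rightarrow> 'v::linorder set set \<Rightarrow> ('v set \<Rightarrow>\<^sub>0 'k) set monoid" where
  "reduced_homology K i \<Gamma> =
     \<lparr>carrier = {c \<in> chains i \<Gamma>. boundary c = 0}, mult = (+), one = 0\<rparr>
       Mod (boundary ` chains (i + 1) \<Gamma>)"


section \<open>Polynomial rings and Stanley--Reisner rings\<close>

text \<open>The polynomial ring over the field \<open>'k\<close> whose variables are indexed by the
  elements of \<^term>\<open>Vs\<close>. A polynomial is a finitely supported function on exponent vectors.\<close>

definition poly_ring :: "'v set \<Rightarrow> (('v \<Rightarrow>\<^sub>0 nat) \<Rightarrow>\<^sub>0 'k::field) ring" where
  "poly_ring Vs = \<lparr>carrier = {p. \<forall>t\<in>Poly_Mapping.keys p. Poly_Mapping.keys t \<subseteq> Vs},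
     mult = (*), one = 1, zero = 0, add = (+)\<rparr>"

lemma cring_poly_ring: "cring (poly_ring Vs :: (('v \<Rightarrow>\<^sub>0 nat) \<Rightarrow>\<^sub>0 'k::field) ring)"
proof (rule cringI)
  show "abelian_group (poly_ring Vs :: (('v \<Rightarrow>\<^sub>0 nat) \<Rightarrow>\<^sub>0 'k) ring)"
  proof (rule abelian_groupI)
    fix x assume "x \<in> carrier (poly_ring Vs :: (('v \<Rightarrow>\<^sub>0 nat) \<Rightarrow>\<^sub>0 'k) ring)"
    then show "\<exists>y\<in>carrier (poly_ring Vs). y \<oplus>\<^bsub>poly_ring Vs\<^esub> x = \<zero>\<^bsub>poly_ring Vs\<^esub>"
      by (intro bexI[of _ "-x"]) (auto simp: poly_ring_def keys_minus)
  qed (auto simp: poly_ring_def add.assoc add.commute dest!: subsetD[OF Poly_Mapping.keys_add])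
  show "Group.comm_monoid (poly_ring Vs :: (('v \<Rightarrow>\<^sub>0 nat) \<Rightarrow>\<^sub>0 'k) ring)"
    apply (rule comm_monoidI)
    apply (auto simp: poly_ring_def mult.assoc mult.commute dest!: subsetD[OF keys_mult])
    by (meson UnE keys_add subsetD)
qed (auto simp: poly_ring_def distrib_right)

definition var :: "'v \<Rightarrow> (('v \<Rightarrow>\<^sub>0 nat) \<Rightarrow>\<^sub>0 'k::field)" where
  "var v = Poly_Mapping.single (Poly_Mapping.single v 1) 1"

definition stanley_reisner_ideal ::
  "'v set \<Rightarrow> 'v set set \<Rightarrow> (('v \<Rightarrow>\<^sub>0 nat) \<Rightarrow>\<^sub>0 'k::field) set" where
  "stanley_reisner_ideal Vs \<Delta> =
     Idl\<^bsub>poly_ring Vs\<^esub> ((\<lambda>F. \<Prod>v\<in>F. var v) ` {F. F \<subseteq> Vs \<and> F \<notin> \<Delta>})"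

definition quotient_module :: "('a, 'r) ring_scheme \<Rightarrow> 'a set \<Rightarrow> ('a, 'a set) module" where
  "quotient_module R I =
     \<lparr>carrier = carrier (R Quot I), mult = mult (R Quot I), one = one (R Quot I),
      zero = zero (R Quot I), add = add (R Quot I),
      smult = (\<lambda>a X. (I +>\<^bsub>R\<^esub> a) \<otimes>\<^bsub>R Quot I\<^esub> X)\<rparr>"

lemma module_quotient_module:
  assumes "cring R" "ideal I R"
  shows "module R (quotient_module R I)"
proof -
  interpret ideal I R by fact
  interpret cring R by fact
  have q: "ring (R Quot I)" by (rule quotient_is_ring)
  then interpret Q: ring "R Quot I" .
  have h: "(+>\<^bsub>R\<^esub>) I \<in> ring_hom R (R Quot I)" by (rule rcos_ring_hom)
  have ag: "abelian_group (quotient_module R I)"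
  proof (rule abelian_groupI)
    fix x assume "x \<in> carrier (quotient_module R I)"
    then show "\<exists>y\<in>carrier (quotient_module R I).
        y \<oplus>\<^bsub>quotient_module R I\<^esub> x = \<zero>\<^bsub>quotient_module R I\<^esub>"
      by (intro bexI[of _ "\<ominus>\<^bsub>R Quot I\<^esub> x"]) (simp_all add: quotient_module_def Q.l_neg)
  qed (simp_all add: quotient_module_def Q.a_ac)
  show ?thesis
    using ring_hom_closed[OF h] ring_hom_add[OF h] ring_hom_mult[OF h] ring_hom_one[OF h] ag assms(1)
    by (intro moduleI) (auto simp: quotient_module_def Q.m_assoc Q.l_distr Q.r_distr)
qed

definition stanley_reisner ::
  "'v set \<Rightarrow> 'v set set \<Rightarrow>
   (('v \<Rightarrow>\<^sub>0 nat) \<Rightarrow>\<^sub>0 'k::field, (('v \<Rightarrow>\<^sub>0 nat) \<Rightarrow>\<^sub>0 'k) set) module" where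
  "stanley_reisner Vs \<Delta> = quotient_module (poly_ring Vs) (stanley_reisner_ideal Vs \<Delta>)"


section \<open>Local cohomology\<close>

definition module_hom ::
  "('a, 'r) ring_scheme \<Rightarrow> ('a, 'b) module \<Rightarrow> ('a, 'c) module \<Rightarrow> ('b \<Rightarrow> 'c) set" where
  "module_hom R M N = {f \<in> hom (add_monoid M) (add_monoid N).
     \<forall>a\<in>carrier R. \<forall>x\<in>carrier M. f (a \<odot>\<^bsub>M\<^esub> x) = a \<odot>\<^bsub>N\<^esub> f x}"

text \<open>HOL cannot quantify over modules of all types inside a definition, so the modules
  \<^term>\<open>B\<close> against which injectivity is tested live on the type \<open>'a\<close> of ring elements.
  They include the regular module and its ideals; hence, by Baer's criterion, injectivity with
  respect to modules on any type follows.\<close>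

definition injective_module :: "('a, 'r) ring_scheme \<Rightarrow> ('a, 'b) module \<Rightarrow> bool" where
  "injective_module R E \<longleftrightarrow> module R E \<and>
     (\<forall>(B :: ('a, 'a) module) N. module R B \<and> submodule N R B \<longrightarrow>
        (\<forall>f \<in> module_hom R (B\<lparr>carrier := N\<rparr>) E. \<exists>g \<in> module_hom R B E. \<forall>x\<in>N. g x = f x))"

definition injective_resolution ::
  "('a, 'r) ring_scheme \<Rightarrow> ('a, 'b) module \<Rightarrow>
   (nat \<Rightarrow> ('a, 'c) module) \<Rightarrow> ('b \<Rightarrow> 'c) \<Rightarrow> (nat \<Rightarrow> 'c \<Rightarrow> 'c) \<Rightarrow> bool" where
  "injective_resolution R M E \<epsilon> d \<longleftrightarrow>
     (\<forall>i. injective_module R (E i)) \<and>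
     \<epsilon> \<in> module_hom R M (E 0) \<and> (\<forall>i. d i \<in> module_hom R (E i) (E (Suc i))) \<and>
     inj_on \<epsilon> (carrier M) \<and>
     \<epsilon> ` carrier M = a_kernel (E 0) (E (Suc 0)) (d 0) \<and>
     (\<forall>i. d i ` carrier (E i) = a_kernel (E (Suc i)) (E (Suc (Suc i))) (d (Suc i)))"

definition torsion_part :: "('a, 'r) ring_scheme \<Rightarrow> 'a set \<Rightarrow> ('a, 'b) module \<Rightarrow> 'b set" where
  "torsion_part R Q M = {x \<in> carrier M. \<exists>k::nat.
     \<forall>a \<in> Q [^]\<^bsub>ideals_set R\<^esub> k. a \<odot>\<^bsub>M\<^esub> x = \<zero>\<^bsub>M\<^esub>}"

definition torsion_cocycles ::
  "('a, 'r) ring_scheme \<Rightarrow> 'a set \<Rightarrow> (nat \<Rightarrow> ('a, 'c) module) \<Rightarrow> (nat \<Rightarrow> 'c \<Rightarrow> 'c) \<Rightarrow> nat \<Rightarrow> 'c set" where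
  "torsion_cocycles R Q E d i = {x \<in> torsion_part R Q (E i). d i x = \<zero>\<^bsub>E (Suc i)\<^esub>}"

fun torsion_coboundaries ::
  "('a, 'r) ring_scheme \<Rightarrow> 'a set \<Rightarrow> (nat \<Rightarrow> ('a, 'c) module) \<Rightarrow> (nat \<Rightarrow> 'c \<Rightarrow> 'c) \<Rightarrow> nat \<Rightarrow> 'c set" where
  "torsion_coboundaries R Q E d 0 = {\<zero>\<^bsub>E 0\<^esub>}"
| "torsion_coboundaries R Q E d (Suc i) = d i ` torsion_part R Q (E i)"

text \<open>Local cohomology is the right derived functor of \<^const>\<open>torsion_part\<close>, computed from
  an arbitrarily chosen injective resolution. The terms of the resolution need a fixed carrier
  type. Functions from \<open>'a list\<close> to \<open>'b\<close> suffice when \<^term>\<open>R\<close> is an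
  algebra over a field \<open>K\<close>, the only case used here: the \<open>K\<close>-multilinear maps from
  \<open>R\<^sup>p\<^sup>+\<^sup>1\<close> to \<^term>\<open>M\<close>, for \<open>p \<ge> 0\<close>, with \<^term>\<open>R\<close>
  acting on the first argument, are the terms of an injective resolution (the cobar resolution).\<close>

definition local_cohomology ::
  "('a, 'r) ring_scheme \<Rightarrow> 'a set \<Rightarrow> ('a, 'b) module \<Rightarrow> nat \<Rightarrow> ('a list \<Rightarrow> 'b) set monoid" where
  "local_cohomology R Q M i =
     (let (E, \<epsilon>, d) = (SOME (E, \<epsilon>, d). injective_resolution R M E \<epsilon> d)
      in (E i)\<lparr>carrier := torsion_cocycles R Q E d i\<rparr> A_Mod torsion_coboundaries R Q E d i)"

definition grade :: "('a, 'r) ring_scheme \<Rightarrow> 'a set \<Rightarrow> ('a, 'b) module \<Rightarrow> nat" where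
  "grade R Q M = (LEAST i. \<not> trivial_group (local_cohomology R Q M i))"

definition cd :: "('a, 'r) ring_scheme \<Rightarrow> 'a set \<Rightarrow> ('a, 'b) module \<Rightarrow> nat" where
  "cd R Q M = (GREATEST i. \<not> trivial_group (local_cohomology R Q M i))"

definition relative_CM :: "('a, 'r) ring_scheme \<Rightarrow> 'a set \<Rightarrow> ('a, 'b) module \<Rightarrow> bool" where
  "relative_CM R Q M \<longleftrightarrow> grade R Q M = cd R Q M"

end

theory Submission
  imports Defs "HOL-Library.Sublist"
begin

text \<open>Both conditions speak about the same vector spaces, because the local cohomology of
  \<open>K[\<Delta>]\<close> with respect to \<open>Q\<close> can be read off degree by degree in the
  grading by integer exponent vectors. Consider a degree that is negative exactly on
  \<open>F \<subseteq> W\<close>, and whose positive part has support \<open>G \<subseteq> V\<close> in the variables \<open>x\<close> and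
  support \<open>H \<subseteq> W\<close> in the variables \<open>y\<close>. There \<open>H\<^sup>i\<^sub>Q(K[\<Delta>])\<close> is the reduced
  cohomology, in degree \<open>i - |F| - 1\<close>, of the complex of all \<open>T \<subseteq> W - F\<close> for which
  \<open>F \<union> G \<union> H \<union> T\<close> is a face of \<open>\<Delta>\<close>. For \<open>H \<noteq> {}\<close> this complex is a cone and contributes
  nothing (\<open>cone_coexact\<close>); for \<open>H = {}\<close> it is the restriction to \<open>W\<close> of the link of
  \<open>F \<union> G\<close>. Hence \<open>H\<^sup>i\<^sub>Q(K[\<Delta>]) \<noteq> 0\<close> if and only if some such restricted link has
  cohomology in degree \<open>i - |F| - 1\<close> (\<open>coexact_imp_poly_acyclic\<close>,
  \<open>poly_acyclic_imp_coexact\<close>), and over a field cohomology vanishes together with homology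
  (\<open>reduced_homology_trivial_iff_coexact\<close>).

  Let \<open>d\<close> be the largest number of elements of a face of \<open>\<Delta>\<^sub>W\<close>. A face of that size has
  the link \<open>{{}}\<close> in \<open>\<Delta>\<^sub>W\<close>, which has cohomology in degree \<open>-1\<close>, and no degree above \<open>d\<close> can occur;
  so \<open>d\<close> is the cohomological dimension. The ring is relative Cohen--Macaulay if and only if
  the restricted links of \<open>F \<union> G\<close> have no homology below degree \<open>d - |F| - 1\<close>. Condition (b)
  has the dimension of the link of \<open>F\<close> in \<open>\<Delta>\<^sub>W\<close> in place of this number. The dimension is
  never larger, which gives (b); the two agree when all facets of \<open>\<Delta>\<^sub>W\<close> have \<open>d\<close> elements,
  and (b) with \<open>G = {}\<close> forces this: by induction the size of a facet is a function on the
  vertices of a link that is constant along edges, and links of positive dimension are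
  connected (\<open>coexact_links_imp_pure\<close>).

  Local cohomology is given by an arbitrary injective resolution, which has to exist and has
  to be compared with something computable. It exists because, for an algebra \<open>R\<close> over a
  field \<open>K\<close>, the \<open>R\<close>-modules of \<open>K\<close>-multilinear maps form an injective resolution
  (\<open>cobar_resolution\<close>). The comparison uses Koszul cochains on the powers
  \<open>y\<^sub>1\<^sup>k, \<dots>, y\<^sub>n\<^sup>k\<close>. A cocycle for the exponent \<open>k\<close> becomes a cochain for \<open>k + l\<close> when its
  component at \<open>T\<close> is multiplied by the \<open>l\<close>-th power of the product of the variables in
  \<open>T\<close>, and local cohomology vanishes exactly if every cocycle becomes a coboundary for some
  \<open>l\<close>. This is the statement that the direct limit of Koszul cohomology, that is, the Cech
  cohomology, vanishes, phrased without forming localisations. Since the powers of the variables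
  form a regular sequence, injective modules have no Koszul cohomology in positive degrees
  (\<open>injective_koszul_acyclic\<close>), and dimension shifting along the resolution finishes the
  comparison (\<open>local_cohomology_trivial_iff\<close>).\<close>

type_synonym ('v, 'k) mpoly = "('v \<Rightarrow>\<^sub>0 nat) \<Rightarrow>\<^sub>0 'k"

abbreviation lookup where "lookup \<equiv> Poly_Mapping.lookup"
abbreviation keys where "keys \<equiv> Poly_Mapping.keys"
abbreviation single where "single \<equiv> Poly_Mapping.single"

section \<open>Homomorphisms, quotient groups, and linear maps over a field\<close>

lemma module_homI:
  assumes "\<And>x. x \<in> carrier M \<Longrightarrow> f x \<in> carrier N"
    and "\<And>x y. x \<in> carrier M \<Longrightarrow> y \<in> carrier M \<Longrightarrow> f (x \<oplus>\<^bsub>M\<^esub> y) = f x \<oplus>\<^bsub>N\<^esub> f y"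
    and "\<And>a x. a \<in> carrier R \<Longrightarrow> x \<in> carrier M \<Longrightarrow> f (a \<odot>\<^bsub>M\<^esub> x) = a \<odot>\<^bsub>N\<^esub> f x"
  shows "f \<in> module_hom R M N"
  using assms by (auto simp: module_hom_def hom_def)

lemma module_homD:
  assumes "f \<in> module_hom R M N"
  shows "x \<in> carrier M \<Longrightarrow> f x \<in> carrier N"
    and "x \<in> carrier M \<Longrightarrow> y \<in> carrier M \<Longrightarrow> f (x \<oplus>\<^bsub>M\<^esub> y) = f x \<oplus>\<^bsub>N\<^esub> f y"
    and "a \<in> carrier R \<Longrightarrow> x \<in> carrier M \<Longrightarrow> f (a \<odot>\<^bsub>M\<^esub> x) = a \<odot>\<^bsub>N\<^esub> f x"
  using assms by (auto simp: module_hom_def hom_def)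

lemma module_hom_abelian:
  assumes "module R M" "module R N" "f \<in> module_hom R M N"
  shows "abelian_group_hom M N f"
proof -
  interpret M: module R M by fact
  interpret N: module R N by fact
  show ?thesis using assms(3)
    by (intro abelian_group_homI M.M.abelian_group_axioms N.M.abelian_group_axioms group_hom.intro
        group_hom_axioms.intro M.M.a_group N.M.a_group) (auto simp: module_hom_def)
qed

lemma module_hom_zero:
  assumes "module R M" "module R N" "f \<in> module_hom R M N"
  shows "f \<zero>\<^bsub>M\<^esub> = \<zero>\<^bsub>N\<^esub>"
  by (rule abelian_group_hom.hom_zero[OF module_hom_abelian[OF assms]])

lemma module_hom_neg:
  assumes "module R M" "module R N" "f \<in> module_hom R M N" "x \<in> carrier M"
  shows "f (\<ominus>\<^bsub>M\<^esub> x) = \<ominus>\<^bsub>N\<^esub> f x"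
  by (rule abelian_group_hom.hom_a_inv[OF module_hom_abelian[OF assms(1-3)] assms(4)])

lemma module_hom_minus:
  assumes "module R M" "module R N" "f \<in> module_hom R M N" "x \<in> carrier M" "y \<in> carrier M"
  shows "f (x \<ominus>\<^bsub>M\<^esub> y) = f x \<ominus>\<^bsub>N\<^esub> f y"
proof -
  interpret M: module R M by fact
  interpret N: module R N by fact
  show ?thesis using assms(4,5)
    by (simp add: a_minus_def module_homD(2)[OF assms(3)] module_hom_neg[OF assms(1-3)])
qed

lemma (in abelian_group) diff_eq_zero_iff:
  assumes "x \<in> carrier G" "y \<in> carrier G"
  shows "x \<ominus> y = \<zero> \<longleftrightarrow> x = y"
proof
  assume "x \<ominus> y = \<zero>"
  then have "\<ominus> (\<ominus> y) = x" using assms by (intro minus_equality) (auto simp: a_minus_def)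
  then show "x = y" using assms by simp
qed (use assms in \<open>simp add: a_minus_def r_neg\<close>)

text \<open>Both homology and local cohomology are quotient groups; this turns their triviality into an
  inclusion between cocycles and coboundaries.\<close>

lemma trivial_quotient_group_iff:
  assumes "comm_group G" "subgroup H G"
  shows "trivial_group (G Mod H) \<longleftrightarrow> carrier G \<subseteq> H"
proof -
  interpret G: comm_group G by fact
  interpret H: subgroup H G by fact
  have "H \<lhd> G" using assms by (simp add: G.normal_iff_subgroup)
  then have grp: "group (G Mod H)" by (rule normal.factorgroup_is_group)
  have "carrier (G Mod H) = {\<one>\<^bsub>G Mod H\<^esub>} \<longleftrightarrow> (\<forall>x\<in>carrier G. H #>\<^bsub>G\<^esub> x = H)"
    using G.one_closed by (auto simp: FactGroup_def RCOSETS_def)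
  also have "\<dots> \<longleftrightarrow> carrier G \<subseteq> H"
    using G.coset_join1[OF _ _ assms(2)] G.coset_join2[OF _ assms(2)] by blast
  finally show ?thesis using grp by (simp add: trivial_group_def)
qed

text \<open>A subspace that is maximal among those meeting \<open>N\<close> trivially must span the space
  together with \<open>N\<close>, since otherwise a further line could be added to it. Vector spaces
  appear here as modules on a carrier set, for they will be modules over an algebra restricted to its field of scalars.\<close>

lemma subspace_complement:
  assumes F: "field F" and B: "module F B" and N: "submodule N F B"
  obtains C where "submodule C F B" "N \<inter> C = {\<zero>\<^bsub>B\<^esub>}"
    "\<And>b. b \<in> carrier B \<Longrightarrow> \<exists>n\<in>N. \<exists>c\<in>C. b = n \<oplus>\<^bsub>B\<^esub> c"
proof -
  interpret F: field F by fact
  interpret B: module F B by fact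
  note NE = B.submoduleE[OF N]
  define A where "A = {C. submodule C F B \<and> N \<inter> C = {\<zero>\<^bsub>B\<^esub>}}"
  have zero_sub: "\<zero>\<^bsub>B\<^esub> \<in> H" if "submodule H F B" for H
    using submodule.axioms(1)[OF that] subgroup.one_closed by fastforce
  have "\<exists>M\<in>A. \<forall>X\<in>A. M \<subseteq> X \<longrightarrow> X = M"
  proof (rule subset_Zorn_nonempty)
    have "submodule {\<zero>\<^bsub>B\<^esub>} F B" by (rule B.submoduleI) auto
    then show "A \<noteq> {}" using zero_sub[OF N] by (auto simp: A_def)
    fix \<C> assume ne: "\<C> \<noteq> {}" and ch: "subset.chain A \<C>"
    then have sub: "submodule C F B" "N \<inter> C = {\<zero>\<^bsub>B\<^esub>}" if "C \<in> \<C>" for C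
      using that by (auto simp: subset.chain_def A_def)
    have "submodule (\<Union>\<C>) F B"
    proof (rule B.submoduleI)
      fix a b assume "a \<in> \<Union>\<C>" "b \<in> \<Union>\<C>"
      then obtain C D where CD: "C \<in> \<C>" "D \<in> \<C>" "a \<in> C" "b \<in> D" by blast
      then have "C \<subseteq> D \<or> D \<subseteq> C" using ch by (auto simp: subset_chain_def)
      then obtain E where "E \<in> \<C>" "a \<in> E" "b \<in> E" using CD by blast
      then show "a \<oplus>\<^bsub>B\<^esub> b \<in> \<Union>\<C>" using B.submoduleE(5)[OF sub(1)] by blast
    next
      show "\<Union>\<C> \<subseteq> carrier B" using B.submoduleE(1)[OF sub(1)] by blast
      show "\<zero>\<^bsub>B\<^esub> \<in> \<Union>\<C>" using ne zero_sub[OF sub(1)] by blast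
    qed (use B.submoduleE(3,4)[OF sub(1)] in blast)+
    then show "\<Union>\<C> \<in> A" using ne sub(2) by (auto simp: A_def)
  qed
  then obtain C where CA: "C \<in> A" and mx: "\<And>X. X \<in> A \<Longrightarrow> C \<subseteq> X \<Longrightarrow> X = C" by blast
  have C: "submodule C F B" "N \<inter> C = {\<zero>\<^bsub>B\<^esub>}" using CA by (simp_all add: A_def)
  have max: "X = C" if "submodule X F B" "N \<inter> X = {\<zero>\<^bsub>B\<^esub>}" "C \<subseteq> X" for X
    using mx[of X] that by (simp add: A_def)
  note CE = B.submoduleE[OF C(1)]
  have "\<exists>n\<in>N. \<exists>c\<in>C. b = n \<oplus>\<^bsub>B\<^esub> c" if b: "b \<in> carrier B" for b
  proof (rule ccontr)
    assume no: "\<not> ?thesis"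
    \<comment> \<open>\<open>C\<close> enlarged by the line through \<open>b\<close> still meets \<open>N\<close> trivially\<close>
    define X where "X = {c \<oplus>\<^bsub>B\<^esub> l \<odot>\<^bsub>B\<^esub> b | c l. c \<in> C \<and> l \<in> carrier F}"
    have inC: "c \<in> carrier B" if "c \<in> C" for c using CE(1) that by blast
    have inN: "c \<in> carrier B" if "c \<in> N" for c using NE(1) that by blast
    have X: "submodule X F B"
    proof (rule B.submoduleI)
      show "X \<subseteq> carrier B" using b by (auto simp: X_def inC)
      show "\<zero>\<^bsub>B\<^esub> \<in> X" unfolding X_def using zero_sub[OF C(1)] b
        by (intro CollectI exI[of _ "\<zero>\<^bsub>B\<^esub>"] exI[of _ "\<zero>\<^bsub>F\<^esub>"]) auto
    next
      fix x assume "x \<in> X"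
      then obtain c l where x: "x = c \<oplus>\<^bsub>B\<^esub> l \<odot>\<^bsub>B\<^esub> b" "c \<in> C" "l \<in> carrier F" by (auto simp: X_def)
      then show "\<ominus>\<^bsub>B\<^esub> x \<in> X" unfolding X_def using b CE(3) inC
        by (intro CollectI exI[of _ "\<ominus>\<^bsub>B\<^esub> c"] exI[of _ "\<ominus>\<^bsub>F\<^esub> l"]) (auto simp: B.smult_l_minus B.minus_add)
      fix a assume a: "a \<in> carrier F"
      with x show "a \<odot>\<^bsub>B\<^esub> x \<in> X" unfolding X_def using b CE(4) inC
        by (intro CollectI exI[of _ "a \<odot>\<^bsub>B\<^esub> c"] exI[of _ "a \<otimes>\<^bsub>F\<^esub> l"])
           (auto simp: B.smult_r_distr B.smult_assoc1)
    next
      fix x y assume "x \<in> X" "y \<in> X"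
      then obtain c l c' l' where x: "x = c \<oplus>\<^bsub>B\<^esub> l \<odot>\<^bsub>B\<^esub> b" "c \<in> C" "l \<in> carrier F"
         "y = c' \<oplus>\<^bsub>B\<^esub> l' \<odot>\<^bsub>B\<^esub> b" "c' \<in> C" "l' \<in> carrier F" by (auto simp: X_def)
      then show "x \<oplus>\<^bsub>B\<^esub> y \<in> X" unfolding X_def using b CE(5) inC
        by (intro CollectI exI[of _ "c \<oplus>\<^bsub>B\<^esub> c'"] exI[of _ "l \<oplus>\<^bsub>F\<^esub> l'"])
           (auto simp: B.smult_l_distr B.a_ac)
    qed
    have "N \<inter> X \<subseteq> {\<zero>\<^bsub>B\<^esub>}"
    proof
      fix x assume x: "x \<in> N \<inter> X"
      then obtain c l where cl: "x = c \<oplus>\<^bsub>B\<^esub> l \<odot>\<^bsub>B\<^esub> b" "c \<in> C" "l \<in> carrier F" by (auto simp: X_def)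
      show "x \<in> {\<zero>\<^bsub>B\<^esub>}"
      proof (cases "l = \<zero>\<^bsub>F\<^esub>")
        case True
        then have "x = c" using cl b inC by simp
        then show ?thesis using C(2) x cl by blast
      next
        case False
        \<comment> \<open>otherwise \<open>b\<close> could be solved for and would lie in the sum of \<open>N\<close> and \<open>C\<close>\<close>
        then have li: "inv\<^bsub>F\<^esub> l \<in> carrier F" "inv\<^bsub>F\<^esub> l \<otimes>\<^bsub>F\<^esub> l = \<one>\<^bsub>F\<^esub>"
          using cl F.field_Units by (auto simp: F.Units_l_inv)
        have "l \<odot>\<^bsub>B\<^esub> b = \<ominus>\<^bsub>B\<^esub> c \<oplus>\<^bsub>B\<^esub> x"
          using cl b inC by (simp add: B.r_neg1)
        also have "\<dots> = x \<oplus>\<^bsub>B\<^esub> \<ominus>\<^bsub>B\<^esub> c" using cl x inC inN by (simp add: B.a_comm)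
        finally have "inv\<^bsub>F\<^esub> l \<odot>\<^bsub>B\<^esub> (l \<odot>\<^bsub>B\<^esub> b) = inv\<^bsub>F\<^esub> l \<odot>\<^bsub>B\<^esub> (x \<oplus>\<^bsub>B\<^esub> \<ominus>\<^bsub>B\<^esub> c)" by simp
        then have "b = inv\<^bsub>F\<^esub> l \<odot>\<^bsub>B\<^esub> x \<oplus>\<^bsub>B\<^esub> inv\<^bsub>F\<^esub> l \<odot>\<^bsub>B\<^esub> (\<ominus>\<^bsub>B\<^esub> c)"
          using li cl x b inC inN by (simp add: B.smult_assoc1[symmetric] B.smult_r_distr)
        then show ?thesis using no li NE(4) CE(3,4) x cl by blast
      qed
    qed
    then have "X = C"
    proof (intro max[OF X])
      show "N \<inter> X \<subseteq> {\<zero>\<^bsub>B\<^esub>} \<Longrightarrow> N \<inter> X = {\<zero>\<^bsub>B\<^esub>}" using zero_sub[OF N] zero_sub[OF X] by blast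
      show "C \<subseteq> X"
      proof
        fix c assume "c \<in> C"
        then show "c \<in> X" unfolding X_def using b inC
          by (intro CollectI exI[of _ c] exI[of _ "\<zero>\<^bsub>F\<^esub>"]) auto
      qed
    qed
    moreover have "b \<in> X" unfolding X_def using b zero_sub[OF C(1)]
      by (intro CollectI exI[of _ "\<zero>\<^bsub>B\<^esub>"] exI[of _ "\<one>\<^bsub>F\<^esub>"]) auto
    ultimately show False using no b zero_sub[OF N] by (metis B.l_zero)
  qed
  with C show ?thesis using that by blast
qed

lemma linear_map_extends:
  assumes F: "field F" and B: "module F B" and U: "module F U" and N: "submodule N F B"
    and f: "f \<in> module_hom F (B\<lparr>carrier := N\<rparr>) U"
  obtains g where "g \<in> module_hom F B U" "\<And>x. x \<in> N \<Longrightarrow> g x = f x"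
proof -
  interpret F: field F by fact
  interpret B: module F B by fact
  interpret U: module F U by fact
  obtain C where C: "submodule C F B" "N \<inter> C = {\<zero>\<^bsub>B\<^esub>}"
    and sum: "\<And>b. b \<in> carrier B \<Longrightarrow> \<exists>n\<in>N. \<exists>c\<in>C. b = n \<oplus>\<^bsub>B\<^esub> c"
    using subspace_complement[OF F B N] by blast
  note NE = B.submoduleE[OF N] and CE = B.submoduleE[OF C(1)]
  have inC: "c \<in> carrier B" if "c \<in> C" for c using CE(1) that by blast
  have inN: "c \<in> carrier B" if "c \<in> N" for c using NE(1) that by blast
  have z: "\<zero>\<^bsub>B\<^esub> \<in> C" "\<zero>\<^bsub>B\<^esub> \<in> N" using C(2) by blast+
  \<comment> \<open>the projection onto \<open>N\<close> along \<open>C\<close>\<close>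
  define p where "p b = (SOME n. n \<in> N \<and> (\<exists>c\<in>C. b = n \<oplus>\<^bsub>B\<^esub> c))" for b
  have p_eq: "p (n \<oplus>\<^bsub>B\<^esub> c) = n" if n: "n \<in> N" "c \<in> C" for n c
    unfolding p_def
  proof (rule some_equality)
    fix n' assume "n' \<in> N \<and> (\<exists>c'\<in>C. n \<oplus>\<^bsub>B\<^esub> c = n' \<oplus>\<^bsub>B\<^esub> c')"
    then obtain c' where n': "n' \<in> N" "c' \<in> C" "n \<oplus>\<^bsub>B\<^esub> c = n' \<oplus>\<^bsub>B\<^esub> c'" by blast
    have "c = \<ominus>\<^bsub>B\<^esub> n \<oplus>\<^bsub>B\<^esub> (n' \<oplus>\<^bsub>B\<^esub> c')"
      using n' n inN inC by (simp add: B.r_neg1 n'(3)[symmetric])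
    then have "c \<oplus>\<^bsub>B\<^esub> \<ominus>\<^bsub>B\<^esub> c' = \<ominus>\<^bsub>B\<^esub> n \<oplus>\<^bsub>B\<^esub> n'"
      using n' n inN inC by (simp add: B.a_assoc B.r_neg)
    then have "n' \<oplus>\<^bsub>B\<^esub> \<ominus>\<^bsub>B\<^esub> n = c \<oplus>\<^bsub>B\<^esub> \<ominus>\<^bsub>B\<^esub> c'"
      using n' n inN inC by (simp add: B.a_comm)
    then have "n' \<oplus>\<^bsub>B\<^esub> \<ominus>\<^bsub>B\<^esub> n \<in> N \<inter> C" by (metis IntI NE(3,5) CE(3,5) n n'(1,2))
    then have "n' \<oplus>\<^bsub>B\<^esub> \<ominus>\<^bsub>B\<^esub> n = \<zero>\<^bsub>B\<^esub>" using C by blast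
    then show "n' = n" using n n' inN by (metis B.minus_equality B.minus_minus B.add.inv_closed B.a_inv_closed)
  qed (use n in blast)
  define g where "g b = f (p b)" for b
  have "g \<in> module_hom F B U"
  proof (rule module_homI)
    fix x assume "x \<in> carrier B"
    then obtain n c where x: "n \<in> N" "c \<in> C" "x = n \<oplus>\<^bsub>B\<^esub> c" using sum by blast
    then show "g x \<in> carrier U" using module_homD(1)[OF f] by (simp add: g_def p_eq)
    { fix y assume "y \<in> carrier B"
      then obtain n' c' where y: "n' \<in> N" "c' \<in> C" "y = n' \<oplus>\<^bsub>B\<^esub> c'" using sum by blast
      have "x \<oplus>\<^bsub>B\<^esub> y = (n \<oplus>\<^bsub>B\<^esub> n') \<oplus>\<^bsub>B\<^esub> (c \<oplus>\<^bsub>B\<^esub> c')"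
        using x y inN inC by (simp add: B.a_ac)
      then show "g (x \<oplus>\<^bsub>B\<^esub> y) = g x \<oplus>\<^bsub>U\<^esub> g y"
        using x y module_homD(2)[OF f] NE(5) CE(5) by (simp add: g_def p_eq) }
    { fix a assume a: "a \<in> carrier F"
      have "a \<odot>\<^bsub>B\<^esub> x = a \<odot>\<^bsub>B\<^esub> n \<oplus>\<^bsub>B\<^esub> a \<odot>\<^bsub>B\<^esub> c" using x a inN inC by (simp add: B.smult_r_distr)
      then show "g (a \<odot>\<^bsub>B\<^esub> x) = a \<odot>\<^bsub>U\<^esub> g x"
        using x a module_homD(3)[OF f] NE(4) CE(4) by (simp add: g_def p_eq) }
  qed
  moreover have "g x = f x" if "x \<in> N" for x
    using p_eq[OF that z(1)] that inN by (simp add: g_def)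
  ultimately show ?thesis using that by blast
qed

section \<open>The cobar resolution\<close>

text \<open>The setting of the cobar resolution: \<open>R\<close> is an algebra over the field \<open>K\<close>, given
  as a subset of its carrier.\<close>

locale module_over_subfield = module R M
  for R (structure) and M :: "('a, 'c) module" (structure) +
  fixes K
  assumes K_sub: "K \<subseteq> carrier R" and K_field: "field (R\<lparr>carrier := K\<rparr>)"
begin

text \<open>Extension by zero of a function of a non-empty list, given as a function of its first entry
  and its tail. The value zero outside the carrier makes multilinear maps unique as functions on all
  lists.\<close>

definition pack :: "('a \<Rightarrow> 'a list \<Rightarrow> 'c) \<Rightarrow> 'a list \<Rightarrow> 'c" where
  "pack g l = (case l of [] \<Rightarrow> \<zero>\<^bsub>M\<^esub> | s # r \<Rightarrow> if s \<in> carrier R then g s r else \<zero>\<^bsub>M\<^esub>)"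

lemma pack_simps [simp]:
  "pack g [] = \<zero>\<^bsub>M\<^esub>" "s \<in> carrier R \<Longrightarrow> pack g (s # r) = g s r"
  "s \<notin> carrier R \<Longrightarrow> pack g (s # r) = \<zero>\<^bsub>M\<^esub>"
  by (simp_all add: pack_def)

text \<open>The \<open>K\<close>-multilinear maps in \<open>p\<close> arguments from \<open>R\<close> to \<open>M\<close>, one argument being
  split off at a time. For \<open>p = 0\<close> these are the elements of \<open>M\<close>.\<close>

primrec multilin :: "nat \<Rightarrow> ('a list \<Rightarrow> 'c) set" where
  "multilin 0 = {f. f [] \<in> carrier M \<and> (\<forall>s r. f (s # r) = \<zero>\<^bsub>M\<^esub>)}"
| "multilin (Suc p) = {f. f [] = \<zero>\<^bsub>M\<^esub> \<and> (\<forall>s r. s \<notin> carrier R \<longrightarrow> f (s # r) = \<zero>\<^bsub>M\<^esub>) \<and>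
     (\<forall>s\<in>carrier R. (\<lambda>r. f (s # r)) \<in> multilin p) \<and>
     (\<forall>s\<in>carrier R. \<forall>t\<in>carrier R. \<forall>r. f ((s \<oplus> t) # r) = f (s # r) \<oplus>\<^bsub>M\<^esub> f (t # r)) \<and>
     (\<forall>c\<in>K. \<forall>s\<in>carrier R. \<forall>r. f ((c \<otimes> s) # r) = c \<odot>\<^bsub>M\<^esub> f (s # r))}"

lemma KR: "c \<in> K \<Longrightarrow> c \<in> carrier R"
  using K_sub by blast

lemma multilin_range: "f \<in> multilin p \<Longrightarrow> f l \<in> carrier M"
proof (induction p arbitrary: f l)
  case 0
  then show ?case by (cases l) auto
next
  case (Suc p)
  show ?case
  proof (cases l)
    case Nil
    then show ?thesis using Suc.prems by simp
  next
    case (Cons s r)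
    then show ?thesis using Suc.prems Suc.IH[of "\<lambda>r. f (s # r)" r]
      by (cases "s \<in> carrier R") auto
  qed
qed

lemma multilin_slice: "f \<in> multilin (Suc p) \<Longrightarrow> s \<in> carrier R \<Longrightarrow> (\<lambda>r. f (s # r)) \<in> multilin p"
  by simp

lemma multilin_scalar:
  "f \<in> multilin (Suc p) \<Longrightarrow> c \<in> K \<Longrightarrow> s \<in> carrier R \<Longrightarrow> f ((c \<otimes> s) # r) = c \<odot>\<^bsub>M\<^esub> f (s # r)"
  by simp

lemma pack_multilin:
  assumes "\<And>s. s \<in> carrier R \<Longrightarrow> g s \<in> multilin p"
    and "\<And>s t r. s \<in> carrier R \<Longrightarrow> t \<in> carrier R \<Longrightarrow> g (s \<oplus> t) r = g s r \<oplus>\<^bsub>M\<^esub> g t r"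
    and "\<And>c s r. c \<in> K \<Longrightarrow> s \<in> carrier R \<Longrightarrow> g (c \<otimes> s) r = c \<odot>\<^bsub>M\<^esub> g s r"
  shows "pack g \<in> multilin (Suc p)"
  using assms KR by simp

lemma multilin_zero: "(\<lambda>_. \<zero>\<^bsub>M\<^esub>) \<in> multilin p"
  by (induction p) (auto simp: KR)

lemma multilin_add: "f \<in> multilin p \<Longrightarrow> g \<in> multilin p \<Longrightarrow> (\<lambda>l. f l \<oplus>\<^bsub>M\<^esub> g l) \<in> multilin p"
proof (induction p arbitrary: f g)
  case (Suc p)
  have r: "f l \<in> carrier M" "g l \<in> carrier M" for l using Suc.prems multilin_range by blast+
  show ?case using Suc.prems Suc.IH r by (auto simp: M.a_ac smult_r_distr KR)
qed auto

lemma multilin_smult: "f \<in> multilin p \<Longrightarrow> a \<in> carrier R \<Longrightarrow> (\<lambda>l. a \<odot>\<^bsub>M\<^esub> f l) \<in> multilin p"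
proof (induction p arbitrary: f)
  case (Suc p)
  have r: "f l \<in> carrier M" for l using Suc.prems multilin_range by blast
  show ?case using Suc.prems Suc.IH r
    by (auto simp: smult_r_distr KR smult_assoc1[symmetric] R.m_comm)
qed auto

lemma multilin_neg: "f \<in> multilin p \<Longrightarrow> (\<lambda>l. \<ominus>\<^bsub>M\<^esub> f l) \<in> multilin p"
  using multilin_smult[of f p "\<ominus> \<one>"] multilin_range[of f p] by (simp add: smult_l_minus)

lemma multilin_minus: "f \<in> multilin p \<Longrightarrow> g \<in> multilin p \<Longrightarrow> (\<lambda>l. f l \<ominus>\<^bsub>M\<^esub> g l) \<in> multilin p"
  unfolding a_minus_def by (intro multilin_add multilin_neg)

definition multilin_space :: "nat \<Rightarrow> ('a, 'a list \<Rightarrow> 'c) module" where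
  "multilin_space p = \<lparr>carrier = multilin p, mult = undefined, one = undefined,
     zero = (\<lambda>_. \<zero>\<^bsub>M\<^esub>), add = (\<lambda>f g l. f l \<oplus>\<^bsub>M\<^esub> g l), smult = (\<lambda>c f l. c \<odot>\<^bsub>M\<^esub> f l)\<rparr>"

text \<open>\<open>R\<close> acts on multilinear maps through their first argument.\<close>

definition act :: "'a \<Rightarrow> ('a list \<Rightarrow> 'c) \<Rightarrow> 'a list \<Rightarrow> 'c" where
  "act a f = pack (\<lambda>s r. f ((a \<otimes> s) # r))"

definition cobar :: "nat \<Rightarrow> ('a, 'a list \<Rightarrow> 'c) module" where
  "cobar p = \<lparr>carrier = multilin (Suc p), mult = undefined, one = undefined,
     zero = (\<lambda>_. \<zero>\<^bsub>M\<^esub>), add = (\<lambda>f g l. f l \<oplus>\<^bsub>M\<^esub> g l), smult = act\<rparr>"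

lemma abelian_group_multilin:
  assumes "carrier N = multilin p" "zero N = (\<lambda>_. \<zero>\<^bsub>M\<^esub>)" "add N = (\<lambda>f g l. f l \<oplus>\<^bsub>M\<^esub> g l)"
  shows "abelian_group N"
proof (rule abelian_groupI)
  fix f assume "f \<in> carrier N"
  then show "\<exists>g\<in>carrier N. g \<oplus>\<^bsub>N\<^esub> f = \<zero>\<^bsub>N\<^esub>" using multilin_neg[of f p] multilin_range[of f p]
    by (intro bexI[of _ "\<lambda>l. \<ominus>\<^bsub>M\<^esub> f l"]) (auto simp: assms M.l_neg)
qed (auto simp: assms multilin_zero multilin_add multilin_range M.a_ac)

lemma module_multilin_space: "module (R\<lparr>carrier := K\<rparr>) (multilin_space p)"
proof -
  interpret F: field "R\<lparr>carrier := K\<rparr>" by (rule K_field)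
  show ?thesis
    by (intro moduleI F.is_cring abelian_group_multilin[of _ p])
       (auto simp: multilin_space_def KR multilin_smult multilin_range smult_l_distr smult_r_distr
        smult_assoc1)
qed

lemma act_closed:
  assumes "f \<in> multilin (Suc p)" "a \<in> carrier R"
  shows "act a f \<in> multilin (Suc p)"
  unfolding act_def using assms
  by (intro pack_multilin) (auto simp: R.r_distr R.m_lcomm[of a] KR)

lemma module_cobar: "module R (cobar p)"
proof (rule moduleI)
  show "abelian_group (cobar p)" by (rule abelian_group_multilin[of _ "Suc p"]) (auto simp: cobar_def)
next
  fix a f assume "a \<in> carrier R" "f \<in> carrier (cobar p)"
  then show "a \<odot>\<^bsub>cobar p\<^esub> f \<in> carrier (cobar p)" unfolding cobar_def using act_closed by auto
next
  fix a b f assume "a \<in> carrier R" "b \<in> carrier R" "f \<in> carrier (cobar p)"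
  then show "(a \<oplus> b) \<odot>\<^bsub>cobar p\<^esub> f = a \<odot>\<^bsub>cobar p\<^esub> f \<oplus>\<^bsub>cobar p\<^esub> b \<odot>\<^bsub>cobar p\<^esub> f"
    by (auto simp: cobar_def act_def pack_def fun_eq_iff R.l_distr split: list.split)
next
  fix a b f assume "a \<in> carrier R" "b \<in> carrier R" "f \<in> carrier (cobar p)"
  then show "(a \<otimes> b) \<odot>\<^bsub>cobar p\<^esub> f = a \<odot>\<^bsub>cobar p\<^esub> (b \<odot>\<^bsub>cobar p\<^esub> f)"
    by (auto simp: cobar_def act_def pack_def fun_eq_iff R.m_assoc R.m_lcomm R.m_comm split: list.split)
next
  fix a f g assume "a \<in> carrier R" "f \<in> carrier (cobar p)" "g \<in> carrier (cobar p)"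
  then show "a \<odot>\<^bsub>cobar p\<^esub> (f \<oplus>\<^bsub>cobar p\<^esub> g) = a \<odot>\<^bsub>cobar p\<^esub> f \<oplus>\<^bsub>cobar p\<^esub> a \<odot>\<^bsub>cobar p\<^esub> g"
    by (auto simp: cobar_def act_def pack_def fun_eq_iff split: list.split)
next
  fix f assume "f \<in> carrier (cobar p)"
  then show "\<one> \<odot>\<^bsub>cobar p\<^esub> f = f"
    by (auto simp: cobar_def act_def pack_def fun_eq_iff split: list.split)
qed (rule R.is_cring)

text \<open>A homomorphism into the \<open>R\<close>-module \<open>Hom\<^sub>K(R, U)\<close> amounts to a \<open>K\<close>-linear map into
  \<open>U\<close>, obtained by evaluating at \<open>1\<close>; and \<open>K\<close>-linear maps extend from subspaces.\<close>

lemma cobar_injective: "injective_module R (cobar p)"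
  unfolding injective_module_def
proof (intro conjI allI impI ballI module_cobar)
  fix B :: "('a, 'a) module" and N f
  assume BN: "module R B \<and> submodule N R B" and f: "f \<in> module_hom R (B\<lparr>carrier := N\<rparr>) (cobar p)"
  interpret F: field "R\<lparr>carrier := K\<rparr>" by (rule K_field)
  interpret B: module R B using BN by blast
  have BF: "module (R\<lparr>carrier := K\<rparr>) B"
    by (intro moduleI F.is_cring B.M.abelian_group_axioms)
       (auto simp: KR B.smult_l_distr B.smult_r_distr B.smult_assoc1)
  have NF: "submodule N (R\<lparr>carrier := K\<rparr>) B"
    using BN by (auto simp: submodule_def submodule_axioms_def KR)
  note NE = B.submoduleE[OF conjunct2[OF BN]]
  have fN: "f n \<in> multilin (Suc p)" if "n \<in> N" for n
    using module_homD(1)[OF f, of n] that by (simp add: cobar_def)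
  have "(\<lambda>n l. f n (\<one> # l)) \<in> module_hom (R\<lparr>carrier := K\<rparr>) (B\<lparr>carrier := N\<rparr>) (multilin_space p)"
  proof (rule module_homI)
    fix x assume x: "x \<in> carrier (B\<lparr>carrier := N\<rparr>)"
    then show "(\<lambda>l. f x (\<one> # l)) \<in> carrier (multilin_space p)"
      using fN[of x] by (simp add: multilin_space_def)
    fix c assume c: "c \<in> carrier (R\<lparr>carrier := K\<rparr>)"
    then show "(\<lambda>l. f (c \<odot>\<^bsub>B\<lparr>carrier := N\<rparr>\<^esub> x) (\<one> # l)) = c \<odot>\<^bsub>multilin_space p\<^esub> (\<lambda>l. f x (\<one> # l))"
      using module_homD(3)[OF f, of c x] x multilin_scalar[OF fN[of x], of c \<one>]
      by (auto simp: multilin_space_def cobar_def act_def KR)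
  next
    fix x y assume "x \<in> carrier (B\<lparr>carrier := N\<rparr>)" "y \<in> carrier (B\<lparr>carrier := N\<rparr>)"
    then show "(\<lambda>l. f (x \<oplus>\<^bsub>B\<lparr>carrier := N\<rparr>\<^esub> y) (\<one> # l))
        = (\<lambda>l. f x (\<one> # l)) \<oplus>\<^bsub>multilin_space p\<^esub> (\<lambda>l. f y (\<one> # l))"
      using module_homD(2)[OF f, of x y] by (simp add: multilin_space_def cobar_def)
  qed
  then obtain h where h: "h \<in> module_hom (R\<lparr>carrier := K\<rparr>) B (multilin_space p)"
    and hN: "\<And>n. n \<in> N \<Longrightarrow> h n = (\<lambda>l. f n (\<one> # l))"
    using linear_map_extends[OF K_field BF module_multilin_space NF] by metis
  note hD = module_homD[OF h, unfolded multilin_space_def, simplified]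
  define g where "g b = pack (\<lambda>s. h (s \<odot>\<^bsub>B\<^esub> b))" for b
  have "g \<in> module_hom R B (cobar p)"
  proof (rule module_homI)
    fix b assume b: "b \<in> carrier B"
    show "g b \<in> carrier (cobar p)" unfolding cobar_def g_def using b
      by (simp del: multilin.simps, intro pack_multilin)
         (auto simp: hD B.smult_l_distr B.smult_assoc1 KR)
    fix a assume a: "a \<in> carrier R"
    show "g (a \<odot>\<^bsub>B\<^esub> b) = a \<odot>\<^bsub>cobar p\<^esub> g b" using a b
      by (auto simp: cobar_def g_def act_def pack_def fun_eq_iff B.smult_assoc1[symmetric] R.m_comm split: list.split)
  next
    fix b c assume "b \<in> carrier B" "c \<in> carrier B"
    then show "g (b \<oplus>\<^bsub>B\<^esub> c) = g b \<oplus>\<^bsub>cobar p\<^esub> g c"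
      by (auto simp: cobar_def g_def pack_def fun_eq_iff B.smult_r_distr hD split: list.split)
  qed
  moreover have "g n = f n" if n: "n \<in> N" for n
  proof
    fix l
    show "g n l = f n l"
    proof (cases l)
      case Nil
      then show ?thesis using fN[OF n] by (simp add: g_def)
    next
      case (Cons s r)
      show ?thesis
      proof (cases "s \<in> carrier R")
        case True
        then show ?thesis using Cons n NE(4) module_homD(3)[OF f, of s n]
          by (simp add: g_def hN cobar_def act_def)
      next
        case False
        then show ?thesis using Cons fN[OF n] by (simp add: g_def)
      qed
    qed
  qed
  ultimately show "\<exists>g\<in>module_hom R B (cobar p). \<forall>x\<in>N. g x = f x" by blast
qed

text \<open>The usual differential, with alternating signs, of the cobar complex: neighbouring
  arguments are multiplied together, and in the last term the last argument acts on the value. The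
  recursion splits off the first argument \<open>s\<close>; the first of the alternating terms is
  \<open>act s f\<close>. In degree \<open>0\<close> it is the embedding of \<open>M\<close>, sending \<open>m\<close> to \<open>s \<mapsto> s m\<close>.\<close>

primrec cobar_diff :: "nat \<Rightarrow> ('a list \<Rightarrow> 'c) \<Rightarrow> 'a list \<Rightarrow> 'c" where
  "cobar_diff 0 f = pack (\<lambda>s r. if r = [] then s \<odot>\<^bsub>M\<^esub> f [] else \<zero>\<^bsub>M\<^esub>)"
| "cobar_diff (Suc p) f = pack (\<lambda>s r. act s f r \<ominus>\<^bsub>M\<^esub> cobar_diff p (\<lambda>r. f (s # r)) r)"

lemma pack_cong: "(\<And>s r. s \<in> carrier R \<Longrightarrow> g s r = h s r) \<Longrightarrow> pack g = pack h"
  by (auto simp: pack_def fun_eq_iff split: list.split)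

lemma act_add: "act a (\<lambda>l. f l \<oplus>\<^bsub>M\<^esub> g l) = (\<lambda>l. act a f l \<oplus>\<^bsub>M\<^esub> act a g l)"
  by (auto simp: act_def pack_def fun_eq_iff split: list.split)

lemma act_smult: "c \<in> carrier R \<Longrightarrow> act a (\<lambda>l. c \<odot>\<^bsub>M\<^esub> f l) = (\<lambda>l. c \<odot>\<^bsub>M\<^esub> act a f l)"
  by (auto simp: act_def pack_def fun_eq_iff split: list.split)

text \<open>The three claims are proved together, as linearity in the first argument of a differential
  rests on additivity and homogeneity one step below.\<close>

lemma cobar_diff_closed_linear:
  "(\<forall>f \<in> multilin p. cobar_diff p f \<in> multilin (Suc p)) \<and>
   (\<forall>f \<in> multilin p. \<forall>g \<in> multilin p. \<forall>l. cobar_diff p (\<lambda>l. f l \<oplus>\<^bsub>M\<^esub> g l) l = cobar_diff p f l \<oplus>\<^bsub>M\<^esub> cobar_diff p g l) \<and>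
   (\<forall>f \<in> multilin p. \<forall>c \<in> carrier R. \<forall>l. cobar_diff p (\<lambda>l. c \<odot>\<^bsub>M\<^esub> f l) l = c \<odot>\<^bsub>M\<^esub> cobar_diff p f l)"
proof (induction p)
  case 0
  show ?case
    by (auto simp: pack_def smult_r_distr smult_l_distr smult_assoc1[symmetric] R.m_comm KR split: list.split)
next
  case (Suc p)
  note cl = conjunct1[OF Suc.IH, rule_format] and ad = conjunct1[OF conjunct2[OF Suc.IH], rule_format]
    and sm = conjunct2[OF conjunct2[OF Suc.IH], rule_format]
  have ra: "act s f r \<in> carrier M" if "f \<in> multilin (Suc p)" "s \<in> carrier R" for s f r
    using multilin_range[OF act_closed] that by blast
  have rd: "cobar_diff p (\<lambda>r. f (s # r)) r \<in> carrier M" if "f \<in> multilin (Suc p)" "s \<in> carrier R" for s f r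
    using multilin_range[OF cl] multilin_slice that by blast
  show ?case
  proof (intro conjI ballI allI)
    fix f assume f: "f \<in> multilin (Suc p)"
    show "cobar_diff (Suc p) f \<in> multilin (Suc (Suc p))" unfolding cobar_diff.simps
    proof (rule pack_multilin)
      fix s t r assume s: "s \<in> carrier R" and t: "t \<in> carrier R"
      have "(\<lambda>r. f ((s \<oplus> t) # r)) = (\<lambda>r. f (s # r) \<oplus>\<^bsub>M\<^esub> f (t # r))" using f s t by simp
      moreover have "act (s \<oplus> t) f r = act s f r \<oplus>\<^bsub>M\<^esub> act t f r"
        using f s t by (cases r; cases "hd r \<in> carrier R") (auto simp: act_def R.l_distr)
      ultimately show "act (s \<oplus> t) f r \<ominus>\<^bsub>M\<^esub> cobar_diff p (\<lambda>r. f ((s \<oplus> t) # r)) r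
        = (act s f r \<ominus>\<^bsub>M\<^esub> cobar_diff p (\<lambda>r. f (s # r)) r) \<oplus>\<^bsub>M\<^esub> (act t f r \<ominus>\<^bsub>M\<^esub> cobar_diff p (\<lambda>r. f (t # r)) r)"
        using ra[OF f] rd[OF f] s t f ad[OF multilin_slice[OF f] multilin_slice[OF f]]
        by (simp add: a_minus_def M.minus_add M.a_ac)
    next
      fix s r c assume s: "s \<in> carrier R" and c: "c \<in> K"
      have "(\<lambda>r. f ((c \<otimes> s) # r)) = (\<lambda>r. c \<odot>\<^bsub>M\<^esub> f (s # r))" using f s c by simp
      moreover have "act (c \<otimes> s) f r = c \<odot>\<^bsub>M\<^esub> act s f r"
        using f s c by (cases r; cases "hd r \<in> carrier R") (auto simp: act_def R.m_assoc KR)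
      ultimately show "act (c \<otimes> s) f r \<ominus>\<^bsub>M\<^esub> cobar_diff p (\<lambda>r. f ((c \<otimes> s) # r)) r
        = c \<odot>\<^bsub>M\<^esub> (act s f r \<ominus>\<^bsub>M\<^esub> cobar_diff p (\<lambda>r. f (s # r)) r)"
        using ra[OF f] rd[OF f] s c f sm[OF multilin_slice[OF f]]
        by (simp add: a_minus_def smult_r_distr smult_r_minus KR)
    qed (intro multilin_minus act_closed cl multilin_slice f)
  next
    fix f g l assume f: "f \<in> multilin (Suc p)" and g: "g \<in> multilin (Suc p)"
    show "cobar_diff (Suc p) (\<lambda>l. f l \<oplus>\<^bsub>M\<^esub> g l) l = cobar_diff (Suc p) f l \<oplus>\<^bsub>M\<^esub> cobar_diff (Suc p) g l"
      using ra[OF f] rd[OF f] ra[OF g] rd[OF g] ad[OF multilin_slice[OF f] multilin_slice[OF g]]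
      by (cases l; cases "hd l \<in> carrier R") (auto simp: act_add a_minus_def M.minus_add M.a_ac)
  next
    fix f c l assume f: "f \<in> multilin (Suc p)" and c: "c \<in> carrier R"
    show "cobar_diff (Suc p) (\<lambda>l. c \<odot>\<^bsub>M\<^esub> f l) l = c \<odot>\<^bsub>M\<^esub> cobar_diff (Suc p) f l"
      using ra[OF f] rd[OF f] sm[OF multilin_slice[OF f]] c
      by (cases l; cases "hd l \<in> carrier R") (auto simp: act_smult a_minus_def smult_r_distr smult_r_minus)
  qed
qed

lemmas cobar_diff_closed = cobar_diff_closed_linear[THEN conjunct1, rule_format]
lemmas cobar_diff_add = cobar_diff_closed_linear[THEN conjunct2, THEN conjunct1, rule_format]
lemmas cobar_diff_smult = cobar_diff_closed_linear[THEN conjunct2, THEN conjunct2, rule_format]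

lemma cobar_diff_minus:
  assumes f: "f \<in> multilin p" and g: "g \<in> multilin p"
  shows "cobar_diff p (\<lambda>l. f l \<ominus>\<^bsub>M\<^esub> g l) l = cobar_diff p f l \<ominus>\<^bsub>M\<^esub> cobar_diff p g l"
proof -
  have "(\<lambda>l. \<ominus>\<^bsub>M\<^esub> g l) = (\<lambda>l. (\<ominus> \<one>) \<odot>\<^bsub>M\<^esub> g l)"
    using multilin_range[OF g] by (simp add: smult_l_minus)
  then have "cobar_diff p (\<lambda>l. \<ominus>\<^bsub>M\<^esub> g l) l = \<ominus>\<^bsub>M\<^esub> cobar_diff p g l"
    using cobar_diff_smult[OF g, of "\<ominus> \<one>" l] multilin_range[OF cobar_diff_closed[OF g]]
    by (simp add: smult_l_minus)
  then show ?thesis using cobar_diff_add[OF f multilin_neg[OF g]] by (simp add: a_minus_def)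
qed

lemma cobar_diff_act:
  assumes f: "f \<in> multilin (Suc p)" and s: "s \<in> carrier R"
  shows "cobar_diff (Suc p) (act s f) = act s (cobar_diff (Suc p) f)"
proof
  fix l
  show "cobar_diff (Suc p) (act s f) l = act s (cobar_diff (Suc p) f) l"
  proof (cases l)
    case (Cons t r)
    show ?thesis
    proof (cases "t \<in> carrier R")
      case True
      have "act t (act s f) = act (s \<otimes> t) f"
        unfolding act_def using s True by (auto intro!: pack_cong simp: R.m_assoc)
      then show ?thesis using True s Cons by (simp add: act_def)
    qed (simp add: Cons act_def)
  qed (simp add: act_def)
qed

text \<open>With the first argument \<open>s\<close> fixed, the double differential is
  \<open>act s (d f) - d (act s f) + d (d (f s))\<close>. The first two terms cancel by linearity over \<open>R\<close> and
  the last one vanishes by induction.\<close>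

lemma cobar_diff_diff: "f \<in> multilin p \<Longrightarrow> cobar_diff (Suc p) (cobar_diff p f) l = \<zero>\<^bsub>M\<^esub>"
proof (induction p arbitrary: f l)
  case 0
  show ?case
  proof (cases l)
    case (Cons s r)
    show ?thesis
    proof (cases "s \<in> carrier R")
      case s: True
      show ?thesis using Cons s 0
        by (cases r; cases "hd r \<in> carrier R")
           (auto simp: act_def pack_def smult_assoc1[symmetric] R.m_comm a_minus_def M.r_neg)
    qed (simp add: Cons)
  qed simp
next
  case (Suc p)
  show ?case
  proof (cases l)
    case (Cons s r)
    show ?thesis
    proof (cases "s \<in> carrier R")
      case s: True
      let ?fs = "\<lambda>r. f (s # r)"
      have fs: "?fs \<in> multilin p" using Suc.prems s by simp
      have "cobar_diff (Suc (Suc p)) (cobar_diff (Suc p) f) l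
         = act s (cobar_diff (Suc p) f) r \<ominus>\<^bsub>M\<^esub> cobar_diff (Suc p) (\<lambda>r. act s f r \<ominus>\<^bsub>M\<^esub> cobar_diff p ?fs r) r"
        using Cons s by simp
      also have "cobar_diff (Suc p) (\<lambda>r. act s f r \<ominus>\<^bsub>M\<^esub> cobar_diff p ?fs r) r
         = act s (cobar_diff (Suc p) f) r"
        using cobar_diff_minus[OF act_closed[OF Suc.prems s] cobar_diff_closed[OF fs]]
          Suc.IH[OF fs] cobar_diff_act[OF Suc.prems s]
          multilin_range[OF act_closed[OF cobar_diff_closed[OF Suc.prems] s]]
        by (simp add: a_minus_def del: cobar_diff.simps)
      finally show ?thesis
        using multilin_range[OF act_closed[OF cobar_diff_closed[OF Suc.prems] s]]
        by (simp add: a_minus_def M.r_neg del: cobar_diff.simps)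
    qed (simp add: Cons)
  qed simp
qed

text \<open>Inserting \<open>1\<close> as the first argument is a contracting homotopy of the complex. It is only
  linear over \<open>K\<close>, but that is enough for exactness.\<close>

lemma cobar_diff_contraction:
  assumes f: "f \<in> multilin (Suc p)"
  shows "cobar_diff (Suc p) f (\<one> # l) = f l \<ominus>\<^bsub>M\<^esub> cobar_diff p (\<lambda>r. f (\<one> # r)) l"
proof -
  have "act \<one> f l = f l" using f by (cases l; cases "hd l \<in> carrier R") (auto simp: act_def)
  then show ?thesis by simp
qed

text \<open>Exactness follows from the contracting homotopy: a cocycle \<open>f\<close> is the differential of
  \<open>f (1, \<dots>)\<close>.\<close>

theorem cobar_resolution:
  "injective_resolution R M cobar (\<lambda>m. cobar_diff 0 (\<lambda>l. if l = [] then m else \<zero>\<^bsub>M\<^esub>)) (\<lambda>p. cobar_diff (Suc p))"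
proof -
  have hom: "cobar_diff (Suc p) \<in> module_hom R (cobar p) (cobar (Suc p))" for p
    by (rule module_homI)
       (auto simp: cobar_def cobar_diff_closed cobar_diff_act cobar_diff_add simp del: cobar_diff.simps multilin.simps)
  have exact: "cobar_diff p ` multilin p = {f \<in> multilin (Suc p). cobar_diff (Suc p) f = (\<lambda>_. \<zero>\<^bsub>M\<^esub>)}" for p
  proof (intro equalityI subsetI)
    fix f assume "f \<in> {f \<in> multilin (Suc p). cobar_diff (Suc p) f = (\<lambda>_. \<zero>\<^bsub>M\<^esub>)}"
    then have f: "f \<in> multilin (Suc p)" "cobar_diff (Suc p) f (\<one> # l) = \<zero>\<^bsub>M\<^esub>" for l by auto
    have h: "(\<lambda>r. f (\<one> # r)) \<in> multilin p" using f(1) by simp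
    have "f l = cobar_diff p (\<lambda>r. f (\<one> # r)) l" for l
      using f(2)[of l] cobar_diff_contraction[OF f(1), of l] multilin_range[OF f(1)]
        multilin_range[OF cobar_diff_closed[OF h]] by (metis M.diff_eq_zero_iff)
    then show "f \<in> cobar_diff p ` multilin p" using h by blast
  qed (auto simp: cobar_diff_closed cobar_diff_diff fun_eq_iff simp del: cobar_diff.simps multilin.simps)
  have in0: "(\<lambda>l. if l = [] then m else \<zero>\<^bsub>M\<^esub>) \<in> multilin 0" if "m \<in> carrier M" for m
    using that by simp
  have im0: "(\<lambda>m l. if l = [] then m else \<zero>\<^bsub>M\<^esub>) ` carrier M = multilin 0"
  proof (intro equalityI subsetI)
    fix f assume "f \<in> multilin 0"
    then show "f \<in> (\<lambda>m l. if l = [] then m else \<zero>\<^bsub>M\<^esub>) ` carrier M"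
      by (intro image_eqI[of _ _ "f []"]) (auto simp: fun_eq_iff neq_Nil_conv)
  qed auto
  let ?e = "\<lambda>m. cobar_diff 0 (\<lambda>l. if l = [] then m else \<zero>\<^bsub>M\<^esub>)"
  have "?e \<in> module_hom R M (cobar 0)"
    by (rule module_homI)
       (auto simp: cobar_def pack_def act_def fun_eq_iff smult_l_distr smult_r_distr smult_assoc1[symmetric] R.m_comm KR split: list.split)
  moreover have "inj_on ?e (carrier M)"
  proof (rule inj_onI)
    fix x y assume xy: "x \<in> carrier M" "y \<in> carrier M" and e: "?e x = ?e y"
    have ev: "?e z [\<one>] = z" if "z \<in> carrier M" for z using that by simp
    from fun_cong[OF e] have "?e x [\<one>] = ?e y [\<one>]" .
    then show "x = y" unfolding ev[OF xy(1)] ev[OF xy(2)] .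
  qed
  moreover have "?e ` carrier M = cobar_diff 0 ` multilin 0"
    unfolding im0[symmetric] by (simp add: image_image)
  moreover have "carrier (cobar p) = multilin (Suc p)" "\<zero>\<^bsub>cobar p\<^esub> = (\<lambda>_. \<zero>\<^bsub>M\<^esub>)" for p
    by (simp_all add: cobar_def del: multilin.simps)
  ultimately show ?thesis
    unfolding injective_resolution_def a_kernel_def' using cobar_injective hom
    by (simp only: exact) blast
qed

end

section \<open>Koszul cochains\<close>

lemma (in abelian_group) neg_zero [simp]: "\<ominus> \<zero> = \<zero>"
  by (rule minus_equality) auto

lemma subseq_set: "subseq r s \<Longrightarrow> set r \<subseteq> set s"
  by (auto elim: list_emb_set)

text \<open>Koszul cochains assign elements of \<open>M\<close> to sequences of indices, which later will be the
  increasing enumerations of subsets of \<open>W\<close>. The recursion is the usual alternating sum with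
  the first index split off. It avoids finite sums in the module and makes each identity below a
  short induction.\<close>

primrec koszul :: "('a, 'b, 'm) module_scheme \<Rightarrow> ('v \<Rightarrow> 'a) \<Rightarrow> ('v list \<Rightarrow> 'b) \<Rightarrow> 'v list \<Rightarrow> 'b" where
  "koszul M y z [] = \<zero>\<^bsub>M\<^esub>"
| "koszul M y z (a # r) = y a \<odot>\<^bsub>M\<^esub> z r \<ominus>\<^bsub>M\<^esub> koszul M y (\<lambda>s. z (a # s)) r"

primrec list_mult :: "('a, 'm) ring_scheme \<Rightarrow> ('v \<Rightarrow> 'a) \<Rightarrow> 'v list \<Rightarrow> 'a" where
  "list_mult R y [] = \<one>\<^bsub>R\<^esub>"
| "list_mult R y (a # r) = y a \<otimes>\<^bsub>R\<^esub> list_mult R y r"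

abbreviation koszul_pow ::
  "('a, 'r) ring_scheme \<Rightarrow> ('a, 'b, 'm) module_scheme \<Rightarrow> ('v \<Rightarrow> 'a) \<Rightarrow> nat \<Rightarrow> ('v list \<Rightarrow> 'b) \<Rightarrow> 'v list \<Rightarrow> 'b" where
  "koszul_pow R M y k \<equiv> koszul M (\<lambda>v. y v [^]\<^bsub>R\<^esub> k)"

abbreviation pow_mult :: "('a, 'r) ring_scheme \<Rightarrow> ('v \<Rightarrow> 'a) \<Rightarrow> nat \<Rightarrow> 'v list \<Rightarrow> 'a" where
  "pow_mult R y l \<equiv> list_mult R (\<lambda>v. y v [^]\<^bsub>R\<^esub> l)"

abbreviation eventually_coboundary ::
  "('a, 'r) ring_scheme \<Rightarrow> ('a, 'b) module \<Rightarrow> ('v \<Rightarrow> 'a) \<Rightarrow> 'v list \<Rightarrow> nat \<Rightarrow> nat \<Rightarrow> ('v list \<Rightarrow> 'b) \<Rightarrow> bool" where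
  "eventually_coboundary R M y ws i k z \<equiv> \<exists>l u. (\<forall>r. u r \<in> carrier M) \<and>
     (\<forall>r. subseq r ws \<longrightarrow> length r = i \<longrightarrow> pow_mult R y l r \<odot>\<^bsub>M\<^esub> z r = koszul_pow R M y (k + l) u r)"

text \<open>Vanishing of the \<open>i\<close>-th cohomology of the direct limit of the Koszul complexes on the powers
  \<open>y v ^ k\<close>, as a statement about cochains: a cocycle for the exponent \<open>k\<close> need not be
  a coboundary, but its image for some exponent \<open>k + l\<close> is one. Cochains are total functions
  into \<open>M\<close>, of which equations on subsequences of \<open>ws\<close> are required.\<close>

definition cech_vanishes ::
  "('a, 'r) ring_scheme \<Rightarrow> ('a, 'b) module \<Rightarrow> ('v \<Rightarrow> 'a) \<Rightarrow> 'v list \<Rightarrow> nat \<Rightarrow> bool" where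
  "cech_vanishes R M y ws i \<longleftrightarrow>
     (\<forall>k::nat. \<forall>z. (\<forall>r. z r \<in> carrier M) \<longrightarrow>
        (\<forall>r. subseq r ws \<longrightarrow> length r = Suc i \<longrightarrow> koszul_pow R M y k z r = \<zero>\<^bsub>M\<^esub>) \<longrightarrow>
        (eventually_coboundary R M y ws i k z))"

lemma cech_vanishesD:
  assumes "cech_vanishes R M y ws i" "\<And>r. z r \<in> carrier M"
    "\<And>r. subseq r ws \<Longrightarrow> length r = Suc i \<Longrightarrow> koszul_pow R M y k z r = \<zero>\<^bsub>M\<^esub>"
  obtains l u where "\<And>r. u r \<in> carrier M"
    "\<And>r. subseq r ws \<Longrightarrow> length r = i \<Longrightarrow>
       pow_mult R y l r \<odot>\<^bsub>M\<^esub> z r = koszul_pow R M y (k + l) u r"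
proof -
  have "eventually_coboundary R M y ws i k z"
    using assms(1)[unfolded cech_vanishes_def, THEN spec[of _ k], THEN spec[of _ z]] assms(2,3) by simp
  then show ?thesis using that by blast
qed

lemma cech_vanishesI:
  assumes "\<And>k z. \<lbrakk>\<And>r. z r \<in> carrier M;
      \<And>r. subseq r ws \<Longrightarrow> length r = Suc i \<Longrightarrow> koszul_pow R M y k z r = \<zero>\<^bsub>M\<^esub>\<rbrakk>
    \<Longrightarrow> eventually_coboundary R M y ws i k z"
  shows "cech_vanishes R M y ws i"
  unfolding cech_vanishes_def by (intro allI impI, rule assms) simp_all

lemma koszul_cong:
  "(\<And>s. subseq s r \<Longrightarrow> Suc (length s) = length r \<Longrightarrow> z s = z' s) \<Longrightarrow> koszul M y z r = koszul M y z' r"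
proof (induction r arbitrary: z z')
  case (Cons a r)
  have "z r = z' r" by (intro Cons.prems) auto
  moreover have "koszul M y (\<lambda>s. z (a # s)) r = koszul M y (\<lambda>s. z' (a # s)) r"
    by (intro Cons.IH Cons.prems) auto
  ultimately show ?case by simp
qed simp

context module begin

lemma koszul_closed:
  "(\<And>v. y v \<in> carrier R) \<Longrightarrow> (\<And>r. z r \<in> carrier M) \<Longrightarrow> koszul M y z r \<in> carrier M"
  by (induction r arbitrary: z) auto

lemma koszul_minus:
  assumes "\<And>v. y v \<in> carrier R"
  shows "(\<And>r. z r \<in> carrier M) \<Longrightarrow> (\<And>r. w r \<in> carrier M) \<Longrightarrow>
    koszul M y (\<lambda>r. z r \<ominus>\<^bsub>M\<^esub> w r) r = koszul M y z r \<ominus>\<^bsub>M\<^esub> koszul M y w r"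
proof (induction r arbitrary: z w)
  case Nil
  then show ?case by (simp add: a_minus_def)
next
  case (Cons a r)
  then show ?case using assms Cons.IH[of "\<lambda>s. z (a # s)" "\<lambda>s. w (a # s)"]
    koszul_closed[of y "\<lambda>s. z (a # s)" r] koszul_closed[of y "\<lambda>s. w (a # s)" r]
    by (simp add: a_minus_def smult_r_distr smult_r_minus M.minus_add M.a_ac)
qed

lemma koszul_smult:
  assumes "\<And>v. y v \<in> carrier R" "c \<in> carrier R"
  shows "(\<And>r. z r \<in> carrier M) \<Longrightarrow> koszul M y (\<lambda>r. c \<odot>\<^bsub>M\<^esub> z r) r = c \<odot>\<^bsub>M\<^esub> koszul M y z r"
proof (induction r arbitrary: z)
  case (Cons a r)
  then show ?case using assms Cons.IH[of "\<lambda>s. z (a # s)"]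
    koszul_closed[of y "\<lambda>s. z (a # s)" r]
    by (simp add: a_minus_def smult_r_distr smult_r_minus smult_assoc1[symmetric] R.m_comm)
qed (use assms in simp)

text \<open>Expanding the inner differential at \<open>a # s\<close> by its recursion leaves
  \<open>y a\<close> times the differential of \<open>z\<close>, which the other term cancels, and a double
  differential over a shorter sequence.\<close>

lemma koszul_koszul:
  assumes y: "\<And>v. y v \<in> carrier R"
  shows "(\<And>r. z r \<in> carrier M) \<Longrightarrow> koszul M y (koszul M y z) r = \<zero>\<^bsub>M\<^esub>"
proof (induction r arbitrary: z)
  case (Cons a r)
  have cl: "koszul M y w r \<in> carrier M" if "\<And>r. w r \<in> carrier M" for w r
    using koszul_closed[of y w r] y that by blast
  have "koszul M y (\<lambda>s. koszul M y z (a # s)) r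
      = koszul M y (\<lambda>s. y a \<odot>\<^bsub>M\<^esub> z s) r \<ominus>\<^bsub>M\<^esub> koszul M y (koszul M y (\<lambda>s. z (a # s))) r"
    using y Cons.prems cl by (simp add: koszul_minus[of y])
  also have "\<dots> = y a \<odot>\<^bsub>M\<^esub> koszul M y z r"
    using y Cons.prems cl Cons.IH[of "\<lambda>s. z (a # s)"] by (simp add: koszul_smult[of y] a_minus_def)
  finally show ?case using y Cons.prems cl by (simp add: a_minus_def M.r_neg)
qed simp

lemma list_mult_closed: "(\<And>v. x v \<in> carrier R) \<Longrightarrow> list_mult R x r \<in> carrier R"
  by (induction r) auto

text \<open>Multiplying each component of a cochain by the product of the \<open>x v\<close> over its indices is a
  map of complexes from the Koszul complex of \<open>y\<close> to that of \<open>x y\<close>. With powers of the same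
  elements, these are the transition maps of the direct system whose limit is the Cech complex.\<close>

lemma koszul_rescale:
  assumes x: "\<And>v. x v \<in> carrier R" and y: "\<And>v. y v \<in> carrier R"
  shows "(\<And>r. z r \<in> carrier M) \<Longrightarrow>
    koszul M (\<lambda>v. x v \<otimes> y v) (\<lambda>r. list_mult R x r \<odot>\<^bsub>M\<^esub> z r) r = list_mult R x r \<odot>\<^bsub>M\<^esub> koszul M y z r"
proof (induction r arbitrary: z)
  case (Cons a r)
  note lm = list_mult_closed[of x, OF x]
  have xy: "x v \<otimes> y v \<in> carrier R" for v using x y by simp
  have "koszul M (\<lambda>v. x v \<otimes> y v) (\<lambda>s. list_mult R x (a # s) \<odot>\<^bsub>M\<^esub> z (a # s)) r
     = x a \<odot>\<^bsub>M\<^esub> koszul M (\<lambda>v. x v \<otimes> y v) (\<lambda>s. list_mult R x s \<odot>\<^bsub>M\<^esub> z (a # s)) r"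
    using x lm Cons.prems by (simp add: koszul_smult[of "\<lambda>v. x v \<otimes> y v", OF xy x, symmetric] smult_assoc1)
  also have "\<dots> = x a \<odot>\<^bsub>M\<^esub> (list_mult R x r \<odot>\<^bsub>M\<^esub> koszul M y (\<lambda>s. z (a # s)) r)"
    using Cons.prems by (simp add: Cons.IH)
  finally show ?case
    using x y lm Cons.prems koszul_closed[of y "\<lambda>s. z (a # s)" r]
    by (simp add: a_minus_def smult_r_distr smult_r_minus smult_assoc1[symmetric] R.m_ac)
qed simp

lemma koszul_power_rescale:
  assumes y: "\<And>v. y v \<in> carrier R" and z: "\<And>r. z r \<in> carrier M"
  shows "koszul M (\<lambda>v. y v [^] (k + l :: nat)) (\<lambda>r. list_mult R (\<lambda>v. y v [^] l) r \<odot>\<^bsub>M\<^esub> z r) r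
    = list_mult R (\<lambda>v. y v [^] l) r \<odot>\<^bsub>M\<^esub> koszul M (\<lambda>v. y v [^] k) z r"
proof -
  have "(\<lambda>v. y v [^] (k + l)) = (\<lambda>v. y v [^] l \<otimes> y v [^] k)"
    using y by (simp add: R.nat_pow_mult add.commute)
  then show ?thesis using koszul_rescale[of "\<lambda>v. y v [^] l" "\<lambda>v. y v [^] k" z r] y z by simp
qed

end

lemma koszul_hom:
  assumes "module R M" "module R N" "f \<in> module_hom R M N" "\<And>v. y v \<in> carrier R"
  shows "(\<And>r. z r \<in> carrier M) \<Longrightarrow> koszul N y (\<lambda>r. f (z r)) r = f (koszul M y z r)"
proof (induction r arbitrary: z)
  case Nil
  show ?case using module_hom_zero[OF assms(1-3)] by simp
next
  case (Cons a r)
  interpret M: module R M by fact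
  show ?case using Cons assms(4)
    by (simp add: module_hom_minus[OF assms(1-3)] M.koszul_closed module_homD(3)[OF assms(3)])
qed

text \<open>The dual of the exactness of the Koszul complex of a regular sequence. The divisibility
  hypothesis says that \<open>y a\<close> acts surjectively on the elements killed by the \<open>y v\<close> for
  \<open>v\<close> in \<open>T\<close>. Induction on \<open>ws\<close>: a cocycle is a coboundary on the sequences avoiding the first
  index \<open>a\<close>; the error on the sequences starting with \<open>a\<close> is again a cocycle of one degree
  less, on the remaining indices. In degree \<open>0\<close>, where induction says nothing, divisibility removes it.\<close>

lemma (in module) koszul_exact:
  assumes y: "\<And>v. y v \<in> carrier R" and "distinct ws"
    and div: "\<And>a T x. insert a T \<subseteq> set ws \<Longrightarrow> a \<notin> T \<Longrightarrow> x \<in> carrier M \<Longrightarrow> (\<forall>v\<in>T. y v \<odot>\<^bsub>M\<^esub> x = \<zero>\<^bsub>M\<^esub>)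
      \<Longrightarrow> \<exists>e\<in>carrier M. y a \<odot>\<^bsub>M\<^esub> e = x \<and> (\<forall>v\<in>T. y v \<odot>\<^bsub>M\<^esub> e = \<zero>\<^bsub>M\<^esub>)"
    and z: "\<And>r. z r \<in> carrier M"
    and cocycle: "\<And>r. subseq r ws \<Longrightarrow> length r = Suc i \<Longrightarrow> koszul M y z r = \<zero>\<^bsub>M\<^esub>" and "i > 0"
  obtains u where "\<And>r. u r \<in> carrier M"
    "\<And>r. subseq r ws \<Longrightarrow> length r = i \<Longrightarrow> z r = koszul M y u r"
proof -
  have "\<exists>u. (\<forall>r. u r \<in> carrier M) \<and> (\<forall>r. subseq r ws \<longrightarrow> length r = i \<longrightarrow> z r = koszul M y u r)"
    using assms(2-)
  proof (induction ws arbitrary: z i)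
    case Nil
    then show ?case by (intro exI[of _ "\<lambda>_. \<zero>\<^bsub>M\<^esub>"]) auto
  next
    case (Cons a ws)
    note z = Cons.prems(3)
    have a: "a \<notin> set ws" and dws: "distinct ws" using Cons.prems by auto
    have div': "\<exists>e\<in>carrier M. y b \<odot>\<^bsub>M\<^esub> e = x \<and> (\<forall>v\<in>T. y v \<odot>\<^bsub>M\<^esub> e = \<zero>\<^bsub>M\<^esub>)"
      if "insert b T \<subseteq> set ws" "b \<notin> T" "x \<in> carrier M" "\<forall>v\<in>T. y v \<odot>\<^bsub>M\<^esub> x = \<zero>\<^bsub>M\<^esub>" for b T x
      using Cons.prems(2)[of b T x] that by auto
    have coc: "koszul M y z r = \<zero>\<^bsub>M\<^esub>" if "subseq r ws" "length r = Suc i" for r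
      using Cons.prems(4)[of r] that by auto
    have "\<exists>u. (\<forall>r. u r \<in> carrier M) \<and> (\<forall>r. subseq r ws \<longrightarrow> length r = i \<longrightarrow> z r = koszul M y u r)"
      by (rule Cons.IH[of z i]) (use dws div' z coc Cons.prems(5) in auto)
    then obtain u where u: "\<And>r. u r \<in> carrier M"
      and zu: "\<And>r. subseq r ws \<Longrightarrow> length r = i \<Longrightarrow> z r = koszul M y u r" by blast
    \<comment> \<open>the error on sequences starting with \<open>a\<close>\<close>
    define w where "w r = y a \<odot>\<^bsub>M\<^esub> u r \<ominus>\<^bsub>M\<^esub> z (a # r)" for r
    have w: "w r \<in> carrier M" for r using u z y by (simp add: w_def)
    have zw: "z (a # r) = y a \<odot>\<^bsub>M\<^esub> u r \<ominus>\<^bsub>M\<^esub> w r" for r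
      using u z y by (simp add: w_def a_minus_def M.minus_add M.r_neg1 M.r_neg2)
    have kw: "koszul M y w r = \<zero>\<^bsub>M\<^esub>" if r: "subseq r ws" "length r = i" for r
    proof -
      have "koszul M y w r = y a \<odot>\<^bsub>M\<^esub> koszul M y u r \<ominus>\<^bsub>M\<^esub> koszul M y (\<lambda>s. z (a # s)) r"
        unfolding w_def using u z y by (simp add: koszul_minus[of y] koszul_smult[of y])
      also have "\<dots> = koszul M y z (a # r)" using zu[OF r] by simp
      finally show ?thesis using Cons.prems(4)[of "a # r"] r by simp
    qed
    obtain j where j: "i = Suc j" using Cons.prems(5) by (cases i) auto
    show ?case
    proof (cases "j = 0")
      case True
      have "\<forall>v\<in>set ws. y v \<odot>\<^bsub>M\<^esub> w [] = \<zero>\<^bsub>M\<^esub>"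
      proof
        fix v assume "v \<in> set ws"
        then have "subseq [v] ws" by (simp add: subseq_singleton_left)
        then show "y v \<odot>\<^bsub>M\<^esub> w [] = \<zero>\<^bsub>M\<^esub>" using kw[of "[v]"] True j y w by (simp add: a_minus_def)
      qed
      then obtain e where e: "e \<in> carrier M" "y a \<odot>\<^bsub>M\<^esub> e = w []" "\<And>v. v \<in> set ws \<Longrightarrow> y v \<odot>\<^bsub>M\<^esub> e = \<zero>\<^bsub>M\<^esub>"
        using Cons.prems(2)[of a "set ws" "w []"] a w by auto
      have "z r = koszul M y (\<lambda>r. u r \<ominus>\<^bsub>M\<^esub> e) r" if r: "subseq r (a # ws)" "length r = i" for r
      proof -
        obtain v where v: "r = [v]" using r True j by (auto simp: length_Suc_conv)
        have *: "koszul M y (\<lambda>r. u r \<ominus>\<^bsub>M\<^esub> e) [v] = y v \<odot>\<^bsub>M\<^esub> u [] \<ominus>\<^bsub>M\<^esub> y v \<odot>\<^bsub>M\<^esub> e"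
          using u y e by (simp add: a_minus_def smult_r_distr smult_r_minus)
        show ?thesis
        proof (cases "v = a")
          case True
          then show ?thesis using v * e zw[of "[]"] by simp
        next
          case False
          then have "v \<in> set ws" using r v by (simp add: subseq_singleton_left)
          then show ?thesis using v * e(3) zu[of "[v]"] True j u y
            by (simp add: subseq_singleton_left a_minus_def)
        qed
      qed
      then show ?thesis using u e by (intro exI[of _ "\<lambda>r. u r \<ominus>\<^bsub>M\<^esub> e"]) auto
    next
      case False
      have "\<exists>u. (\<forall>r. u r \<in> carrier M) \<and> (\<forall>r. subseq r ws \<longrightarrow> length r = j \<longrightarrow> w r = koszul M y u r)"
        by (rule Cons.IH[of w j]) (use dws div' w kw j False in auto)
      then obtain t where t: "\<And>r. t r \<in> carrier M"
        and wt: "\<And>r. subseq r ws \<Longrightarrow> length r = j \<Longrightarrow> w r = koszul M y t r" by blast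
      \<comment> \<open>the solutions for sequences with and without \<open>a\<close> are glued\<close>
      define g where "g r = (case r of [] \<Rightarrow> u [] | b # s \<Rightarrow> if b = a then t s else u r)" for r
      have g: "g r \<in> carrier M" for r using t u by (auto simp: g_def split: list.split)
      have gu: "g r = u r" if "subseq r ws" for r
      proof -
        have "a \<notin> set r" using a subseq_set[OF that] by blast
        then show ?thesis by (auto simp: g_def split: list.split)
      qed
      have "z r = koszul M y g r" if r: "subseq r (a # ws)" "length r = i" for r
      proof (cases "subseq r ws")
        case True
        have "koszul M y g r = koszul M y u r"
          by (rule koszul_cong) (use True gu subseq_order.order_trans in blast)
        then show ?thesis using zu True r by simp
      next
        case False
        then obtain s where s: "r = a # s" "subseq s ws" using r(1)
          by (cases r) (auto split: if_splits)
        have "koszul M y g r = y a \<odot>\<^bsub>M\<^esub> u s \<ominus>\<^bsub>M\<^esub> koszul M y t s"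
          using s gu[OF s(2)] by (simp add: g_def)
        then show ?thesis using wt[OF s(2)] zw[of s] r j s by simp
      qed
      then show ?thesis using g by blast
    qed
  qed
  then show ?thesis using that by blast
qed

section \<open>Dimension shifting\<close>

definition koszul_acyclic ::
  "('a, 'r) ring_scheme \<Rightarrow> ('a, 'b) module \<Rightarrow> ('v \<Rightarrow> 'a) \<Rightarrow> 'v list \<Rightarrow> bool" where
  "koszul_acyclic R M y ws \<longleftrightarrow>
     (\<forall>(k::nat) i z. i > 0 \<longrightarrow> (\<forall>r. z r \<in> carrier M) \<longrightarrow>
        (\<forall>r. subseq r ws \<longrightarrow> length r = Suc i \<longrightarrow> koszul_pow R M y k z r = \<zero>\<^bsub>M\<^esub>) \<longrightarrow>
        (\<exists>u. (\<forall>r. u r \<in> carrier M) \<and>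
          (\<forall>r. subseq r ws \<longrightarrow> length r = i \<longrightarrow> z r = koszul_pow R M y k u r)))"

lemma koszul_acyclicD:
  assumes "koszul_acyclic R M y ws" "i > 0" "\<And>r. z r \<in> carrier M"
    "\<And>r. subseq r ws \<Longrightarrow> length r = Suc i \<Longrightarrow> koszul_pow R M y k z r = \<zero>\<^bsub>M\<^esub>"
  obtains u where "\<And>r. u r \<in> carrier M"
    "\<And>r. subseq r ws \<Longrightarrow> length r = i \<Longrightarrow> z r = koszul_pow R M y k u r"
proof -
  have "\<exists>u. (\<forall>r. u r \<in> carrier M) \<and>
      (\<forall>r. subseq r ws \<longrightarrow> length r = i \<longrightarrow> z r = koszul_pow R M y k u r)"
    using assms(1)[unfolded koszul_acyclic_def, THEN spec[of _ k], THEN spec[of _ i], THEN spec[of _ z]]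
      assms(2-) by simp
  then show ?thesis using that by blast
qed

definition power_torsion ::
  "('a, 'r) ring_scheme \<Rightarrow> ('v \<Rightarrow> 'a) \<Rightarrow> 'v set \<Rightarrow> ('a, 'b) module \<Rightarrow> 'b set" where
  "power_torsion R y W M = {x \<in> carrier M. \<exists>k::nat. \<forall>v\<in>W. y v [^]\<^bsub>R\<^esub> k \<odot>\<^bsub>M\<^esub> x = \<zero>\<^bsub>M\<^esub>}"

text \<open>One step of dimension shifting: \<open>E\<close> will be a term of an injective resolution, \<open>L\<close> and
  \<open>N\<close> consecutive kernels.\<close>

locale short_exact =
  L: module R L + E: module R E + N: module R N
  for R :: "('a, 'r) ring_scheme" and L :: "('a, 'l) module" and E :: "('a, 'e) module"
    and N :: "('a, 'n) module" +
  fixes f g and y :: "'v \<Rightarrow> 'a" and ws :: "'v list"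
  assumes f: "f \<in> module_hom R L E" and g: "g \<in> module_hom R E N"
    and inj: "inj_on f (carrier L)"
    and exact: "f ` carrier L = {x \<in> carrier E. g x = \<zero>\<^bsub>N\<^esub>}"
    and onto: "g ` carrier E = carrier N"
    and y: "\<And>v. y v \<in> carrier R"
    and acyclic: "koszul_acyclic R E y ws"
begin

lemmas f_hom = module_homD[OF f] module_hom_minus[OF L.module_axioms E.module_axioms f]
  module_hom_neg[OF L.module_axioms E.module_axioms f]
lemmas g_hom = module_homD[OF g] module_hom_minus[OF E.module_axioms N.module_axioms g]
  module_hom_neg[OF E.module_axioms N.module_axioms g]

lemma yk: "y v [^]\<^bsub>R\<^esub> (k::nat) \<in> carrier R"
  using y by simp

lemma koszul_f: "(\<And>r. z r \<in> carrier L) \<Longrightarrow>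
    koszul_pow R E y k (\<lambda>r. f (z r)) r = f (koszul_pow R L y k z r)"
  by (rule koszul_hom[OF L.module_axioms E.module_axioms f yk])

lemma koszul_g: "(\<And>r. z r \<in> carrier E) \<Longrightarrow>
    koszul_pow R N y k (\<lambda>r. g (z r)) r = g (koszul_pow R E y k z r)"
  by (rule koszul_hom[OF E.module_axioms N.module_axioms g yk])

lemma gf: "x \<in> carrier L \<Longrightarrow> g (f x) = \<zero>\<^bsub>N\<^esub>"
  using exact by blast

lemma lift_g:
  assumes "\<And>r. z r \<in> carrier N"
  obtains w where "\<And>r. w r \<in> carrier E" "\<And>r. g (w r) = z r"
proof (rule that)
  show "inv_into (carrier E) g (z r) \<in> carrier E" "g (inv_into (carrier E) g (z r)) = z r" for r
    using assms onto by (auto intro!: inv_into_into f_inv_into_f)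
qed

lemma lift_f:
  assumes "\<And>r. P r \<Longrightarrow> z r \<in> carrier E" "\<And>r. P r \<Longrightarrow> g (z r) = \<zero>\<^bsub>N\<^esub>"
  obtains s where "\<And>r. s r \<in> carrier L" "\<And>r. P r \<Longrightarrow> f (s r) = z r"
proof (rule that)
  have "z r \<in> f ` carrier L" if "P r" for r using assms that exact by blast
  then show "(if P r then inv_into (carrier L) f (z r) else \<zero>\<^bsub>L\<^esub>) \<in> carrier L"
    "P r \<Longrightarrow> f (if P r then inv_into (carrier L) f (z r) else \<zero>\<^bsub>L\<^esub>) = z r" for r
    by (auto intro!: inv_into_into f_inv_into_f)
qed

lemma injD: "x \<in> carrier L \<Longrightarrow> x' \<in> carrier L \<Longrightarrow> f x = f x' \<Longrightarrow> x = x'"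
  using inj by (auto dest: inj_onD)

lemma list_mult_pow_closed: "pow_mult R y l r \<in> carrier R"
  by (rule L.list_mult_closed[OF yk])

lemma kos_closed:
  "(\<And>r. z r \<in> carrier L) \<Longrightarrow> koszul_pow R L y k z r \<in> carrier L"
  "(\<And>r. w r \<in> carrier E) \<Longrightarrow> koszul_pow R E y k w r \<in> carrier E"
  by (rule L.koszul_closed[OF yk] E.koszul_closed[OF yk]; blast)+

text \<open>The connecting isomorphism of the long exact sequence, as far as vanishing is concerned.
  In each direction a cocycle is lifted or pulled back along the sequence, vanishing at the
  other end is applied after raising the exponent from \<open>k\<close> to \<open>k + l\<close>, and the remaining
  cocycle in \<open>E\<close> is a coboundary as \<open>E\<close> is acyclic.\<close>

lemma cech_vanishes_shift:
  assumes j: "j > 0"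
  shows "cech_vanishes R N y ws j \<longleftrightarrow> cech_vanishes R L y ws (Suc j)"
proof
  assume V: "cech_vanishes R L y ws (Suc j)"
  show "cech_vanishes R N y ws j"
  proof (rule cech_vanishesI)
    fix k z assume z: "\<And>r. z r \<in> carrier N"
      and coc: "\<And>r. subseq r ws \<Longrightarrow> length r = Suc j \<Longrightarrow> koszul_pow R N y k z r = \<zero>\<^bsub>N\<^esub>"
    let ?d = "\<lambda>X k. koszul_pow R X y k"
    obtain w where w: "\<And>r. w r \<in> carrier E" and gw: "\<And>r. g (w r) = z r" using lift_g z by blast
    have g0: "g (?d E k w r) = \<zero>\<^bsub>N\<^esub>" if "subseq r ws \<and> length r = Suc j" for r
      using koszul_g[of w k r] w gw coc that by simp
    obtain s where s: "\<And>r. s r \<in> carrier L"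
      and fs: "\<And>r. subseq r ws \<and> length r = Suc j \<Longrightarrow> f (s r) = ?d E k w r"
      by (rule lift_f[of "\<lambda>r. subseq r ws \<and> length r = Suc j", OF kos_closed(2)[OF w] g0])
        (assumption | rule that)+
    have "?d L k s r = \<zero>\<^bsub>L\<^esub>" if r: "subseq r ws" "length r = Suc (Suc j)" for r
    proof -
      have "f (?d L k s r) = ?d E k (\<lambda>r. f (s r)) r" using koszul_f[of s] s by simp
      also have "\<dots> = ?d E k (?d E k w) r"
        by (rule koszul_cong, rule fs) (use r subseq_order.order_trans in auto)
      also have "\<dots> = \<zero>\<^bsub>E\<^esub>" by (rule E.koszul_koszul[OF yk]) (rule w)
      also have "\<dots> = f \<zero>\<^bsub>L\<^esub>" using module_hom_zero[OF L.module_axioms E.module_axioms f] by simp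
      finally show ?thesis using injD kos_closed s by blast
    qed
    note coc' = this
    obtain l u where u: "\<And>r. u r \<in> carrier L" and su: "\<And>r. subseq r ws \<Longrightarrow> length r = Suc j \<Longrightarrow>
       pow_mult R y l r \<odot>\<^bsub>L\<^esub> s r = ?d L (k + l) u r"
      by (rule cech_vanishesD[OF V s coc']) (assumption | rule that)+
    let ?P = "pow_mult R y l"
    define t where "t r = ?P r \<odot>\<^bsub>E\<^esub> w r \<ominus>\<^bsub>E\<^esub> f (u r)" for r
    have t: "t r \<in> carrier E" for r using w u f_hom list_mult_pow_closed by (simp add: t_def)
    have "?d E (k + l) t r = \<zero>\<^bsub>E\<^esub>" if r: "subseq r ws" "length r = Suc j" for r
    proof -
      have "?d E (k + l) t r = ?d E (k + l) (\<lambda>r. ?P r \<odot>\<^bsub>E\<^esub> w r) r \<ominus>\<^bsub>E\<^esub> ?d E (k + l) (\<lambda>r. f (u r)) r"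
        unfolding t_def by (rule E.koszul_minus[OF yk]) (use w u f_hom list_mult_pow_closed in auto)
      also have "\<dots> = ?P r \<odot>\<^bsub>E\<^esub> f (s r) \<ominus>\<^bsub>E\<^esub> f (?P r \<odot>\<^bsub>L\<^esub> s r)"
        using E.koszul_power_rescale[of y w k l r, OF y w] koszul_f[of u, OF u] su[OF r] fs r by simp
      also have "\<dots> = \<zero>\<^bsub>E\<^esub>"
        using s f_hom list_mult_pow_closed by (simp add: a_minus_def E.M.r_neg)
      finally show ?thesis .
    qed
    note coc' = this
    obtain v where v: "\<And>r. v r \<in> carrier E"
      and tv: "\<And>r. subseq r ws \<Longrightarrow> length r = j \<Longrightarrow> t r = ?d E (k + l) v r"
      by (rule koszul_acyclicD[OF acyclic j t coc']) (assumption | rule that)+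
    have "?P r \<odot>\<^bsub>N\<^esub> z r = ?d N (k + l) (\<lambda>r. g (v r)) r" if r: "subseq r ws" "length r = j" for r
    proof -
      have "?d N (k + l) (\<lambda>r. g (v r)) r = g (t r)" using koszul_g[of v] v tv r by simp
      also have "\<dots> = ?P r \<odot>\<^bsub>N\<^esub> z r"
        unfolding t_def using w u f_hom g_hom list_mult_pow_closed gw gf z by (simp add: a_minus_def)
      finally show ?thesis by simp
    qed
    then show "eventually_coboundary R N y ws j k z"
      using v g_hom(1) by (intro exI[of _ l] exI[of _ "\<lambda>r. g (v r)"]) auto
  qed
next
  assume V: "cech_vanishes R N y ws j"
  show "cech_vanishes R L y ws (Suc j)"
  proof (rule cech_vanishesI)
    fix k z assume z: "\<And>r. z r \<in> carrier L"
      and coc: "\<And>r. subseq r ws \<Longrightarrow> length r = Suc (Suc j) \<Longrightarrow> koszul_pow R L y k z r = \<zero>\<^bsub>L\<^esub>"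
    let ?d = "\<lambda>X k. koszul_pow R X y k"
    have "?d E k (\<lambda>r. f (z r)) r = \<zero>\<^bsub>E\<^esub>" if "subseq r ws" "length r = Suc (Suc j)" for r
      using koszul_f[of z] z coc that module_hom_zero[OF L.module_axioms E.module_axioms f] by simp
    note coc' = this
    have fz_closed: "f (z r) \<in> carrier E" for r using z f_hom by blast
    obtain w where w: "\<And>r. w r \<in> carrier E"
      and fz: "\<And>r. subseq r ws \<Longrightarrow> length r = Suc j \<Longrightarrow> f (z r) = ?d E k w r"
      by (rule koszul_acyclicD[OF acyclic zero_less_Suc fz_closed coc']) (assumption | rule that)+
    have "?d N k (\<lambda>r. g (w r)) r = \<zero>\<^bsub>N\<^esub>" if "subseq r ws" "length r = Suc j" for r
      using koszul_g[of w] w that gf[OF z] by (simp add: fz[symmetric])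
    note coc' = this
    have gw: "g (w r) \<in> carrier N" for r using w g_hom by blast
    obtain l u where u: "\<And>r. u r \<in> carrier N" and wu: "\<And>r. subseq r ws \<Longrightarrow> length r = j \<Longrightarrow>
       pow_mult R y l r \<odot>\<^bsub>N\<^esub> g (w r) = ?d N (k + l) u r"
      by (rule cech_vanishesD[OF V gw coc']) (assumption | rule that)+
    let ?P = "pow_mult R y l"
    obtain u' where u': "\<And>r. u' r \<in> carrier E" and gu: "\<And>r. g (u' r) = u r" using lift_g u by blast
    define t where "t r = ?P r \<odot>\<^bsub>E\<^esub> w r \<ominus>\<^bsub>E\<^esub> ?d E (k + l) u' r" for r
    have kc: "?d E (k + l) u' r \<in> carrier E" for r using kos_closed u' by blast
    have t: "t r \<in> carrier E" for r using w kc list_mult_pow_closed by (simp add: t_def)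
    have "g (t r) = \<zero>\<^bsub>N\<^esub>" if r: "subseq r ws \<and> length r = j" for r
    proof -
      have "g (t r) = ?P r \<odot>\<^bsub>N\<^esub> g (w r) \<ominus>\<^bsub>N\<^esub> ?d N (k + l) (\<lambda>r. g (u' r)) r"
        unfolding t_def using w kc g_hom list_mult_pow_closed koszul_g[of u'] u' by simp
      also have "\<dots> = ?d N (k + l) u r \<ominus>\<^bsub>N\<^esub> ?d N (k + l) u r" using wu gu r by simp
      also have "\<dots> = \<zero>\<^bsub>N\<^esub>" using N.koszul_closed[of "\<lambda>v. y v [^]\<^bsub>R\<^esub> (k + l)" u r] yk u
        by (simp add: a_minus_def N.M.r_neg)
      finally show ?thesis .
    qed
    note gt = this
    obtain s where s: "\<And>r. s r \<in> carrier L"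
      and fs: "\<And>r. subseq r ws \<and> length r = j \<Longrightarrow> f (s r) = t r"
      by (rule lift_f[of "\<lambda>r. subseq r ws \<and> length r = j", OF t gt]) (assumption | rule that)+
    have "?P r \<odot>\<^bsub>L\<^esub> z r = ?d L (k + l) s r" if r: "subseq r ws" "length r = Suc j" for r
    proof -
      have "f (?d L (k + l) s r) = ?d E (k + l) (\<lambda>r. f (s r)) r" using koszul_f[of s] s by simp
      also have "\<dots> = ?d E (k + l) t r"
        by (rule koszul_cong, rule fs) (use r subseq_order.order_trans in auto)
      also have "\<dots> = ?d E (k + l) (\<lambda>r. ?P r \<odot>\<^bsub>E\<^esub> w r) r \<ominus>\<^bsub>E\<^esub> ?d E (k + l) (?d E (k + l) u') r"
        unfolding t_def by (rule E.koszul_minus[OF yk]) (use w kc list_mult_pow_closed in auto)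
      also have "\<dots> = ?P r \<odot>\<^bsub>E\<^esub> f (z r)"
        using E.koszul_power_rescale[of y w k l r, OF y w] E.koszul_koszul[of "\<lambda>v. y v [^]\<^bsub>R\<^esub> (k + l)" u' r] yk u'
          fz[OF r] list_mult_pow_closed f_hom(1) z kos_closed(2)[of w k r, OF w]
        by (simp add: a_minus_def)
      also have "\<dots> = f (?P r \<odot>\<^bsub>L\<^esub> z r)" using f_hom z list_mult_pow_closed by simp
      finally show ?thesis using injD kos_closed s z list_mult_pow_closed by (metis L.smult_closed)
    qed
    then show "eventually_coboundary R L y ws (Suc j) k z"
      using s by blast
  qed
qed

text \<open>The beginning of the long exact sequence. Cocycles of degree \<open>0\<close> are the torsion elements
  \<open>\<Gamma>(E)\<close> and \<open>\<Gamma>(N)\<close>, and the cokernel of \<open>\<Gamma>(E) \<rightarrow> \<Gamma>(N)\<close> is the first cohomology of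
  \<open>L\<close>.\<close>

lemma cech_vanishes_1_iff:
  "cech_vanishes R L y ws (Suc 0) \<longleftrightarrow>
     power_torsion R y (set ws) N \<subseteq> g ` power_torsion R y (set ws) E"
proof
  assume V: "cech_vanishes R L y ws (Suc 0)"
  show "power_torsion R y (set ws) N \<subseteq> g ` power_torsion R y (set ws) E"
  proof
    fix x assume "x \<in> power_torsion R y (set ws) N"
    then obtain k :: nat where x: "x \<in> carrier N"
      and k: "\<And>v. v \<in> set ws \<Longrightarrow> y v [^]\<^bsub>R\<^esub> k \<odot>\<^bsub>N\<^esub> x = \<zero>\<^bsub>N\<^esub>"
      unfolding power_torsion_def by blast
    let ?d = "\<lambda>X k. koszul_pow R X y k"
    have "x \<in> g ` carrier E" using x by (simp add: onto)
    then obtain e where e: "e \<in> carrier E" "g e = x" by blast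
    have d1: "?d E k (\<lambda>_. e) [v] = y v [^]\<^bsub>R\<^esub> k \<odot>\<^bsub>E\<^esub> e" for v k using e yk by (simp add: a_minus_def)
    have g0: "g (?d E k (\<lambda>_. e) r) = \<zero>\<^bsub>N\<^esub>" if r: "subseq r ws \<and> length r = Suc 0" for r
    proof -
      obtain v where v: "r = [v]" using r by (auto simp: length_Suc_conv)
      then show ?thesis using r k e d1 g_hom(3) yk by (simp add: subseq_singleton_left)
    qed
    obtain s where s: "\<And>r. s r \<in> carrier L"
      and fs: "\<And>r. subseq r ws \<and> length r = Suc 0 \<Longrightarrow> f (s r) = ?d E k (\<lambda>_. e) r"
      by (rule lift_f[of "\<lambda>r. subseq r ws \<and> length r = Suc 0", OF kos_closed(2)[OF e(1)] g0])
        (assumption | rule that)+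
    have "?d L k s r = \<zero>\<^bsub>L\<^esub>" if r: "subseq r ws" "length r = Suc (Suc 0)" for r
    proof -
      have "f (?d L k s r) = ?d E k (\<lambda>r. f (s r)) r" using koszul_f[of s] s by simp
      also have "\<dots> = ?d E k (?d E k (\<lambda>_. e)) r"
        by (rule koszul_cong, rule fs) (use r subseq_order.order_trans in auto)
      also have "\<dots> = \<zero>\<^bsub>E\<^esub>" by (rule E.koszul_koszul[OF yk]) (rule e)
      also have "\<dots> = f \<zero>\<^bsub>L\<^esub>" using module_hom_zero[OF L.module_axioms E.module_axioms f] by simp
      finally show ?thesis using injD kos_closed s by blast
    qed
    note coc' = this
    obtain l u where u: "\<And>r. u r \<in> carrier L" and su: "\<And>r. subseq r ws \<Longrightarrow> length r = Suc 0 \<Longrightarrow>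
       pow_mult R y l r \<odot>\<^bsub>L\<^esub> s r = ?d L (k + l) u r"
      by (rule cech_vanishesD[OF V s coc']) (assumption | rule that)+
    have "y v [^]\<^bsub>R\<^esub> (k + l) \<odot>\<^bsub>E\<^esub> (e \<ominus>\<^bsub>E\<^esub> f (u [])) = \<zero>\<^bsub>E\<^esub>" if "v \<in> set ws" for v
    proof -
      have r: "subseq [v] ws" using that by (simp add: subseq_singleton_left)
      have "y v [^]\<^bsub>R\<^esub> (k + l) \<odot>\<^bsub>E\<^esub> e = y v [^]\<^bsub>R\<^esub> l \<odot>\<^bsub>E\<^esub> f (s [v])"
        using fs[of "[v]"] r d1 e yk y
        by (simp add: E.smult_assoc1[symmetric] L.R.nat_pow_mult add.commute)
      also have "\<dots> = f (y v [^]\<^bsub>R\<^esub> l \<odot>\<^bsub>L\<^esub> s [v])" using f_hom s yk by simp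
      also have "\<dots> = f (y v [^]\<^bsub>R\<^esub> (k + l) \<odot>\<^bsub>L\<^esub> u [])"
        using su[OF r] u yk by (simp add: a_minus_def)
      also have "\<dots> = y v [^]\<^bsub>R\<^esub> (k + l) \<odot>\<^bsub>E\<^esub> f (u [])" using f_hom u yk by simp
      finally show ?thesis using e u f_hom(1) yk
        by (simp add: a_minus_def E.smult_r_distr E.smult_r_minus E.M.r_neg)
    qed
    then have "e \<ominus>\<^bsub>E\<^esub> f (u []) \<in> power_torsion R y (set ws) E"
      unfolding power_torsion_def using e u f_hom(1) by blast
    moreover have "g (e \<ominus>\<^bsub>E\<^esub> f (u [])) = x"
      using e u f_hom(1) g_hom gf x by (simp add: a_minus_def)
    ultimately show "x \<in> g ` power_torsion R y (set ws) E" by blast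
  qed
next
  assume T: "power_torsion R y (set ws) N \<subseteq> g ` power_torsion R y (set ws) E"
  show "cech_vanishes R L y ws (Suc 0)"
  proof (rule cech_vanishesI)
    fix k z assume z: "\<And>r. z r \<in> carrier L"
      and coc: "\<And>r. subseq r ws \<Longrightarrow> length r = Suc (Suc 0) \<Longrightarrow> koszul_pow R L y k z r = \<zero>\<^bsub>L\<^esub>"
    let ?d = "\<lambda>X k. koszul_pow R X y k"
    have "?d E k (\<lambda>r. f (z r)) r = \<zero>\<^bsub>E\<^esub>" if "subseq r ws" "length r = Suc (Suc 0)" for r
      using koszul_f[of z] z coc that module_hom_zero[OF L.module_axioms E.module_axioms f] by simp
    note coc' = this
    have fz_closed: "f (z r) \<in> carrier E" for r using z f_hom by blast
    obtain w where w: "\<And>r. w r \<in> carrier E"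
      and fz: "\<And>r. subseq r ws \<Longrightarrow> length r = Suc 0 \<Longrightarrow> f (z r) = ?d E k w r"
      by (rule koszul_acyclicD[OF acyclic zero_less_Suc fz_closed coc']) (assumption | rule that)+
    have fz1: "f (z [v]) = y v [^]\<^bsub>R\<^esub> k \<odot>\<^bsub>E\<^esub> w []" if "v \<in> set ws" for v
      using fz[of "[v]"] that w yk by (simp add: subseq_singleton_left a_minus_def)
    have "y v [^]\<^bsub>R\<^esub> k \<odot>\<^bsub>N\<^esub> g (w []) = \<zero>\<^bsub>N\<^esub>" if "v \<in> set ws" for v
      using gf[OF z, of "[v]"] fz1[OF that] g_hom(3) w yk by simp
    then have "g (w []) \<in> power_torsion R y (set ws) N"
      unfolding power_torsion_def using g_hom(1) w by blast
    then have "g (w []) \<in> g ` power_torsion R y (set ws) E" by (rule subsetD[OF T])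
    then obtain e where e': "e \<in> power_torsion R y (set ws) E" "g e = g (w [])" by force
    then obtain m :: nat where e: "e \<in> carrier E" "g e = g (w [])"
      and m: "\<And>v. v \<in> set ws \<Longrightarrow> y v [^]\<^bsub>R\<^esub> m \<odot>\<^bsub>E\<^esub> e = \<zero>\<^bsub>E\<^esub>"
      by (auto simp: power_torsion_def)
    have "g (w [] \<ominus>\<^bsub>E\<^esub> e) = \<zero>\<^bsub>N\<^esub>" using g_hom w e by (simp add: a_minus_def N.M.r_neg)
    then have "w [] \<ominus>\<^bsub>E\<^esub> e \<in> f ` carrier L" using w e by (simp add: exact)
    then obtain u where u: "u \<in> carrier L" "f u = w [] \<ominus>\<^bsub>E\<^esub> e" by force
    have "pow_mult R y m r \<odot>\<^bsub>L\<^esub> z r = ?d L (k + m) (\<lambda>_. u) r"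
      if r: "subseq r ws" "length r = Suc 0" for r
    proof -
      obtain v where v: "r = [v]" "v \<in> set ws" using r by (auto simp: length_Suc_conv subseq_singleton_left)
      have "y v [^]\<^bsub>R\<^esub> (k + m) \<odot>\<^bsub>E\<^esub> e = y v [^]\<^bsub>R\<^esub> k \<odot>\<^bsub>E\<^esub> (y v [^]\<^bsub>R\<^esub> m \<odot>\<^bsub>E\<^esub> e)"
        using e yk y by (simp add: E.smult_assoc1[symmetric] L.R.nat_pow_mult)
      then have e0: "y v [^]\<^bsub>R\<^esub> (k + m) \<odot>\<^bsub>E\<^esub> e = \<zero>\<^bsub>E\<^esub>" using m v yk by simp
      have "f (y v [^]\<^bsub>R\<^esub> (k + m) \<odot>\<^bsub>L\<^esub> u) = y v [^]\<^bsub>R\<^esub> (k + m) \<odot>\<^bsub>E\<^esub> w []"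
        using f_hom(3) u yk w e e0 by (simp add: a_minus_def E.smult_r_distr E.smult_r_minus)
      also have "\<dots> = y v [^]\<^bsub>R\<^esub> m \<odot>\<^bsub>E\<^esub> f (z [v])"
        using fz1 v w yk y by (simp add: E.smult_assoc1[symmetric] L.R.nat_pow_mult add.commute)
      also have "\<dots> = f (y v [^]\<^bsub>R\<^esub> m \<odot>\<^bsub>L\<^esub> z [v])" using f_hom z yk by simp
      finally have "y v [^]\<^bsub>R\<^esub> (k + m) \<odot>\<^bsub>L\<^esub> u = y v [^]\<^bsub>R\<^esub> m \<odot>\<^bsub>L\<^esub> z [v]"
        using injD z u yk by (metis L.smult_closed)
      then show ?thesis using v u(1) z yk by (simp add: a_minus_def)
    qed
    then show "eventually_coboundary R L y ws (Suc 0) k z"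
      using u by (intro exI[of _ m] exI[of _ "\<lambda>_. u"]) auto
  qed
qed

end

section \<open>Local cohomology and Koszul cochains\<close>

lemma a_kernel_submodule:
  assumes "module R M" "module R N" "f \<in> module_hom R M N"
  shows "submodule (a_kernel M N f) R M"
proof -
  interpret M: module R M by fact
  interpret N: module R N by fact
  show ?thesis
    by (rule M.submoduleI)
       (auto simp: a_kernel_def' module_homD[OF assms(3)] module_hom_zero[OF assms] module_hom_neg[OF assms])
qed

lemma cech_vanishes_iso:
  assumes "module R L" "module R N" "f \<in> module_hom R L N" "inj_on f (carrier L)" "f ` carrier L = carrier N"
    and y: "\<And>v. y v \<in> carrier R"
  shows "cech_vanishes R L y ws i \<longleftrightarrow> cech_vanishes R N y ws i"
proof -
  have one_way: "cech_vanishes R N y ws i"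
    if V: "cech_vanishes R L y ws i" and "module R L" "module R N" and f: "f \<in> module_hom R L N"
      and h: "h \<in> module_hom R N L" and fh: "\<And>x. x \<in> carrier N \<Longrightarrow> f (h x) = x"
    for L :: "('a, 'x) module" and N :: "('a, 'y) module" and f h
  proof (rule cech_vanishesI)
    interpret L: module R L by fact
    interpret N: module R N by fact
    have yk: "y v [^]\<^bsub>R\<^esub> (k::nat) \<in> carrier R" for v k using y by simp
    fix k z assume z: "\<And>r. z r \<in> carrier N"
      and coc: "\<And>r. subseq r ws \<Longrightarrow> length r = Suc i \<Longrightarrow> koszul_pow R N y k z r = \<zero>\<^bsub>N\<^esub>"
    have hz: "h (z r) \<in> carrier L" for r using z module_homD(1)[OF h] by blast
    have coc': "koszul_pow R L y k (\<lambda>r. h (z r)) r = \<zero>\<^bsub>L\<^esub>" if "subseq r ws" "length r = Suc i" for r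
      using koszul_hom[of R N L h "\<lambda>v. y v [^]\<^bsub>R\<^esub> k" z r] coc[OF that] z h yk
        module_hom_zero[OF N.module_axioms L.module_axioms h] L.module_axioms N.module_axioms by simp
    obtain l u where u: "\<And>r. u r \<in> carrier L" and zu: "\<And>r. subseq r ws \<Longrightarrow> length r = i \<Longrightarrow>
       pow_mult R y l r \<odot>\<^bsub>L\<^esub> h (z r) = koszul_pow R L y (k + l) u r"
      by (rule cech_vanishesD[OF V hz coc']) (assumption | rule that)+
    have "pow_mult R y l r \<odot>\<^bsub>N\<^esub> z r = koszul_pow R N y (k + l) (\<lambda>r. f (u r)) r"
      if r: "subseq r ws" "length r = i" for r
    proof -
      have "koszul_pow R N y (k + l) (\<lambda>r. f (u r)) r = f (koszul_pow R L y (k + l) u r)"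
        by (rule koszul_hom[OF L.module_axioms N.module_axioms f yk u])
      also have "\<dots> = pow_mult R y l r \<odot>\<^bsub>N\<^esub> f (h (z r))"
        unfolding zu[OF r, symmetric] by (rule module_homD(3)[OF f L.list_mult_closed[OF yk] hz])
      finally show ?thesis using fh[OF z] by simp
    qed
    then show "eventually_coboundary R N y ws i k z"
      using u module_homD(1)[OF f] by (intro exI[of _ l] exI[of _ "\<lambda>r. f (u r)"]) auto
  qed
  interpret L: module R L by fact
  let ?h = "inv_into (carrier L) f"
  have hf: "?h (f x) = x" if "x \<in> carrier L" for x using assms(4) that by simp
  have fh: "f (?h x) = x" "?h x \<in> carrier L" if "x \<in> carrier N" for x
    using that assms(5) by (auto intro: f_inv_into_f inv_into_into)
  have "?h \<in> module_hom R N L"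
  proof (rule module_homI)
    fix a x assume a: "a \<in> carrier R" and x: "x \<in> carrier N"
    show "?h (a \<odot>\<^bsub>N\<^esub> x) = a \<odot>\<^bsub>L\<^esub> ?h x"
      using hf[of "a \<odot>\<^bsub>L\<^esub> ?h x"] module_homD(3)[OF assms(3) a fh(2)[OF x]] fh[OF x] a by simp
  next
    fix x x' assume x: "x \<in> carrier N" "x' \<in> carrier N"
    show "?h (x \<oplus>\<^bsub>N\<^esub> x') = ?h x \<oplus>\<^bsub>L\<^esub> ?h x'"
      using hf[of "?h x \<oplus>\<^bsub>L\<^esub> ?h x'"] module_homD(2)[OF assms(3) fh(2)[OF x(1)] fh(2)[OF x(2)]] fh x by simp
  qed (use fh in auto)
  then show ?thesis
    using one_way[OF _ assms(1-3), of ?h] one_way[OF _ assms(2,1) _ assms(3), of ?h] fh hf by blast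
qed

lemma power_torsion_mono_power:
  assumes "module R M" "\<And>v. y v \<in> carrier R" "x \<in> carrier M" "y v [^]\<^bsub>R\<^esub> (k::nat) \<odot>\<^bsub>M\<^esub> x = \<zero>\<^bsub>M\<^esub>"
  shows "y v [^]\<^bsub>R\<^esub> (l + k) \<odot>\<^bsub>M\<^esub> x = \<zero>\<^bsub>M\<^esub>"
proof -
  interpret M: module R M by fact
  have "y v [^]\<^bsub>R\<^esub> (l + k) \<odot>\<^bsub>M\<^esub> x = y v [^]\<^bsub>R\<^esub> l \<odot>\<^bsub>M\<^esub> (y v [^]\<^bsub>R\<^esub> k \<odot>\<^bsub>M\<^esub> x)"
    using assms(1-3) by (simp add: M.smult_assoc1[symmetric] M.R.nat_pow_mult)
  then show ?thesis using assms by simp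
qed

lemma power_torsion_subgroup:
  assumes M: "module R M" and y: "\<And>v. y v \<in> carrier R"
  shows "subgroup (power_torsion R y W M) (add_monoid M)"
proof -
  interpret M: module R M by fact
  have "submodule (power_torsion R y W M) R M"
  proof (rule M.submoduleI)
    show "power_torsion R y W M \<subseteq> carrier M" "\<zero>\<^bsub>M\<^esub> \<in> power_torsion R y W M"
      using y by (auto simp: power_torsion_def)
  next
    fix x assume "x \<in> power_torsion R y W M"
    then obtain k :: nat where x: "x \<in> carrier M" "\<forall>v\<in>W. y v [^]\<^bsub>R\<^esub> k \<odot>\<^bsub>M\<^esub> x = \<zero>\<^bsub>M\<^esub>"
      unfolding power_torsion_def by blast
    then show "\<ominus>\<^bsub>M\<^esub> x \<in> power_torsion R y W M"
      unfolding power_torsion_def using y by (auto simp: M.smult_r_minus intro!: exI[of _ k])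
    fix a assume a: "a \<in> carrier R"
    have "y v [^]\<^bsub>R\<^esub> k \<odot>\<^bsub>M\<^esub> (a \<odot>\<^bsub>M\<^esub> x) = a \<odot>\<^bsub>M\<^esub> (y v [^]\<^bsub>R\<^esub> k \<odot>\<^bsub>M\<^esub> x)" for v
      using a x(1) y by (simp add: M.smult_assoc1[symmetric] M.R.m_comm)
    then show "a \<odot>\<^bsub>M\<^esub> x \<in> power_torsion R y W M"
      unfolding power_torsion_def using y x a by (auto intro!: exI[of _ k])
  next
    fix a b assume "a \<in> power_torsion R y W M" "b \<in> power_torsion R y W M"
    then obtain k l :: nat where x: "a \<in> carrier M" "\<forall>v\<in>W. y v [^]\<^bsub>R\<^esub> k \<odot>\<^bsub>M\<^esub> a = \<zero>\<^bsub>M\<^esub>"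
      "b \<in> carrier M" "\<forall>v\<in>W. y v [^]\<^bsub>R\<^esub> l \<odot>\<^bsub>M\<^esub> b = \<zero>\<^bsub>M\<^esub>"
      unfolding power_torsion_def by blast
    then have "y v [^]\<^bsub>R\<^esub> (k + l) \<odot>\<^bsub>M\<^esub> (a \<oplus>\<^bsub>M\<^esub> b) = \<zero>\<^bsub>M\<^esub>" if "v \<in> W" for v
      using power_torsion_mono_power[of R M y a v k l] power_torsion_mono_power[of R M y b v l k] M y that
      by (simp add: M.smult_r_distr add.commute)
    then show "a \<oplus>\<^bsub>M\<^esub> b \<in> power_torsion R y W M"
      unfolding power_torsion_def using x by blast
  qed
  then show ?thesis by (simp add: submodule_def)
qed

text \<open>Let \<open>Z i\<close> be the kernel of \<open>d i\<close>. The sequences \<open>Z i \<rightarrow> E i \<rightarrow> Z (i + 1)\<close> are short exact, so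
  vanishing for \<open>M \<cong> Z 0\<close> in degree \<open>i\<close> is passed on to \<open>Z (i - 1)\<close> in degree \<open>1\<close>.
  There it says that the torsion elements of \<open>Z i\<close>, which are the cocycles of the torsion complex,
  come from torsion elements of \<open>E (i - 1)\<close>. This argument applies to whichever resolution has
  been chosen.\<close>

theorem local_cohomology_trivial_iff:
  fixes R :: "('a, 'r) ring_scheme" and M :: "('a, 'b) module" and y :: "'v \<Rightarrow> 'a"
  assumes M: "module R M" and y: "\<And>v. y v \<in> carrier R"
    and ex: "injective_resolution R M E0 \<epsilon>0 (d0 :: nat \<Rightarrow> ('a list \<Rightarrow> 'b) \<Rightarrow> 'a list \<Rightarrow> 'b)"
    and acyclic: "\<And>E :: ('a, 'a list \<Rightarrow> 'b) module. injective_module R E \<Longrightarrow> koszul_acyclic R E y ws"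
    and torsion: "\<And>E :: ('a, 'a list \<Rightarrow> 'b) module. module R E \<Longrightarrow>
      torsion_part R Q E = power_torsion R y (set ws) E"
  shows "trivial_group (local_cohomology R Q M i) \<longleftrightarrow> cech_vanishes R M y ws i"
proof -
  \<comment> \<open>the resolution chosen in the definition of local cohomology\<close>
  define res where "res = (SOME (E, \<epsilon>, d). injective_resolution R M E \<epsilon>
     (d :: nat \<Rightarrow> ('a list \<Rightarrow> 'b) \<Rightarrow> 'a list \<Rightarrow> 'b))"
  obtain E \<epsilon> d where Eed: "res = (E, \<epsilon>, d)" by (cases res)
  have "case res of (E, \<epsilon>, d) \<Rightarrow> injective_resolution R M E \<epsilon> d"
    unfolding res_def by (rule someI[of _ "(E0, \<epsilon>0, d0)"]) (use ex in simp)
  then have res: "injective_resolution R M E \<epsilon> d" by (simp add: Eed)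
  have Einj: "injective_module R (E i)" and d: "d i \<in> module_hom R (E i) (E (Suc i))"
    and dker: "d i ` carrier (E i) = a_kernel (E (Suc i)) (E (Suc (Suc i))) (d (Suc i))" for i
    using res by (simp_all add: injective_resolution_def)
  have \<epsilon>: "\<epsilon> \<in> module_hom R M (E 0)" "inj_on \<epsilon> (carrier M)" "\<epsilon> ` carrier M = a_kernel (E 0) (E (Suc 0)) (d 0)"
    using res by (simp_all add: injective_resolution_def)
  have E: "module R (E i)" for i using Einj by (simp add: injective_module_def)
  define Z where "Z i = (E i)\<lparr>carrier := a_kernel (E i) (E (Suc i)) (d i)\<rparr>" for i
  have Z: "module R (Z i)" for i unfolding Z_def
    by (intro submodule.submodule_is_module a_kernel_submodule E d)
  have Zc: "carrier (Z i) = {x \<in> carrier (E i). d i x = \<zero>\<^bsub>E (Suc i)\<^esub>}"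
    and Zz: "\<zero>\<^bsub>Z i\<^esub> = \<zero>\<^bsub>E i\<^esub>" and Zs: "smult (Z i) = smult (E i)" and Za: "add (Z i) = add (E i)" for i
    by (auto simp: Z_def a_kernel_def')
  have dZ: "d i ` carrier (E i) = carrier (Z (Suc i))" for i using dker by (simp add: Z_def)
  have se: "short_exact R (Z i) (E i) (Z (Suc i)) (\<lambda>x. x) (d i) y ws" for i
  proof (intro short_exact.intro short_exact_axioms.intro Z E y)
    show "(\<lambda>x. x) \<in> module_hom R (Z i) (E i)" by (rule module_homI) (auto simp: Zc Zs Za)
    show "d i \<in> module_hom R (E i) (Z (Suc i))"
      using dZ[of i] by (intro module_homI) (auto simp: Zs Za module_homD[OF d])
  qed (auto simp: Zc Zz dZ[unfolded Zc] acyclic[OF Einj])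
  have MZ: "cech_vanishes R M y ws i \<longleftrightarrow> cech_vanishes R (Z 0) y ws i" for i
  proof (rule cech_vanishes_iso[OF M Z _ \<epsilon>(2) _ y])
    show "\<epsilon> ` carrier M = carrier (Z 0)" using \<epsilon>(3) by (simp add: Z_def)
    then show "\<epsilon> \<in> module_hom R M (Z 0)"
      by (intro module_homI) (auto simp: Zs Za module_homD[OF \<epsilon>(1)])
  qed
  have shift: "cech_vanishes R (Z m) y ws (Suc n) \<longleftrightarrow> cech_vanishes R (Z (m + n)) y ws (Suc 0)" for m n
  proof (induction n arbitrary: m)
    case (Suc n)
    then show ?case using short_exact.cech_vanishes_shift[OF se, of "Suc n" m] by simp
  qed simp
  let ?T = "\<lambda>i. power_torsion R y (set ws) (E i)"
  let ?B = "torsion_coboundaries R Q E d i" and ?C = "torsion_cocycles R Q E d i"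
  have TZ: "power_torsion R y (set ws) (Z i) = torsion_cocycles R Q E d i" for i
    by (auto simp: torsion_cocycles_def torsion[OF E] power_torsion_def Zc Zz Zs)
  have sub: "subgroup ?C (add_monoid (E i))"
  proof -
    have "carrier (Z i) \<inter> ?T i = ?C"
      by (auto simp: torsion_cocycles_def torsion[OF E] power_torsion_def Zc)
    moreover have "subgroup (carrier (Z i)) (add_monoid (E i))"
      using a_kernel_submodule[OF E E d] by (simp add: Z_def submodule_def)
    moreover have "subgroup (?T i) (add_monoid (E i))" using power_torsion_subgroup[OF E y] .
    ultimately show ?thesis using group.subgroups_Inter_pair[of "add_monoid (E i)"]
        abelian_group.a_group[OF module.axioms(2)[OF E]] by metis
  qed
  have BC: "subgroup ?B (add_monoid (E i)) \<and> ?B \<subseteq> ?C"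
  proof (cases i)
    case 0
    have "subgroup {\<one>\<^bsub>add_monoid (E 0)\<^esub>} (add_monoid (E 0))"
      by (rule group.triv_subgroup[OF abelian_group.a_group[OF module.axioms(2)[OF E]]])
    then show ?thesis using 0 subgroup.one_closed[OF sub] by simp
  next
    case (Suc n)
    have gh: "group_hom (add_monoid (E n)) (add_monoid (E (Suc n))) (d n)"
      by (rule abelian_group_hom.a_group_hom[OF module_hom_abelian[OF E E d]])
    have "subgroup (d n ` ?T n) (add_monoid (E (Suc n)))"
      by (rule group_hom.subgroup_img_is_subgroup[OF gh power_torsion_subgroup[OF E y]])
    moreover have "d n ` ?T n \<subseteq> torsion_cocycles R Q E d (Suc n)"
    proof
      fix x assume "x \<in> d n ` ?T n"
      then obtain e and k :: nat where e: "x = d n e" "e \<in> carrier (E n)"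
        "\<forall>v\<in>set ws. y v [^]\<^bsub>R\<^esub> k \<odot>\<^bsub>E n\<^esub> e = \<zero>\<^bsub>E n\<^esub>"
        unfolding power_torsion_def by blast
      have "x \<in> carrier (Z (Suc n))" using dZ[of n] e by blast
      moreover have "y v [^]\<^bsub>R\<^esub> k \<odot>\<^bsub>E (Suc n)\<^esub> x = \<zero>\<^bsub>E (Suc n)\<^esub>" if "v \<in> set ws" for v
        using module_homD(3)[OF d, of "y v [^]\<^bsub>R\<^esub> k" e n] e that module_hom_zero[OF E E d]
          monoid.nat_pow_closed[OF cring.axioms(1)[OF module.axioms(1)[OF M], THEN ring.axioms(2)] y]
        by simp
      ultimately have "x \<in> power_torsion R y (set ws) (Z (Suc n))"
        unfolding power_torsion_def by (auto simp: Zs Zz)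
      then show "x \<in> torsion_cocycles R Q E d (Suc n)" by (simp add: TZ)
    qed
    ultimately show ?thesis using Suc by (simp add: torsion[OF E])
  qed
  have "trivial_group (local_cohomology R Q M i) \<longleftrightarrow> ?C \<subseteq> ?B"
  proof -
    have "local_cohomology R Q M i = (E i)\<lparr>carrier := ?C\<rparr> A_Mod ?B"
      unfolding local_cohomology_def res_def[symmetric] by (simp add: Eed)
    also have "\<dots> = add_monoid ((E i)\<lparr>carrier := ?C\<rparr>) Mod ?B" by (simp add: A_FactGroup_def)
    also have "add_monoid ((E i)\<lparr>carrier := ?C\<rparr>) = (add_monoid (E i))\<lparr>carrier := ?C\<rparr>" by simp
    finally have lc: "local_cohomology R Q M i = (add_monoid (E i))\<lparr>carrier := ?C\<rparr> Mod ?B" .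
    have cg: "comm_group (add_monoid (E i))"
      by (rule abelian_group.a_comm_group[OF module.axioms(2)[OF E]])
    then have "comm_group ((add_monoid (E i))\<lparr>carrier := ?C\<rparr>)"
      using group.group_comm_groupI[OF group.subgroup_imp_group[OF comm_group.axioms(2)[OF cg] sub]]
        subgroup.subset[OF sub] comm_groupE(4)[OF cg] by (simp add: subset_iff)
    moreover have "subgroup ?B ((add_monoid (E i))\<lparr>carrier := ?C\<rparr>)"
      using BC by (intro group.subgroup_incl[OF comm_group.axioms(2)[OF cg]] sub) auto
    ultimately show ?thesis unfolding lc by (subst trivial_quotient_group_iff) auto
  qed
  also have "\<dots> \<longleftrightarrow> cech_vanishes R M y ws i"
  proof (cases i)
    case 0
    have "cech_vanishes R (Z 0) y ws 0 \<longleftrightarrow> power_torsion R y (set ws) (Z 0) \<subseteq> {\<zero>\<^bsub>Z 0\<^esub>}"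
    proof
      assume V: "cech_vanishes R (Z 0) y ws 0"
      interpret Z0: module R "Z 0" by (rule Z)
      show "power_torsion R y (set ws) (Z 0) \<subseteq> {\<zero>\<^bsub>Z 0\<^esub>}"
      proof
        fix x assume "x \<in> power_torsion R y (set ws) (Z 0)"
        then obtain k :: nat where x: "x \<in> carrier (Z 0)"
          and k: "\<And>v. v \<in> set ws \<Longrightarrow> y v [^]\<^bsub>R\<^esub> k \<odot>\<^bsub>Z 0\<^esub> x = \<zero>\<^bsub>Z 0\<^esub>"
          unfolding power_torsion_def by blast
        have coc: "koszul_pow R (Z 0) y k (\<lambda>_. x) r = \<zero>\<^bsub>Z 0\<^esub>"
          if "subseq r ws" "length r = Suc 0" for r
          using that k by (auto simp: length_Suc_conv subseq_singleton_left a_minus_def)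
        obtain l u where "\<And>r. u r \<in> carrier (Z 0)"
          and u: "\<And>r. subseq r ws \<Longrightarrow> length r = 0 \<Longrightarrow> pow_mult R y l r \<odot>\<^bsub>Z 0\<^esub> x
            = koszul_pow R (Z 0) y (k + l) u r"
          by (rule cech_vanishesD[OF V x coc]) (assumption | rule that)+
        show "x \<in> {\<zero>\<^bsub>Z 0\<^esub>}" using u[of "[]"] x by simp
      qed
    next
      assume T: "power_torsion R y (set ws) (Z 0) \<subseteq> {\<zero>\<^bsub>Z 0\<^esub>}"
      interpret Z0: module R "Z 0" by (rule Z)
      show "cech_vanishes R (Z 0) y ws 0"
      proof (rule cech_vanishesI)
        fix k z assume z: "\<And>r. z r \<in> carrier (Z 0)"
          and coc: "\<And>r. subseq r ws \<Longrightarrow> length r = Suc 0 \<Longrightarrow>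
            koszul_pow R (Z 0) y k z r = \<zero>\<^bsub>Z 0\<^esub>"
        have "y v [^]\<^bsub>R\<^esub> k \<odot>\<^bsub>Z 0\<^esub> z [] = \<zero>\<^bsub>Z 0\<^esub>" if "v \<in> set ws" for v
          using coc[of "[v]"] that z y by (simp add: subseq_singleton_left a_minus_def)
        then have "z [] \<in> power_torsion R y (set ws) (Z 0)"
          unfolding power_torsion_def using z by blast
        then have "z [] = \<zero>\<^bsub>Z 0\<^esub>" using T by blast
        then show "eventually_coboundary R (Z 0) y ws 0 k z"
          by (intro exI[of _ 0] exI[of _ "\<lambda>_. \<zero>\<^bsub>Z 0\<^esub>"]) auto
      qed
    qed
    then show ?thesis using 0 by (simp add: MZ TZ Zz)
  next
    case (Suc n)
    then show ?thesis
      using short_exact.cech_vanishes_1_iff[OF se, of n] shift[of 0 n] MZ[of i]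
      by (simp add: TZ torsion[OF E])
  qed
  finally show ?thesis .
qed

section \<open>Injective modules and monomial ideals\<close>

definition regular_module :: "('a, 'r) ring_scheme \<Rightarrow> ('a, 'a) module" where
  "regular_module R = \<lparr>carrier = carrier R, mult = mult R, one = one R, zero = zero R, add = add R,
     smult = mult R\<rparr>"

lemma module_regular:
  assumes "cring R"
  shows "module R (regular_module R)"
proof -
  interpret cring R by fact
  show ?thesis
  proof (intro moduleI is_cring)
    show "abelian_group (regular_module R)"
    proof (rule abelian_groupI)
      fix a assume "a \<in> carrier (regular_module R)"
      then show "\<exists>b\<in>carrier (regular_module R). b \<oplus>\<^bsub>regular_module R\<^esub> a = \<zero>\<^bsub>regular_module R\<^esub>"
        by (intro bexI[of _ "\<ominus>\<^bsub>R\<^esub> a"]) (auto simp: regular_module_def l_neg)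
    qed (auto simp: regular_module_def a_ac)
  qed (auto simp: regular_module_def l_distr r_distr m_assoc)
qed

text \<open>If \<open>y\<close> is a non-zero-divisor modulo \<open>A\<close>, then \<open>a + b y \<mapsto> b x\<close> is a well-defined homomorphism
  on the ideal generated by \<open>A\<close> and \<open>y\<close>. It extends to \<open>R\<close>, and the image of \<open>1\<close> is the
  required element \<open>e\<close>.\<close>

lemma injective_coregular:
  fixes R :: "('a, 'r) ring_scheme" and E :: "('a, 'b) module"
  assumes E: "injective_module R E" and A: "ideal A R" and y: "y \<in> carrier R"
    and reg: "\<And>b. b \<in> carrier R \<Longrightarrow> y \<otimes>\<^bsub>R\<^esub> b \<in> A \<Longrightarrow> b \<in> A"
    and x: "x \<in> carrier E" and kill: "\<And>a. a \<in> A \<Longrightarrow> a \<odot>\<^bsub>E\<^esub> x = \<zero>\<^bsub>E\<^esub>"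
  shows "\<exists>e\<in>carrier E. y \<odot>\<^bsub>E\<^esub> e = x \<and> (\<forall>a\<in>A. a \<odot>\<^bsub>E\<^esub> e = \<zero>\<^bsub>E\<^esub>)"
proof -
  interpret E: module R E using E by (simp add: injective_module_def)
  interpret A: ideal A R by (rule A)
  define B where "B = regular_module R"
  have B: "module R B" unfolding B_def by (rule module_regular[OF E.R.is_cring])
  interpret B: module R B by (rule B)
  define N where "N = {a \<oplus>\<^bsub>R\<^esub> b \<otimes>\<^bsub>R\<^esub> y | a b. a \<in> A \<and> b \<in> carrier R}"
  have Bs: "carrier B = carrier R" "\<zero>\<^bsub>B\<^esub> = \<zero>\<^bsub>R\<^esub>" "add B = add R" "smult B = mult R"
    by (simp_all add: B_def regular_module_def)
  have NI: "a \<oplus>\<^bsub>R\<^esub> b \<otimes>\<^bsub>R\<^esub> y \<in> N" if "a \<in> A" "b \<in> carrier R" for a b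
    using that by (auto simp: N_def)
  \<comment> \<open>by regularity, \<open>a + b y\<close> determines \<open>b\<close> modulo \<open>A\<close>, and \<open>A\<close> kills \<open>x\<close>\<close>
  have unique: "b \<odot>\<^bsub>E\<^esub> x = b' \<odot>\<^bsub>E\<^esub> x"
    if ab: "a \<in> A" "b \<in> carrier R" "a' \<in> A" "b' \<in> carrier R"
      and eq: "a \<oplus>\<^bsub>R\<^esub> b \<otimes>\<^bsub>R\<^esub> y = a' \<oplus>\<^bsub>R\<^esub> b' \<otimes>\<^bsub>R\<^esub> y" for a b a' b'
  proof -
    note car = ab A.Icarr[OF ab(1)] A.Icarr[OF ab(3)] y
    have "b \<otimes>\<^bsub>R\<^esub> y = \<ominus>\<^bsub>R\<^esub> a \<oplus>\<^bsub>R\<^esub> (a' \<oplus>\<^bsub>R\<^esub> b' \<otimes>\<^bsub>R\<^esub> y)"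
      unfolding eq[symmetric] using car by (simp add: E.R.r_neg1)
    then have "b \<otimes>\<^bsub>R\<^esub> y \<oplus>\<^bsub>R\<^esub> \<ominus>\<^bsub>R\<^esub> (b' \<otimes>\<^bsub>R\<^esub> y) = \<ominus>\<^bsub>R\<^esub> a \<oplus>\<^bsub>R\<^esub> a'"
      using car by (simp add: E.R.a_assoc E.R.r_neg)
    moreover have "y \<otimes>\<^bsub>R\<^esub> (b \<oplus>\<^bsub>R\<^esub> \<ominus>\<^bsub>R\<^esub> b') = b \<otimes>\<^bsub>R\<^esub> y \<oplus>\<^bsub>R\<^esub> \<ominus>\<^bsub>R\<^esub> (b' \<otimes>\<^bsub>R\<^esub> y)"
      using car by (simp add: E.R.r_distr E.R.r_minus E.R.m_comm)
    moreover have "\<ominus>\<^bsub>R\<^esub> a \<oplus>\<^bsub>R\<^esub> a' \<in> A" using ab by (simp add: A.a_closed)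
    ultimately have "y \<otimes>\<^bsub>R\<^esub> (b \<oplus>\<^bsub>R\<^esub> \<ominus>\<^bsub>R\<^esub> b') \<in> A" by simp
    then have "b \<oplus>\<^bsub>R\<^esub> \<ominus>\<^bsub>R\<^esub> b' \<in> A" by (rule reg[rotated]) (use ab in simp)
    then have "(b \<oplus>\<^bsub>R\<^esub> \<ominus>\<^bsub>R\<^esub> b') \<odot>\<^bsub>E\<^esub> x = \<zero>\<^bsub>E\<^esub>" by (rule kill)
    then have "b \<odot>\<^bsub>E\<^esub> x \<ominus>\<^bsub>E\<^esub> b' \<odot>\<^bsub>E\<^esub> x = \<zero>\<^bsub>E\<^esub>"
      using car x by (simp add: E.smult_l_distr E.smult_l_minus a_minus_def)
    then show ?thesis using car x by (simp add: E.M.diff_eq_zero_iff)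
  qed
  have N_add: "(a \<oplus>\<^bsub>R\<^esub> b \<otimes>\<^bsub>R\<^esub> y) \<oplus>\<^bsub>R\<^esub> (a' \<oplus>\<^bsub>R\<^esub> b' \<otimes>\<^bsub>R\<^esub> y) = (a \<oplus>\<^bsub>R\<^esub> a') \<oplus>\<^bsub>R\<^esub> (b \<oplus>\<^bsub>R\<^esub> b') \<otimes>\<^bsub>R\<^esub> y"
    if "a \<in> A" "b \<in> carrier R" "a' \<in> A" "b' \<in> carrier R" for a b a' b'
    using that A.Icarr y by (simp add: E.R.l_distr E.R.a_ac)
  have N_mult: "c \<otimes>\<^bsub>R\<^esub> (a \<oplus>\<^bsub>R\<^esub> b \<otimes>\<^bsub>R\<^esub> y) = c \<otimes>\<^bsub>R\<^esub> a \<oplus>\<^bsub>R\<^esub> (c \<otimes>\<^bsub>R\<^esub> b) \<otimes>\<^bsub>R\<^esub> y"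
    if "a \<in> A" "b \<in> carrier R" "c \<in> carrier R" for a b c
    using that A.Icarr y by (simp add: E.R.r_distr E.R.m_assoc)
  have N: "submodule N R B"
  proof (rule B.submoduleI)
    show "N \<subseteq> carrier B" using A.Icarr y by (auto simp: Bs N_def)
    show "\<zero>\<^bsub>B\<^esub> \<in> N" using NI[OF A.zero_closed E.R.zero_closed] y by (simp add: Bs)
    have smult: "c \<otimes>\<^bsub>R\<^esub> p \<in> N" if c: "c \<in> carrier R" and p: "p \<in> N" for c p
    proof -
      obtain a b where ab: "p = a \<oplus>\<^bsub>R\<^esub> b \<otimes>\<^bsub>R\<^esub> y" "a \<in> A" "b \<in> carrier R" using p unfolding N_def by blast
      then show ?thesis using N_mult[OF ab(2,3) c] NI[of "c \<otimes>\<^bsub>R\<^esub> a" "c \<otimes>\<^bsub>R\<^esub> b"] A.I_l_closed[OF ab(2) c] c by simp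
    qed
    fix a assume a: "a \<in> N"
    then show "c \<odot>\<^bsub>B\<^esub> a \<in> N" if "c \<in> carrier R" for c using smult that by (simp add: Bs)
    have aB: "a \<in> carrier B" using a \<open>N \<subseteq> carrier B\<close> by blast
    have "\<ominus>\<^bsub>B\<^esub> a = (\<ominus>\<^bsub>R\<^esub> \<one>\<^bsub>R\<^esub>) \<odot>\<^bsub>B\<^esub> a" using aB by (simp add: B.smult_l_minus)
    then show "\<ominus>\<^bsub>B\<^esub> a \<in> N" using smult[OF _ a, of "\<ominus>\<^bsub>R\<^esub> \<one>\<^bsub>R\<^esub>"] by (simp add: Bs)
  next
    fix p p' assume "p \<in> N" "p' \<in> N"
    then obtain a b a' b' where ab: "p = a \<oplus>\<^bsub>R\<^esub> b \<otimes>\<^bsub>R\<^esub> y" "a \<in> A" "b \<in> carrier R"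
       "p' = a' \<oplus>\<^bsub>R\<^esub> b' \<otimes>\<^bsub>R\<^esub> y" "a' \<in> A" "b' \<in> carrier R" unfolding N_def by blast
    then show "p \<oplus>\<^bsub>B\<^esub> p' \<in> N" using N_add[of a b a' b'] NI[of "a \<oplus>\<^bsub>R\<^esub> a'" "b \<oplus>\<^bsub>R\<^esub> b'"] A.a_closed by (simp add: Bs)
  qed
  define f where "f p = (SOME e. \<exists>a b. a \<in> A \<and> b \<in> carrier R \<and> p = a \<oplus>\<^bsub>R\<^esub> b \<otimes>\<^bsub>R\<^esub> y \<and> e = b \<odot>\<^bsub>E\<^esub> x)" for p
  have f: "f (a \<oplus>\<^bsub>R\<^esub> b \<otimes>\<^bsub>R\<^esub> y) = b \<odot>\<^bsub>E\<^esub> x" if "a \<in> A" "b \<in> carrier R" for a b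
    unfolding f_def
  proof (rule some_equality)
    show "\<exists>a' b'. a' \<in> A \<and> b' \<in> carrier R \<and> a \<oplus>\<^bsub>R\<^esub> b \<otimes>\<^bsub>R\<^esub> y = a' \<oplus>\<^bsub>R\<^esub> b' \<otimes>\<^bsub>R\<^esub> y \<and> b \<odot>\<^bsub>E\<^esub> x = b' \<odot>\<^bsub>E\<^esub> x"
      using that by blast
  next
    fix e assume "\<exists>a' b'. a' \<in> A \<and> b' \<in> carrier R \<and> a \<oplus>\<^bsub>R\<^esub> b \<otimes>\<^bsub>R\<^esub> y = a' \<oplus>\<^bsub>R\<^esub> b' \<otimes>\<^bsub>R\<^esub> y \<and> e = b' \<odot>\<^bsub>E\<^esub> x"
    then show "e = b \<odot>\<^bsub>E\<^esub> x" using unique[OF that] by metis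
  qed
  have "f \<in> module_hom R (B\<lparr>carrier := N\<rparr>) E"
  proof (rule module_homI)
    fix p assume "p \<in> carrier (B\<lparr>carrier := N\<rparr>)"
    then obtain a b where ab: "p = a \<oplus>\<^bsub>R\<^esub> b \<otimes>\<^bsub>R\<^esub> y" "a \<in> A" "b \<in> carrier R" unfolding N_def by auto
    then show "f p \<in> carrier E" using f x by simp
    { fix c assume c: "c \<in> carrier R"
      show "f (c \<odot>\<^bsub>B\<lparr>carrier := N\<rparr>\<^esub> p) = c \<odot>\<^bsub>E\<^esub> f p"
        using f[OF A.I_l_closed[OF ab(2) c], of "c \<otimes>\<^bsub>R\<^esub> b"] N_mult[OF ab(2,3) c] ab c f[OF ab(2,3)] x
        by (simp add: Bs E.smult_assoc1) }
    { fix p' assume "p' \<in> carrier (B\<lparr>carrier := N\<rparr>)"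
      then obtain a' b' where ab': "p' = a' \<oplus>\<^bsub>R\<^esub> b' \<otimes>\<^bsub>R\<^esub> y" "a' \<in> A" "b' \<in> carrier R" unfolding N_def by auto
      show "f (p \<oplus>\<^bsub>B\<lparr>carrier := N\<rparr>\<^esub> p') = f p \<oplus>\<^bsub>E\<^esub> f p'"
        using f[OF A.a_closed[OF ab(2) ab'(2)], of "b \<oplus>\<^bsub>R\<^esub> b'"] N_add[OF ab(2,3) ab'(2,3)] ab ab'
          f[OF ab(2,3)] f[OF ab'(2,3)] x
        by (simp add: Bs E.smult_l_distr) }
  qed
  then obtain g where g: "g \<in> module_hom R B E" and gN: "\<And>p. p \<in> N \<Longrightarrow> g p = f p"
    using E B N unfolding injective_module_def by blast
  have gs: "p \<odot>\<^bsub>E\<^esub> g \<one>\<^bsub>R\<^esub> = g p" if "p \<in> carrier R" for p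
    using module_homD(3)[OF g that, of "\<one>\<^bsub>R\<^esub>"] that by (simp add: Bs)
  show ?thesis
  proof (intro bexI[of _ "g \<one>\<^bsub>R\<^esub>"] conjI ballI)
    show "g \<one>\<^bsub>R\<^esub> \<in> carrier E" using module_homD(1)[OF g, of "\<one>\<^bsub>R\<^esub>"] by (simp add: Bs)
    show "y \<odot>\<^bsub>E\<^esub> g \<one>\<^bsub>R\<^esub> = x"
      using f[OF A.zero_closed E.R.one_closed] NI[OF A.zero_closed E.R.one_closed] gN[of y] gs[OF y] x y by simp
    fix a assume a: "a \<in> A"
    show "a \<odot>\<^bsub>E\<^esub> g \<one>\<^bsub>R\<^esub> = \<zero>\<^bsub>E\<^esub>"
      using f[OF a E.R.zero_closed] NI[OF a E.R.zero_closed] gN[of a] gs[OF A.Icarr[OF a]] x y A.Icarr[OF a] by simp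
  qed
qed

lemma poly_ring_simps [simp]:
  "one (poly_ring X) = 1" "zero (poly_ring X) = 0" "mult (poly_ring X) = (*)" "add (poly_ring X) = (+)"
  by (simp_all add: poly_ring_def)

lemma poly_ring_pow [simp]: "p [^]\<^bsub>poly_ring X\<^esub> (n::nat) = p ^ n"
  by (induction n) (simp_all add: mult.commute)

lemma poly_carrier: "p \<in> carrier (poly_ring X) \<longleftrightarrow> (\<forall>t\<in>keys p. keys t \<subseteq> X)"
  by (simp add: poly_ring_def)

lemma lookup_monom_times:
  fixes p :: "('v, 'k::field) mpoly"
  shows "lookup (single s c * p) (s + t) = c * lookup p t"
proof -
  have "lookup (single s c * p) (s + t)
     = (\<Sum>l. (c * (\<Sum>q. lookup p q when s + t = l + q)) when l = s)"
    unfolding lookup_mult lookup_single by (intro Sum_any.cong) (auto simp: when_def)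
  also have "\<dots> = c * (\<Sum>q. lookup p q when s + t = s + q)" by simp
  also have "(\<Sum>q. lookup p q when s + t = s + q) = (\<Sum>q. lookup p q when q = t)"
    by (intro Sum_any.cong) (auto simp: when_def)
  finally show ?thesis by simp
qed

lemma keys_monom_times: "r \<in> keys (single s c * p) \<Longrightarrow> \<exists>t\<in>keys p. r = s + t"
  using keys_mult[of "single s c" p] by (auto split: if_splits)

lemma var_power: "(var v :: ('v, 'k::field) mpoly) ^ k = single (single v k) 1"
  by (induction k) (simp_all add: var_def mult_single single_add[symmetric])

lemma poly_sum_monomials:
  fixes p :: "'a \<Rightarrow>\<^sub>0 'b::comm_monoid_add"
  shows "p = (\<Sum>t\<in>keys p. single t (lookup p t))"
proof (rule poly_mapping_eqI)
  fix t
  show "lookup p t = lookup (\<Sum>t\<in>keys p. single t (lookup p t)) t"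
    by (simp add: lookup_sum lookup_single when_def sum.delta in_keys_iff)
qed

text \<open>Both the Stanley--Reisner ideal and the ideals generated by powers of variables are spanned by
  monomials. In this form membership and regularity become questions about exponent vectors.\<close>

definition monom_ideal :: "'v set \<Rightarrow> (('v \<Rightarrow>\<^sub>0 nat) \<Rightarrow> bool) \<Rightarrow> ('v, 'k::field) mpoly set" where
  "monom_ideal X P = {p \<in> carrier (poly_ring X). \<forall>t\<in>keys p. P t}"

lemma ideal_monom_ideal:
  assumes "\<And>s t. P t \<Longrightarrow> P (s + t)"
  shows "ideal (monom_ideal X P :: ('v, 'k::field) mpoly set) (poly_ring X)"
proof -
  interpret cring "poly_ring X :: ('v, 'k) mpoly ring" by (rule cring_poly_ring)
  let ?I = "monom_ideal X P :: ('v, 'k) mpoly set"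
  have neg: "\<ominus>\<^bsub>poly_ring X\<^esub> p = - p" if "p \<in> carrier (poly_ring X :: ('v, 'k) mpoly ring)" for p
    using that by (intro minus_equality) (auto simp: poly_carrier)
  have mult: "a * p \<in> ?I" if "p \<in> ?I" "a \<in> carrier (poly_ring X)" for a p
  proof -
    have "P t" if t: "t \<in> keys (a * p)" for t
      using keys_mult[of a p] t \<open>p \<in> ?I\<close> assms by (force simp: monom_ideal_def)
    moreover have "a * p \<in> carrier (poly_ring X)"
      using m_closed[of a p] that by (simp add: monom_ideal_def)
    ultimately show ?thesis by (simp add: monom_ideal_def)
  qed
  show ?thesis
  proof (rule idealI)
    show "ring (poly_ring X :: ('v, 'k) mpoly ring)" by (rule ring_axioms)
    show "subgroup ?I (add_monoid (poly_ring X))"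
    proof (rule add.subgroupI)
      show "?I \<subseteq> carrier (poly_ring X)" "?I \<noteq> {}"
        by (auto simp: monom_ideal_def poly_carrier intro!: exI[of _ 0])
      fix p q assume "p \<in> ?I" "q \<in> ?I"
      then show "p \<oplus>\<^bsub>poly_ring X\<^esub> q \<in> ?I"
        using a_closed[of p q] by (auto simp: monom_ideal_def dest!: subsetD[OF Poly_Mapping.keys_add])
    next
      fix p assume p: "p \<in> ?I"
      have "- p \<in> ?I" using p by (simp add: monom_ideal_def poly_carrier)
      moreover have "\<ominus>\<^bsub>poly_ring X\<^esub> p = - p" using neg p by (simp add: monom_ideal_def)
      ultimately show "\<ominus>\<^bsub>poly_ring X\<^esub> p \<in> ?I" by simp
    qed
  qed (use mult in \<open>auto simp: mult.commute\<close>)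
qed

text \<open>Each monomial of \<open>p\<close> is a multiple of some \<open>var u ^ k\<close>.\<close>

lemma monomial_multiples_kill:
  fixes E :: "(('v, 'k::field) mpoly, 'b) module"
  assumes E: "module (poly_ring X) E" and T: "T \<subseteq> X" and x: "x \<in> carrier E"
    and kill: "\<And>u. u \<in> T \<Longrightarrow> var u ^ k \<odot>\<^bsub>E\<^esub> x = \<zero>\<^bsub>E\<^esub>"
    and p: "p \<in> monom_ideal X (\<lambda>t. \<exists>u\<in>T. k \<le> lookup t u)"
  shows "p \<odot>\<^bsub>E\<^esub> x = \<zero>\<^bsub>E\<^esub>"
proof -
  interpret E: module "poly_ring X" E by (rule E)
  have mono: "single t c \<in> carrier (poly_ring X) \<and> single t c \<odot>\<^bsub>E\<^esub> x = \<zero>\<^bsub>E\<^esub>"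
    if t: "keys t \<subseteq> X" "u \<in> T" "k \<le> lookup t u" for t u c
  proof -
    let ?s = "t - single u k"
    have ts: "t = ?s + single u k"
      by (rule poly_mapping_eqI) (use t(3) in \<open>auto simp: lookup_add lookup_minus lookup_single when_def\<close>)
    have s: "single ?s c \<in> carrier (poly_ring X)"
      using t(1) ts by (auto simp: poly_carrier in_keys_iff lookup_minus subset_iff)
    have u: "var u ^ k \<in> carrier (poly_ring X)" using t T by (auto simp: var_power poly_carrier split: if_splits)
    have "single t c = single ?s c * var u ^ k"
      by (subst ts) (simp add: var_power mult_single)
    then have "single t c \<odot>\<^bsub>E\<^esub> x = single ?s c \<odot>\<^bsub>E\<^esub> (var u ^ k \<odot>\<^bsub>E\<^esub> x)"
      using E.smult_assoc1[OF s u x] by simp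
    then show ?thesis using kill[OF t(2)] s t(1) by (simp add: poly_carrier)
  qed
  have "F \<subseteq> keys p \<Longrightarrow> (\<Sum>t\<in>F. single t (lookup p t)) \<in> carrier (poly_ring X) \<and>
      (\<Sum>t\<in>F. single t (lookup p t)) \<odot>\<^bsub>E\<^esub> x = \<zero>\<^bsub>E\<^esub>" if "finite F" for F
    using that
  proof induction
    case empty
    then show ?case using E.smult_l_null[OF x] E.R.zero_closed by simp
  next
    case (insert t F)
    then obtain u where u: "u \<in> T" "k \<le> lookup t u" "keys t \<subseteq> X"
      using p by (auto simp: monom_ideal_def poly_carrier)
    show ?case using insert mono[OF u(3,1,2), of "lookup p t"] x
      E.smult_l_distr[of "single t (lookup p t)" "\<Sum>t\<in>F. single t (lookup p t)" x]
      E.R.a_closed[of "single t (lookup p t)" "\<Sum>t\<in>F. single t (lookup p t)"]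
      by simp
  qed
  from this[of "keys p"] show ?thesis using poly_sum_monomials[of p] by simp
qed

section \<open>Local cohomology with respect to variables\<close>

text \<open>The value zero off \<open>W\<close> makes this a family of ring elements indexed by a whole type.\<close>

definition vars_on :: "'v set \<Rightarrow> 'v \<Rightarrow> ('v, 'k::field) mpoly" where
  "vars_on W v = (if v \<in> W then var v else 0)"

lemma vars_on_closed: "W \<subseteq> X \<Longrightarrow> vars_on W v \<in> carrier (poly_ring X)"
  by (auto simp: vars_on_def poly_carrier var_def split: if_splits)

lemma var_power_monom_ideal:
  "u \<in> T \<Longrightarrow> T \<subseteq> X \<Longrightarrow> var u ^ k \<in> monom_ideal X (\<lambda>t. \<exists>u\<in>T. k \<le> lookup t u)"
  by (auto simp: monom_ideal_def poly_carrier var_power intro!: bexI[of _ u] split: if_splits)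

lemma ideal_powers_of_vars:
  "ideal (monom_ideal X (\<lambda>t. \<exists>u\<in>T. k \<le> lookup t u) :: ('v, 'k::field) mpoly set) (poly_ring X)"
  by (rule ideal_monom_ideal) (auto simp: lookup_add intro: trans_le_add2)

text \<open>The \<open>k\<close>-th powers of distinct variables form a regular sequence, because a monomial \<open>y\<^sub>a\<^sup>k t\<close>
  is divisible by \<open>y\<^sub>u\<^sup>k\<close> with \<open>u \<noteq> a\<close> only if \<open>t\<close> is. Hence injective modules satisfy the
  divisibility hypothesis of \<open>koszul_exact\<close>.\<close>

lemma injective_koszul_acyclic:
  fixes E :: "(('v, 'k::field) mpoly, 'b) module"
  assumes inj: "injective_module (poly_ring X) E" and ws: "distinct ws" "set ws \<subseteq> X"
  shows "koszul_acyclic (poly_ring X) E (vars_on (set ws)) ws"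
proof -
  interpret E: module "poly_ring X" E using inj by (simp add: injective_module_def)
  let ?y = "vars_on (set ws) :: 'v \<Rightarrow> ('v, 'k) mpoly"
  have y: "?y v ^ k \<in> carrier (poly_ring X)" for v k
    using E.R.nat_pow_closed[OF vars_on_closed[OF ws(2)], of v k] by simp
  have "\<exists>e\<in>carrier E. ?y a ^ k \<odot>\<^bsub>E\<^esub> e = x \<and> (\<forall>v\<in>T. ?y v ^ k \<odot>\<^bsub>E\<^esub> e = \<zero>\<^bsub>E\<^esub>)"
    if T: "insert a T \<subseteq> set ws" "a \<notin> T" and x: "x \<in> carrier E" and kill: "\<forall>v\<in>T. ?y v ^ k \<odot>\<^bsub>E\<^esub> x = \<zero>\<^bsub>E\<^esub>"
    for a T x k
  proof -
    let ?A = "monom_ideal X (\<lambda>t. \<exists>u\<in>T. k \<le> lookup t u) :: ('v, 'k) mpoly set"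
    have yv: "?y v = var v" if "v \<in> insert a T" for v using that T by (auto simp: vars_on_def)
    have TX: "T \<subseteq> X" using T ws by blast
    have reg: "b \<in> ?A" if b: "b \<in> carrier (poly_ring X)" "?y a ^ k \<otimes>\<^bsub>poly_ring X\<^esub> b \<in> ?A" for b
    proof -
      have "\<exists>u\<in>T. k \<le> lookup t u" if t: "t \<in> keys b" for t
      proof -
        have "single a k + t \<in> keys (?y a ^ k * b)"
          using t by (simp add: yv var_power in_keys_iff lookup_monom_times)
        then obtain u where u: "u \<in> T" "k \<le> lookup (single a k + t) u"
          using b(2) by (auto simp: monom_ideal_def)
        then have "u \<noteq> a" using T by blast
        then show ?thesis using u by (auto simp: lookup_add lookup_single)
      qed
      then show ?thesis using b(1) by (simp add: monom_ideal_def)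
    qed
    have kill': "p \<odot>\<^bsub>E\<^esub> x = \<zero>\<^bsub>E\<^esub>" if "p \<in> ?A" for p
    proof (rule monomial_multiples_kill[OF E.module_axioms TX x _ that])
      show "var u ^ k \<odot>\<^bsub>E\<^esub> x = \<zero>\<^bsub>E\<^esub>" if "u \<in> T" for u using kill yv[of u] that by auto
    qed
    have "\<exists>e\<in>carrier E. ?y a ^ k \<odot>\<^bsub>E\<^esub> e = x \<and> (\<forall>p\<in>?A. p \<odot>\<^bsub>E\<^esub> e = \<zero>\<^bsub>E\<^esub>)"
      by (rule injective_coregular[OF inj ideal_powers_of_vars y reg x kill'])
    then obtain e where e: "e \<in> carrier E" "?y a ^ k \<odot>\<^bsub>E\<^esub> e = x" "\<forall>p\<in>?A. p \<odot>\<^bsub>E\<^esub> e = \<zero>\<^bsub>E\<^esub>"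
      by (elim bexE conjE)
    have "?y v ^ k \<odot>\<^bsub>E\<^esub> e = \<zero>\<^bsub>E\<^esub>" if v: "v \<in> T" for v
      using bspec[OF e(3) var_power_monom_ideal[OF v TX]] yv[of v] v by simp
    then show ?thesis using e(1,2) by (intro bexI[of _ e] conjI ballI)
  qed
  note div = this
  show ?thesis unfolding koszul_acyclic_def poly_ring_pow
  proof (intro allI impI)
    fix k i z
    assume i: "0 < i" and z: "\<forall>r. z r \<in> carrier E"
      and coc: "\<forall>r. subseq r ws \<longrightarrow> length r = Suc i \<longrightarrow> koszul E (\<lambda>v. ?y v ^ k) z r = \<zero>\<^bsub>E\<^esub>"
    show "\<exists>u. (\<forall>r. u r \<in> carrier E) \<and>
       (\<forall>r. subseq r ws \<longrightarrow> length r = i \<longrightarrow> z r = koszul E (\<lambda>v. ?y v ^ k) u r)"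
      by (rule E.koszul_exact[of "\<lambda>v. ?y v ^ k" ws z i, OF y ws(1) div]) (use i z coc in auto)
  qed
qed

text \<open>The generators of \<open>Q\<close> have degree one in the variables of \<open>W\<close>, and degrees add up under
  multiplication.\<close>

lemma ideal_power_weight:
  fixes Q :: "('v, 'k::field) mpoly set"
  assumes W: "W \<subseteq> X" "finite W" and Q: "Q = Idl\<^bsub>poly_ring X\<^esub> (var ` W)"
  shows "Q [^]\<^bsub>ideals_set (poly_ring X)\<^esub> (m::nat)
    \<subseteq> monom_ideal X (\<lambda>t. m \<le> (\<Sum>v\<in>W. lookup t v))"
proof (induction m)
  case 0
  show ?case by (auto simp: ideals_set_def monom_ideal_def)
next
  case (Suc m)
  interpret cring "poly_ring X :: ('v, 'k) mpoly ring" by (rule cring_poly_ring)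
  let ?D = "\<lambda>m. monom_ideal X (\<lambda>t. m \<le> (\<Sum>v\<in>W. lookup t v)) :: ('v, 'k) mpoly set"
  have D: "ideal (?D m) (poly_ring X)" for m
    by (rule ideal_monom_ideal) (auto simp: lookup_add sum.distrib)
  have Q1: "Q \<subseteq> ?D 1" unfolding Q
  proof (rule genideal_minimal[OF D], rule image_subsetI)
    fix v assume v: "v \<in> W"
    have "1 \<le> (\<Sum>w\<in>W. lookup (single v (1::nat)) w)"
      using member_le_sum[OF v _ W(2), of "lookup (single v (1::nat))"] by simp
    then show "var v \<in> ?D 1"
      using v W(1) by (auto simp: monom_ideal_def poly_carrier var_def split: if_splits)
  qed
  have "s \<in> ?D (Suc m)" if "s \<in> (Q [^]\<^bsub>ideals_set (poly_ring X)\<^esub> m) \<cdot>\<^bsub>poly_ring X\<^esub> Q" for s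
    using that
  proof induction
    case (prod i j)
    then have ij: "i \<in> ?D m" "j \<in> ?D 1" using Suc.IH Q1 by blast+
    have "Suc m \<le> (\<Sum>v\<in>W. lookup t v)" if t: "t \<in> keys (i * j)" for t
    proof -
      obtain a b where ab: "t = a + b" "a \<in> keys i" "b \<in> keys j"
        using keys_mult[of i j] t by blast
      then have "m \<le> (\<Sum>v\<in>W. lookup a v)" "1 \<le> (\<Sum>v\<in>W. lookup b v)"
        using ij by (auto simp: monom_ideal_def)
      then show ?thesis using ab by (simp add: lookup_add sum.distrib)
    qed
    then show ?case using ij m_closed[of i j] by (simp add: monom_ideal_def)
  next
    case (sum s1 s2)
    then show ?case using additive_subgroup.a_closed[OF ideal.axioms(1)[OF D]] by blast
  qed
  then show ?case by (auto simp: ideals_set_def)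
qed

text \<open>A monomial of degree more than \<open>|W| k\<close> in the variables of \<open>W\<close> contains one of them at
  least \<open>k\<close> times, so being killed by a power of \<open>Q\<close> and being killed by a power of each generator are the
  same.\<close>

lemma torsion_part_vars:
  fixes E :: "(('v, 'k::field) mpoly, 'b) module" and Q :: "('v, 'k) mpoly set"
  assumes E: "module (poly_ring X) E" and W: "W \<subseteq> X" "finite W" and Q: "Q = Idl\<^bsub>poly_ring X\<^esub> (var ` W)"
  shows "torsion_part (poly_ring X) Q E = power_torsion (poly_ring X) (vars_on W) W E"
proof -
  interpret E: module "poly_ring X" E by (rule E)
  have varX: "var ` W \<subseteq> carrier (poly_ring X :: ('v, 'k) mpoly ring)"
    using W by (auto simp: poly_carrier var_def split: if_splits)
  have pw: "var v ^ k \<in> Q [^]\<^bsub>ideals_set (poly_ring X)\<^esub> (k::nat)" if "v \<in> W" for v k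
  proof (induction k)
    case 0
    show ?case using E.R.one_closed by (simp add: ideals_set_def)
  next
    case (Suc k)
    have "var v \<in> Q" unfolding Q using E.R.genideal_self[OF varX] that by blast
    from ideal_prod.prod[OF Suc.IH this, of "poly_ring X"] show ?case by (simp add: ideals_set_def mult.commute)
  qed
  show ?thesis
  proof (intro equalityI subsetI)
    fix x assume "x \<in> torsion_part (poly_ring X) Q E"
    then obtain k :: nat where x: "x \<in> carrier E"
      and k: "\<And>a. a \<in> Q [^]\<^bsub>ideals_set (poly_ring X)\<^esub> k \<Longrightarrow> a \<odot>\<^bsub>E\<^esub> x = \<zero>\<^bsub>E\<^esub>"
      unfolding torsion_part_def by blast
    show "x \<in> power_torsion (poly_ring X) (vars_on W) W E"
      unfolding power_torsion_def using x k pw by (auto simp: vars_on_def intro!: exI[of _ k])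
  next
    fix x assume "x \<in> power_torsion (poly_ring X) (vars_on W) W E"
    then obtain k :: nat where x: "x \<in> carrier E" and k: "\<And>v. v \<in> W \<Longrightarrow> var v ^ k \<odot>\<^bsub>E\<^esub> x = \<zero>\<^bsub>E\<^esub>"
      by (auto simp: power_torsion_def vars_on_def)
    have "a \<odot>\<^bsub>E\<^esub> x = \<zero>\<^bsub>E\<^esub>" if a: "a \<in> Q [^]\<^bsub>ideals_set (poly_ring X)\<^esub> (Suc (card W * k))" for a
    proof (rule monomial_multiples_kill[OF E W(1) x k])
      have "\<exists>u\<in>W. k \<le> lookup t u" if "Suc (card W * k) \<le> (\<Sum>v\<in>W. lookup t v)" for t
      proof (rule ccontr)
        assume "\<not> ?thesis"
        then have "(\<Sum>v\<in>W. lookup t v) \<le> (\<Sum>v\<in>W. k)" by (intro sum_mono) (auto simp: not_le less_imp_le)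
        then show False using that by simp
      qed
      then show "a \<in> monom_ideal X (\<lambda>t. \<exists>u\<in>W. k \<le> lookup t u)"
        using subsetD[OF ideal_power_weight[OF W Q] a] by (auto simp: monom_ideal_def)
    qed
    then show "x \<in> torsion_part (poly_ring X) Q E" unfolding torsion_part_def using x by blast
  qed
qed

text \<open>The scalars of the polynomial ring, over which the cobar resolution is formed.\<close>

lemma field_constants:
  "field ((poly_ring X :: ('v, 'k::field) mpoly ring)\<lparr>carrier := range (single 0)\<rparr>)"
    (is "field ?F")
proof -
  have "cring ?F"
  proof (rule cringI)
    show "abelian_group ?F"
    proof (rule abelian_groupI)
      fix p assume "p \<in> carrier ?F"
      then obtain c where "p = single 0 c" by auto
      then show "\<exists>q\<in>carrier ?F. q \<oplus>\<^bsub>?F\<^esub> p = \<zero>\<^bsub>?F\<^esub>"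
        by (intro bexI[of _ "single 0 (- c)"]) (auto simp: single_add[symmetric])
    qed (auto simp: single_add[symmetric] add.assoc add.commute intro: range_eqI[of _ _ 0])
    show "Group.comm_monoid ?F"
      by (rule comm_monoidI) (auto simp: mult_single mult.assoc mult.commute intro: range_eqI[of _ _ 1])
  qed (auto simp: distrib_right)
  then show ?thesis
  proof (rule cring.cring_fieldI2)
    fix a assume "a \<in> carrier ?F" "a \<noteq> \<zero>\<^bsub>?F\<^esub>"
    then obtain c where "a = single 0 c" "single 0 c \<noteq> (0 :: ('v, 'k) mpoly)" by auto
    then show "\<exists>b\<in>carrier ?F. a \<otimes>\<^bsub>?F\<^esub> b = \<one>\<^bsub>?F\<^esub>"
      by (intro bexI[of _ "single 0 (inverse c)"]) (cases "c = 0"; auto simp: mult_single)+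
  qed simp
qed

theorem local_cohomology_vars_trivial_iff:
  fixes M :: "(('v, 'k::field) mpoly, 'b) module" and Q :: "('v, 'k) mpoly set"
  assumes M: "module (poly_ring X) M" and ws: "distinct ws" "set ws \<subseteq> X"
    and Q: "Q = Idl\<^bsub>poly_ring X\<^esub> (var ` set ws)"
  shows "trivial_group (local_cohomology (poly_ring X) Q M i) \<longleftrightarrow>
    cech_vanishes (poly_ring X) M (vars_on (set ws)) ws i"
proof -
  interpret module_over_subfield "poly_ring X" M "range (single 0)"
    by (intro module_over_subfield.intro module_over_subfield_axioms.intro M field_constants)
       (auto simp: poly_carrier)
  show ?thesis
    by (rule local_cohomology_trivial_iff[OF M vars_on_closed[OF ws(2)] cobar_resolution
          injective_koszul_acyclic[OF _ ws] torsion_part_vars[OF _ ws(2) _ Q]]) auto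
qed

section \<open>Simplicial cochains\<close>

text \<open>The sign with which the face \<open>T - {v}\<close> occurs in the boundary of the oriented simplex \<open>T\<close>.\<close>

definition pos_sign :: "'v::linorder set \<Rightarrow> 'v \<Rightarrow> 'k::comm_ring_1" where
  "pos_sign T v = (-1) ^ card {u \<in> T. u < v}"

lemma pos_sign_square: "pos_sign T v * pos_sign T v = 1"
  by (simp add: pos_sign_def power_mult_distrib[symmetric])

lemma pos_sign_square_left: "pos_sign T v * (pos_sign T v * x) = x"
  by (simp add: mult.assoc[symmetric] pos_sign_square)

lemma pos_sign_exchange:
  assumes "finite T" "v \<in> T" "w \<in> T" "v \<noteq> w"
  shows "pos_sign T v * pos_sign (T - {v}) w = - (pos_sign T w * pos_sign (T - {w}) v :: 'k::comm_ring_1)"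
proof -
  have *: "pos_sign T b * pos_sign (T - {b}) a = - (pos_sign T a * pos_sign (T - {a}) b :: 'k)"
    if "a \<in> T" "b \<in> T" "a < b" for a b
  proof -
    have "{u \<in> T. u < b} = insert a {u \<in> T - {a}. u < b}" using that by auto
    then have "pos_sign T b = - (pos_sign (T - {a}) b :: 'k)"
      using assms(1) by (simp add: pos_sign_def)
    moreover have "{u \<in> T - {b}. u < a} = {u \<in> T. u < a}" using that by auto
    then have "pos_sign (T - {b}) a = (pos_sign T a :: 'k)" by (simp add: pos_sign_def)
    ultimately show ?thesis by (simp add: mult.commute)
  qed
  show ?thesis
  proof (cases "v < w")
    case True
    then show ?thesis using *[of v w] assms by simp
  next
    case False
    then show ?thesis using *[of w v] assms by simp
  qed
qed

definition coboundary :: "('v::linorder set \<Rightarrow> 'k::comm_ring_1) \<Rightarrow> 'v set \<Rightarrow> 'k" where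
  "coboundary c T = (\<Sum>v\<in>T. pos_sign T v * c (T - {v}))"

text \<open>The reduced cohomology of \<open>\<Gamma>\<close> with coefficients in \<open>'k\<close> vanishes in degree \<open>p - 1\<close>, the
  degree of the faces with \<open>p\<close> elements. Cochains are arbitrary functions on sets of vertices.\<close>

definition coexact :: "'k::comm_ring_1 itself \<Rightarrow> 'v::linorder set set \<Rightarrow> nat \<Rightarrow> bool" where
  "coexact K \<Gamma> p \<longleftrightarrow> (\<forall>c :: 'v set \<Rightarrow> 'k.
     (\<forall>T\<in>\<Gamma>. card T = Suc p \<longrightarrow> coboundary c T = 0) \<longrightarrow>
     (\<exists>u. \<forall>T\<in>\<Gamma>. card T = p \<longrightarrow> c T = coboundary u T))"

lemma coexactD:
  fixes c :: "'v::linorder set \<Rightarrow> 'k::comm_ring_1"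
  assumes "coexact TYPE('k) \<Gamma> p" "\<And>T. T \<in> \<Gamma> \<Longrightarrow> card T = Suc p \<Longrightarrow> coboundary c T = 0"
  obtains u where "\<And>T. T \<in> \<Gamma> \<Longrightarrow> card T = p \<Longrightarrow> c T = coboundary u T"
proof -
  have "\<exists>u. \<forall>T\<in>\<Gamma>. card T = p \<longrightarrow> c T = coboundary u T"
    using assms(1)[unfolded coexact_def, THEN spec[of _ c]] assms(2) by simp
  then show ?thesis using that by blast
qed

lemma coboundary_coboundary:
  fixes c :: "'v::linorder set \<Rightarrow> 'k::comm_ring_1"
  assumes T: "finite T"
  shows "coboundary (coboundary c) T = 0"
proof -
  let ?f = "\<lambda>v w. pos_sign T v * (pos_sign (T - {v}) w * c (T - {v} - {w}))"
  let ?A = "{(v, w). v \<in> T \<and> w \<in> T \<and> v < w}" and ?B = "{(v, w). v \<in> T \<and> w \<in> T \<and> w < v}"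
  have fin: "finite ?A" "finite ?B" using T by (auto intro: finite_subset[of _ "T \<times> T"])
  have "coboundary (coboundary c) T = (\<Sum>v\<in>T. \<Sum>w\<in>T - {v}. ?f v w)"
    by (simp add: coboundary_def sum_distrib_left)
  also have "\<dots> = (\<Sum>(v, w)\<in>(SIGMA v:T. T - {v}). ?f v w)" using T by (simp add: sum.Sigma)
  also have "(SIGMA v:T. T - {v}) = ?A \<union> ?B" by auto
  also have "(\<Sum>(v, w)\<in>?A \<union> ?B. ?f v w) = (\<Sum>(v, w)\<in>?A. ?f v w) + (\<Sum>(v, w)\<in>?B. ?f v w)"
    using fin by (intro sum.union_disjoint) auto
  also have "(\<Sum>(v, w)\<in>?B. ?f v w) = (\<Sum>(v, w)\<in>?A. ?f w v)"
    by (rule sum.reindex_bij_witness[of _ prod.swap prod.swap]) auto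
  also have "\<dots> = (\<Sum>(v, w)\<in>?A. - ?f v w)"
  proof (intro sum.cong refl, clarify)
    fix v w assume "v \<in> T" "w \<in> T" "v < w"
    then show "?f w v = - ?f v w" using pos_sign_exchange[OF T, of v w, where 'k = 'k]
      by (simp add: mult.assoc[symmetric] insert_commute Diff_insert[symmetric])
  qed
  also have "(\<Sum>(v, w)\<in>?A. ?f v w) + (\<Sum>(v, w)\<in>?A. - ?f v w) = 0"
    unfolding sum.distrib[symmetric] by (rule sum.neutral) auto
  finally show ?thesis .
qed

text \<open>The contracting homotopy of a cone with apex \<open>w\<close> sends \<open>c\<close> to
  \<open>A \<mapsto> \<plusminus> c (insert w A)\<close>.\<close>

lemma cone_coexact:
  fixes \<Gamma> :: "'v::linorder set set"
  assumes fin: "\<And>T. T \<in> \<Gamma> \<Longrightarrow> finite T" and sub: "\<And>T. T \<in> \<Gamma> \<Longrightarrow> T - {w} \<in> \<Gamma>"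
    and cone: "\<And>T. T \<in> \<Gamma> \<Longrightarrow> insert w T \<in> \<Gamma>"
  shows "coexact TYPE('k::comm_ring_1) \<Gamma> p"
  unfolding coexact_def
proof (intro allI impI)
  fix c :: "'v set \<Rightarrow> 'k"
  assume coc: "\<forall>T\<in>\<Gamma>. card T = Suc p \<longrightarrow> coboundary c T = 0"
  define u where "u A = (if w \<in> A then 0 else pos_sign (insert w A) w * c (insert w A))" for A
  have "c T = coboundary u T" if T: "T \<in> \<Gamma>" "card T = p" for T
  proof (cases "w \<in> T")
    case True
    have "coboundary u T = (\<Sum>v\<in>T. if v = w then c T else 0)"
      unfolding coboundary_def
      using True by (intro sum.cong) (auto simp: u_def insert_absorb pos_sign_square_left)
    then show ?thesis using True fin[OF T(1)] by simp
  next
    case False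
    let ?U = "insert w T"
    have fT: "finite T" using fin T by blast
    have "coboundary c ?U = 0" using coc cone[OF T(1)] T False fT by simp
    then have "pos_sign ?U w * c T + (\<Sum>v\<in>T. pos_sign ?U v * c (?U - {v})) = 0"
      using False fT by (simp add: coboundary_def)
    from arg_cong[OF this, of "\<lambda>x. pos_sign ?U w * x"]
    have "pos_sign ?U w * (pos_sign ?U w * c T) + pos_sign ?U w * (\<Sum>v\<in>T. pos_sign ?U v * c (?U - {v})) = 0"
      by (simp add: distrib_left)
    then have "c T = - (\<Sum>v\<in>T. pos_sign ?U w * pos_sign ?U v * c (?U - {v}))"
      by (simp add: pos_sign_square_left eq_neg_iff_add_eq_0 sum_distrib_left mult.assoc)
    also have "\<dots> = (\<Sum>v\<in>T. pos_sign T v * u (T - {v}))"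
      unfolding sum_negf[symmetric]
    proof (intro sum.cong refl)
      fix v assume v: "v \<in> T"
      have ne: "v \<noteq> w" using v False by blast
      have U: "?U - {v} = insert w (T - {v})" using ne by auto
      have "pos_sign ?U v * pos_sign (?U - {v}) w = - (pos_sign ?U w * pos_sign T v :: 'k)"
        using pos_sign_exchange[of ?U v w, where 'k = 'k] fT v ne False by simp
      from arg_cong[OF this, of "\<lambda>x. x * pos_sign (?U - {v}) w"]
      have e: "pos_sign ?U v = - (pos_sign ?U w * pos_sign T v * pos_sign (?U - {v}) w :: 'k)"
        by (simp add: mult.assoc pos_sign_square)
      have "- (pos_sign ?U w * pos_sign ?U v * c (?U - {v}))
          = pos_sign ?U w * (pos_sign ?U w * (pos_sign T v * pos_sign (?U - {v}) w * c (?U - {v})))"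
        unfolding e by (simp add: mult.assoc)
      also have "\<dots> = pos_sign T v * u (T - {v})"
        unfolding pos_sign_square_left using False U by (simp add: u_def mult.assoc)
      finally show "- (pos_sign ?U w * pos_sign ?U v * c (?U - {v})) = pos_sign T v * u (T - {v})" .
    qed
    finally show ?thesis by (simp add: coboundary_def)
  qed
  then show "\<exists>u. \<forall>T\<in>\<Gamma>. card T = p \<longrightarrow> c T = coboundary u T" by blast
qed

text \<open>The same cohomology computed on the sets \<open>F \<union> T\<close> with the signs that \<open>v\<close> has in \<open>F \<union> T\<close>.
  This is the form in which a link occurs inside the Koszul complex. The two complexes become
  isomorphic after multiplying the component at \<open>T\<close> by the product of the signs of its vertices relative to
  \<open>F\<close>.\<close>

lemma coexact_translate:
  fixes F :: "'v::linorder set"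
  assumes "finite F" and disj: "\<And>T. T \<in> \<Gamma> \<Longrightarrow> finite T \<and> T \<inter> F = {}"
    and sub: "\<And>T v. T \<in> \<Gamma> \<Longrightarrow> T - {v} \<in> \<Gamma>"
  shows "coexact TYPE('k::comm_ring_1) \<Gamma> p \<longleftrightarrow> (\<forall>c :: 'v set \<Rightarrow> 'k.
     (\<forall>T\<in>\<Gamma>. card T = Suc p \<longrightarrow> (\<Sum>v\<in>T. pos_sign (F \<union> T) v * c (F \<union> (T - {v}))) = 0) \<longrightarrow>
     (\<exists>u. \<forall>T\<in>\<Gamma>. card T = p \<longrightarrow> c (F \<union> T) = (\<Sum>v\<in>T. pos_sign (F \<union> T) v * u (F \<union> (T - {v})))))"
    (is "_ \<longleftrightarrow> ?rel")
proof -
  \<comment> \<open>the signs of the elements of \<open>T\<close> relative to \<open>F\<close>; multiplying by them is an isomorphism of complexes\<close>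
  define \<tau> where "\<tau> T = (\<Prod>v\<in>T. pos_sign F v :: 'k)" for T
  have sq: "\<tau> T * \<tau> T = 1" for T
    by (simp add: \<tau>_def prod.distrib[symmetric] pos_sign_square)
  have sql: "\<tau> T * (\<tau> T * x) = x" for T x by (simp add: mult.assoc[symmetric] sq)
  have split: "pos_sign (F \<union> T) v = (pos_sign F v * pos_sign T v :: 'k)" if "T \<in> \<Gamma>" for T v
  proof -
    have "{u \<in> F \<union> T. u < v} = {u \<in> F. u < v} \<union> {u \<in> T. u < v}" by auto
    moreover have "card ({u \<in> F. u < v} \<union> {u \<in> T. u < v}) = card {u \<in> F. u < v} + card {u \<in> T. u < v}"
      using assms(1) disj[OF that] by (intro card_Un_disjoint) auto
    ultimately show ?thesis by (simp add: pos_sign_def power_add)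
  qed
  have tau: "pos_sign (F \<union> T) v = \<tau> T * pos_sign T v * \<tau> (T - {v})" if "T \<in> \<Gamma>" "v \<in> T" for T v
  proof -
    have "\<tau> T = pos_sign F v * \<tau> (T - {v})"
      unfolding \<tau>_def using disj[OF that(1)] that(2) by (intro prod.remove) auto
    then have "\<tau> T * pos_sign T v * \<tau> (T - {v}) = pos_sign F v * pos_sign T v * (\<tau> (T - {v}) * \<tau> (T - {v}))"
      by (simp add: mult_ac)
    then show ?thesis using split[OF that(1)] sq by simp
  qed
  have rel: "(\<Sum>v\<in>T. pos_sign (F \<union> T) v * c (F \<union> (T - {v}))) = \<tau> T * coboundary (\<lambda>T. \<tau> T * c (F \<union> T)) T"
    if "T \<in> \<Gamma>" for T and c :: "'v set \<Rightarrow> 'k"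
    unfolding coboundary_def sum_distrib_left using tau[OF that] by (intro sum.cong) (auto simp: mult_ac)
  have unF: "(F \<union> T) - F = T" if "T \<in> \<Gamma>" for T using disj[OF that] by auto
  show ?thesis
  proof
    assume co: "coexact TYPE('k) \<Gamma> p"
    show ?rel
    proof (intro allI impI)
      fix c :: "'v set \<Rightarrow> 'k"
      assume "\<forall>T\<in>\<Gamma>. card T = Suc p \<longrightarrow> (\<Sum>v\<in>T. pos_sign (F \<union> T) v * c (F \<union> (T - {v}))) = 0"
      then have z: "\<tau> T * coboundary (\<lambda>T. \<tau> T * c (F \<union> T)) T = 0" if "T \<in> \<Gamma>" "card T = Suc p" for T
        using rel[OF that(1), of c] that by simp
      have coc: "coboundary (\<lambda>T. \<tau> T * c (F \<union> T)) T = 0" if "T \<in> \<Gamma>" "card T = Suc p" for T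
        using z[OF that] sql[of T "coboundary (\<lambda>T. \<tau> T * c (F \<union> T)) T"] by simp
      obtain u where u: "\<And>T. T \<in> \<Gamma> \<Longrightarrow> card T = p \<Longrightarrow> \<tau> T * c (F \<union> T) = coboundary u T"
        by (rule coexactD[OF co coc]) (assumption | rule that)+
      define u' where "u' A = \<tau> (A - F) * u (A - F)" for A
      have "c (F \<union> T) = (\<Sum>v\<in>T. pos_sign (F \<union> T) v * u' (F \<union> (T - {v})))" if T: "T \<in> \<Gamma>" "card T = p" for T
      proof -
        have "coboundary (\<lambda>T. \<tau> T * u' (F \<union> T)) T = coboundary u T"
          unfolding coboundary_def using unF[OF sub[OF T(1)]]
          by (intro sum.cong) (auto simp: u'_def sql)
        then show ?thesis using rel[OF T(1), of u'] u[OF T, symmetric] sql by simp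
      qed
      then show "\<exists>u. \<forall>T\<in>\<Gamma>. card T = p \<longrightarrow> c (F \<union> T) = (\<Sum>v\<in>T. pos_sign (F \<union> T) v * u (F \<union> (T - {v})))" by blast
    qed
  next
    assume r: ?rel
    show "coexact TYPE('k) \<Gamma> p" unfolding coexact_def
    proof (intro allI impI)
      fix c :: "'v set \<Rightarrow> 'k"
      assume coc: "\<forall>T\<in>\<Gamma>. card T = Suc p \<longrightarrow> coboundary c T = 0"
      define c' where "c' A = \<tau> (A - F) * c (A - F)" for A
      have c': "coboundary (\<lambda>T. \<tau> T * c' (F \<union> T)) T = coboundary c T" if T: "T \<in> \<Gamma>" for T
        unfolding coboundary_def using unF[OF sub[OF T(1)]]
        by (intro sum.cong) (auto simp: c'_def sql)
      have "\<forall>T\<in>\<Gamma>. card T = Suc p \<longrightarrow> (\<Sum>v\<in>T. pos_sign (F \<union> T) v * c' (F \<union> (T - {v}))) = 0"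
        using rel[of _ c'] c' coc by simp
      then have "\<exists>u. \<forall>T\<in>\<Gamma>. card T = p \<longrightarrow> c' (F \<union> T) = (\<Sum>v\<in>T. pos_sign (F \<union> T) v * u (F \<union> (T - {v})))"
        by (rule r[THEN spec, THEN mp])
      then obtain u where u: "\<And>T. T \<in> \<Gamma> \<Longrightarrow> card T = p \<Longrightarrow>
          c' (F \<union> T) = (\<Sum>v\<in>T. pos_sign (F \<union> T) v * u (F \<union> (T - {v})))"
        by (elim exE) simp
      have "c T = coboundary (\<lambda>T. \<tau> T * u (F \<union> T)) T" if T: "T \<in> \<Gamma>" "card T = p" for T
      proof -
        have "\<tau> T * c T = \<tau> T * coboundary (\<lambda>T. \<tau> T * u (F \<union> T)) T"
          using u[OF T] rel[OF T(1), of u] unF[OF T(1)] by (simp add: c'_def)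
        then show ?thesis using sql by metis
      qed
      then show "\<exists>u. \<forall>T\<in>\<Gamma>. card T = p \<longrightarrow> c T = coboundary u T" by blast
    qed
  qed
qed

section \<open>Homology and cohomology over a field\<close>

text \<open>By induction on the columns of \<open>P\<close>: either every functional that kills the old columns also kills
  the new one, or some functional kills the old columns only and tells which multiple of the new
  one has to be subtracted from \<open>x\<close>.\<close>

lemma fredholm_alternative:
  fixes P :: "'a \<Rightarrow> 'b \<Rightarrow> 'k::field"
  assumes "finite X" and Y: "finite Y"
    and "\<And>f. (\<forall>b\<in>X. (\<Sum>a\<in>Y. f a * P a b) = 0) \<Longrightarrow> (\<Sum>a\<in>Y. f a * x a) = 0"
  shows "\<exists>z. \<forall>a\<in>Y. x a = (\<Sum>b\<in>X. P a b * z b)"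
  using assms(1,3)
proof (induction X arbitrary: x)
  case empty
  have "x a = 0" if a: "a \<in> Y" for a
  proof -
    have "(\<Sum>a'\<in>Y. (if a' = a then 1 else 0) * x a') = x a" using a Y by (simp add: if_distrib[of "\<lambda>c. c * _"] cong: if_cong)
    then show ?thesis using empty[of "\<lambda>a'. if a' = a then 1 else 0"] by simp
  qed
  then show ?case by simp
next
  case (insert b0 X)
  show ?case
  proof (cases "\<forall>f. (\<forall>b\<in>X. (\<Sum>a\<in>Y. f a * P a b) = 0) \<longrightarrow> (\<Sum>a\<in>Y. f a * P a b0) = 0")
    case True
    have "\<exists>z. \<forall>a\<in>Y. x a = (\<Sum>b\<in>X. P a b * z b)"
      by (rule insert.IH, rule insert.prems) (use True in simp)
    then obtain z where z: "\<forall>a\<in>Y. x a = (\<Sum>b\<in>X. P a b * z b)" by blast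
    have "(\<Sum>b\<in>insert b0 X. P a b * (z(b0 := 0)) b) = (\<Sum>b\<in>X. P a b * z b)" for a
      using insert.hyps by (auto intro!: sum.cong)
    then show ?thesis using z by (intro exI[of _ "z(b0 := 0)"]) simp
  next
    case False
    then obtain g where g: "\<forall>b\<in>X. (\<Sum>a\<in>Y. g a * P a b) = 0" "(\<Sum>a\<in>Y. g a * P a b0) \<noteq> 0" by blast
    define h where "h a = g a / (\<Sum>a\<in>Y. g a * P a b0)" for a
    have h: "(\<Sum>a\<in>Y. h a * w a) = (\<Sum>a\<in>Y. g a * w a) / (\<Sum>a\<in>Y. g a * P a b0)" for w
      by (simp add: h_def sum_divide_distrib)
    define c where "c = (\<Sum>a\<in>Y. h a * x a)"
    have "\<exists>z. \<forall>a\<in>Y. x a - c * P a b0 = (\<Sum>b\<in>X. P a b * z b)"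
    proof (rule insert.IH)
      fix f :: "'a \<Rightarrow> 'k" assume f: "\<forall>b\<in>X. (\<Sum>a\<in>Y. f a * P a b) = 0"
      define d where "d = (\<Sum>a\<in>Y. f a * P a b0)"
      \<comment> \<open>subtracting a multiple of \<open>h\<close> makes the functional vanish on the column \<open>b0\<close> as well\<close>
      have lin: "(\<Sum>a\<in>Y. (f a - d * h a) * w a) = (\<Sum>a\<in>Y. f a * w a) - d * (\<Sum>a\<in>Y. h a * w a)" for w
        by (simp add: left_diff_distrib sum_subtractf sum_distrib_left mult.assoc)
      have "(\<Sum>a\<in>Y. (f a - d * h a) * x a) = 0"
        by (rule insert.prems) (use f g in \<open>auto simp: lin h d_def[symmetric]\<close>)
      then have "(\<Sum>a\<in>Y. f a * x a) = d * c" unfolding lin by (simp add: c_def)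
      then show "(\<Sum>a\<in>Y. f a * (x a - c * P a b0)) = 0"
        by (simp add: right_diff_distrib sum_subtractf d_def sum_distrib_left sum_distrib_right mult_ac)
    qed
    then obtain z where z: "\<forall>a\<in>Y. x a - c * P a b0 = (\<Sum>b\<in>X. P a b * z b)" by blast
    have "(\<Sum>b\<in>insert b0 X. P a b * (z(b0 := c)) b) = P a b0 * c + (\<Sum>b\<in>X. P a b * z b)" for a
      using insert.hyps by (auto intro!: sum.cong)
    then have "\<forall>a\<in>Y. x a = (\<Sum>b\<in>insert b0 X. P a b * (z(b0 := c)) b)"
      using z by (simp add: algebra_simps)
    then show ?thesis by blast
  qed
qed

text \<open>The entry of the boundary matrix at the faces \<open>T\<close> and \<open>A\<close>.\<close>

definition incidence :: "'v::linorder set \<Rightarrow> 'v set \<Rightarrow> 'k::comm_ring_1" where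
  "incidence T A = coboundary (\<lambda>B. if B = A then 1 else 0) T"

lemma incidence_zero: "\<not> (\<exists>v\<in>T. A = T - {v}) \<Longrightarrow> incidence T A = 0"
  by (auto simp: incidence_def coboundary_def intro!: sum.neutral)

lemma coboundary_incidence:
  assumes "finite X" "\<And>v. v \<in> T \<Longrightarrow> T - {v} \<in> X"
  shows "coboundary c T = (\<Sum>A\<in>X. incidence T A * c A)"
proof -
  have "(\<Sum>A\<in>X. incidence T A * c A)
      = (\<Sum>v\<in>T. \<Sum>A\<in>X. pos_sign T v * (if T - {v} = A then 1 else 0) * c A)"
    unfolding incidence_def coboundary_def sum_distrib_right by (rule sum.swap)
  also have "\<dots> = (\<Sum>v\<in>T. pos_sign T v * c (T - {v}))"
  proof (rule sum.cong[OF refl])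
    fix v assume "v \<in> T"
    have "(\<Sum>A\<in>X. pos_sign T v * (if T - {v} = A then 1 else 0) * c A)
        = (\<Sum>A\<in>X. if T - {v} = A then pos_sign T v * c A else 0)" by (rule sum.cong) auto
    then show "(\<Sum>A\<in>X. pos_sign T v * (if T - {v} = A then 1 else 0) * c A) = pos_sign T v * c (T - {v})"
      using assms \<open>v \<in> T\<close> by simp
  qed
  finally show ?thesis by (simp add: coboundary_def)
qed

lemma lookup_boundary:
  fixes c :: "'v::linorder set \<Rightarrow>\<^sub>0 'k::field"
  assumes "finite X" "keys c \<subseteq> X"
  shows "lookup (boundary c) A = (\<Sum>T\<in>X. incidence T A * lookup c T)"
proof -
  have "lookup (boundary c) A
      = (\<Sum>T\<in>keys c. incidence T A * lookup c T)"
    by (simp add: boundary_def lookup_sum incidence_def coboundary_def sum_distrib_right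
        lookup_single when_def pos_sign_def if_distrib if_distribR cong: if_cong sum.cong)
  also have "\<dots> = (\<Sum>T\<in>X. incidence T A * lookup c T)"
    using assms by (intro sum.mono_neutral_left) (auto simp: in_keys_iff)
  finally show ?thesis .
qed

lemma boundary_add:
  fixes c d :: "'v::linorder set \<Rightarrow>\<^sub>0 'k::field"
  shows "boundary (c + d) = boundary c + boundary d"
proof (rule poly_mapping_eqI)
  fix A
  let ?X = "keys c \<union> keys d"
  have "finite ?X" "keys (c + d) \<subseteq> ?X" using keys_add[of c d] by auto
  then show "lookup (boundary (c + d)) A = lookup (boundary c + boundary d) A"
    by (simp add: lookup_boundary[of ?X] lookup_add distrib_left sum.distrib)
qed

lemma boundary_zero: "boundary 0 = 0"
  by (simp add: boundary_def)

lemma boundary_uminus: "boundary (- c) = - boundary c"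
  using boundary_add[of c "- c"] by (simp add: boundary_zero eq_neg_iff_add_eq_0 add.commute)

lemma boundary_boundary:
  fixes c :: "'v::linorder set \<Rightarrow>\<^sub>0 'k::field"
  assumes fin: "\<And>T. T \<in> keys c \<Longrightarrow> finite T"
  shows "boundary (boundary c) = 0"
proof (rule poly_mapping_eqI)
  fix A
  define X where "X = (\<Union>T\<in>keys c. (\<lambda>v. T - {v}) ` T)"
  have X: "finite X" unfolding X_def using fin by auto
  have lb: "lookup (boundary c) B = (\<Sum>T\<in>keys c. incidence T B * lookup c T)" for B
    by (rule lookup_boundary) auto
  have "lookup (boundary c) B = 0" if "B \<notin> X" for B
    unfolding lb
  proof (intro sum.neutral ballI)
    fix T assume "T \<in> keys c"
    then have "\<not> (\<exists>v\<in>T. B = T - {v})" using that by (auto simp: X_def)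
    then show "incidence T B * lookup c T = 0" by (simp add: incidence_zero)
  qed
  then have kX: "keys (boundary c) \<subseteq> X" by (auto simp: in_keys_iff)
  have "lookup (boundary (boundary c)) A
     = (\<Sum>B\<in>X. \<Sum>T\<in>keys c. incidence B A * (incidence T B * lookup c T))"
    by (simp add: lookup_boundary[OF X kX] lb sum_distrib_left)
  also have "\<dots> = (\<Sum>T\<in>keys c. (\<Sum>B\<in>X. incidence T B * incidence B A) * lookup c T)"
    by (subst sum.swap) (simp add: sum_distrib_left sum_distrib_right mult_ac)
  also have "\<dots> = 0"
  proof (intro sum.neutral ballI)
    fix T assume T: "T \<in> keys c"
    have "(\<Sum>B\<in>X. incidence T B * incidence B A :: 'k) = coboundary (\<lambda>B. incidence B A) T"
      by (rule coboundary_incidence[OF X, symmetric]) (use T in \<open>auto simp: X_def\<close>)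
    also have "\<dots> = coboundary (coboundary (\<lambda>B. if B = A then 1 else 0)) T"
      by (simp add: incidence_def)
    also have "\<dots> = 0" by (rule coboundary_coboundary[OF fin[OF T]])
    finally show "(\<Sum>B\<in>X. incidence T B * incidence B A) * lookup c T = 0" by simp
  qed
  finally show "lookup (boundary (boundary c)) A = lookup 0 A" by simp
qed

lemma chains_closed:
  "0 \<in> chains i \<Gamma>" "c \<in> chains i \<Gamma> \<Longrightarrow> d \<in> chains i \<Gamma> \<Longrightarrow> c + d \<in> chains i \<Gamma>"
  "c \<in> chains i \<Gamma> \<Longrightarrow> - c \<in> chains i \<Gamma>"
  using keys_add[of c d] by (auto simp: chains_def)

lemma boundary_chains:
  fixes c :: "'v::linorder set \<Rightarrow>\<^sub>0 'k::field"
  assumes sub: "\<And>T v. T \<in> \<Gamma> \<Longrightarrow> T - {v} \<in> \<Gamma>" and c: "c \<in> chains (i + 1) \<Gamma>"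
  shows "boundary c \<in> chains i \<Gamma>"
proof -
  have "A \<in> \<Gamma> \<and> finite A \<and> int (card A) = i + 1" if A: "A \<in> keys (boundary c)" for A
  proof -
    have "(\<Sum>T\<in>keys c. incidence T A * lookup c T) \<noteq> 0"
      using A lookup_boundary[of "keys c" c A] by (simp add: in_keys_iff)
    then obtain T where T: "T \<in> keys c" "incidence T A \<noteq> (0 :: 'k)"
      by (metis (no_types, lifting) mult_zero_left sum.neutral)
    then obtain v where v: "v \<in> T" "A = T - {v}" using incidence_zero by blast
    have "T \<in> \<Gamma>" "finite T" "int (card T) = i + 2" using c T(1) by (auto simp: chains_def)
    moreover from this v(1) have "int (card (T - {v})) = i + 1"
      using card_Suc_Diff1[of T v] by simp
    ultimately show ?thesis using sub v by simp
  qed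
  then show ?thesis by (auto simp: chains_def)
qed

text \<open>The quotient is a group by \<open>boundary_boundary\<close>, which makes boundaries a subgroup of the cycles.\<close>

lemma reduced_homology_trivial:
  fixes \<Gamma> :: "'v::linorder set set"
  assumes sub: "\<And>T v. T \<in> \<Gamma> \<Longrightarrow> T - {v} \<in> \<Gamma>"
  shows "trivial_group (reduced_homology TYPE('k::field) i \<Gamma>) \<longleftrightarrow>
    {c \<in> chains i \<Gamma>. boundary c = 0} \<subseteq> boundary ` (chains (i + 1) \<Gamma> :: ('v set \<Rightarrow>\<^sub>0 'k) set)"
proof -
  let ?G = "\<lparr>carrier = {c \<in> chains i \<Gamma>. boundary c = 0}, mult = (+), one = 0\<rparr> :: ('v set \<Rightarrow>\<^sub>0 'k) monoid"
  have G: "comm_group ?G"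
  proof (rule comm_groupI)
    fix c assume "c \<in> carrier ?G"
    then show "\<exists>d\<in>carrier ?G. d \<otimes>\<^bsub>?G\<^esub> c = \<one>\<^bsub>?G\<^esub>"
      by (intro bexI[of _ "- c"]) (auto simp: chains_closed boundary_uminus)
  qed (auto simp: chains_closed boundary_add boundary_zero add.assoc add.commute)
  interpret G: comm_group ?G by (rule G)
  have "subgroup (boundary ` chains (i + 1) \<Gamma>) ?G"
  proof (rule G.subgroupI)
    show "boundary ` chains (i + 1) \<Gamma> \<subseteq> carrier ?G"
    proof
      fix b :: "'v set \<Rightarrow>\<^sub>0 'k" assume "b \<in> boundary ` chains (i + 1) \<Gamma>"
      then obtain c :: "'v set \<Rightarrow>\<^sub>0 'k" where c: "c \<in> chains (i + 1) \<Gamma>" "b = boundary c" by blast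
      moreover have "boundary (boundary c) = 0" by (rule boundary_boundary) (use c(1) in \<open>auto simp: chains_def\<close>)
      ultimately show "b \<in> carrier ?G" using boundary_chains[OF sub] by simp
    qed
    show "boundary ` chains (i + 1) \<Gamma> \<noteq> {}" using chains_closed(1) by blast
  next
    fix a :: "'v set \<Rightarrow>\<^sub>0 'k" assume a: "a \<in> boundary ` chains (i + 1) \<Gamma>"
    then obtain c :: "'v set \<Rightarrow>\<^sub>0 'k" where c: "c \<in> chains (i + 1) \<Gamma>" "a = boundary c" by blast
    have "boundary (boundary c) = 0" by (rule boundary_boundary) (use c(1) in \<open>auto simp: chains_def\<close>)
    then have aG: "a \<in> carrier ?G" "- a \<in> carrier ?G"
      using boundary_chains[OF sub c(1)] c chains_closed(3)[of a] by (auto simp: boundary_uminus)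
    have "inv\<^bsub>?G\<^esub> a = - a" by (rule G.inv_equality) (use aG in auto)
    then show "inv\<^bsub>?G\<^esub> a \<in> boundary ` chains (i + 1) \<Gamma>"
      using c chains_closed(3)[OF c(1)] by (auto simp: boundary_uminus[symmetric])
  next
    fix a b :: "'v set \<Rightarrow>\<^sub>0 'k" assume "a \<in> boundary ` chains (i + 1) \<Gamma>" "b \<in> boundary ` chains (i + 1) \<Gamma>"
    then obtain c d :: "'v set \<Rightarrow>\<^sub>0 'k" where "c \<in> chains (i + 1) \<Gamma>" "d \<in> chains (i + 1) \<Gamma>"
      "a = boundary c" "b = boundary d" by blast
    then show "a \<otimes>\<^bsub>?G\<^esub> b \<in> boundary ` chains (i + 1) \<Gamma>"
      using chains_closed(2)[of c "i + 1" \<Gamma> d] by (simp add: boundary_add[symmetric])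
  qed
  then show ?thesis unfolding reduced_homology_def using trivial_quotient_group_iff[OF G] by simp
qed

lemma reduced_homology_below:
  fixes \<Gamma> :: "'v::linorder set set"
  assumes "\<And>T v. T \<in> \<Gamma> \<Longrightarrow> T - {v} \<in> \<Gamma>" "i < -1"
  shows "trivial_group (reduced_homology TYPE('k::field) i \<Gamma>)"
proof -
  have "c = 0" if "c \<in> chains i \<Gamma>" for c :: "'v set \<Rightarrow>\<^sub>0 'k"
  proof -
    have "keys c = {}" using that assms(2) by (force simp: chains_def)
    then show ?thesis by simp
  qed
  then have "{c \<in> chains i \<Gamma>. boundary c = 0} \<subseteq> boundary ` (chains (i + 1) \<Gamma> :: ('v set \<Rightarrow>\<^sub>0 'k) set)"
    using chains_closed(1) boundary_zero by force
  then show ?thesis using reduced_homology_trivial[OF assms(1), where 'k = 'k] by blast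
qed

text \<open>Boundary and coboundary are given by transposed matrices. If one of the two complexes is exact
  and a cocycle (or cycle) \<open>x\<close> of the other is given, then the functionals vanishing on
  the coboundaries (or boundaries) come from the exact complex and therefore vanish on \<open>x\<close>, so that
  \<open>fredholm_alternative\<close> applies.\<close>

lemma reduced_homology_trivial_iff_coexact:
  fixes \<Gamma> :: "'v::linorder set set"
  assumes fin: "finite \<Gamma>" "\<And>T. T \<in> \<Gamma> \<Longrightarrow> finite T" and sub: "\<And>T v. T \<in> \<Gamma> \<Longrightarrow> T - {v} \<in> \<Gamma>"
  shows "trivial_group (reduced_homology TYPE('k::field) (int p - 1) \<Gamma>) \<longleftrightarrow> coexact TYPE('k) \<Gamma> p"
proof -
  define Y where "Y = {T \<in> \<Gamma>. card T = p}"
  define Z where "Z = {T \<in> \<Gamma>. card T = Suc p}"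
  define X where "X = (\<Union>T\<in>Y. (\<lambda>v. T - {v}) ` T)"
  have finite: "finite X" "finite Y" "finite Z" using fin by (auto simp: X_def Y_def Z_def)
  have chY: "chains (int p - 1) \<Gamma> = {c :: 'v set \<Rightarrow>\<^sub>0 'k. keys c \<subseteq> Y}"
    and chZ: "chains (int p - 1 + 1) \<Gamma> = {c :: 'v set \<Rightarrow>\<^sub>0 'k. keys c \<subseteq> Z}"
    using fin(2) by (auto simp: chains_def Y_def Z_def)
  have cY: "coboundary c T = (\<Sum>A\<in>Y. incidence T A * c A)" if "T \<in> Z" for T and c :: "'v set \<Rightarrow> 'k"
    by (rule coboundary_incidence[OF finite(2)]) (use that sub fin in \<open>auto simp: Y_def Z_def card_Diff_singleton\<close>)
  have cX: "coboundary c T = (\<Sum>A\<in>X. incidence T A * c A)" if "T \<in> Y" for T and c :: "'v set \<Rightarrow> 'k"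
    by (rule coboundary_incidence[OF finite(1)]) (use that in \<open>auto simp: X_def\<close>)
  define hom_exact where "hom_exact \<longleftrightarrow> (\<forall>x :: 'v set \<Rightarrow> 'k.
     (\<forall>B. (\<Sum>A\<in>Y. incidence A B * x A) = 0) \<longrightarrow> (\<exists>y. \<forall>A\<in>Y. x A = (\<Sum>T\<in>Z. incidence T A * y T)))"
  define to_chain where "to_chain S x = (\<Sum>T\<in>S. single T (x T))"
    for S and x :: "'v set \<Rightarrow> 'k"
  have lk: "lookup (to_chain S x) A = (if A \<in> S then x A else 0)" if "finite S" for S x A
    using that by (simp add: to_chain_def lookup_sum lookup_single when_def)
  have kS: "keys (to_chain S x) \<subseteq> S" if "finite S" for S x
    using lk[OF that] by (auto simp: in_keys_iff split: if_splits)
  have "trivial_group (reduced_homology TYPE('k) (int p - 1) \<Gamma>) \<longleftrightarrow>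
      {c \<in> {c. keys c \<subseteq> Y}. boundary c = 0}
      \<subseteq> boundary ` {c :: 'v set \<Rightarrow>\<^sub>0 'k. keys c \<subseteq> Z}"
    unfolding chY[symmetric] chZ[symmetric] by (rule reduced_homology_trivial[OF sub])
  also have "\<dots> \<longleftrightarrow> hom_exact"
  proof
    assume H: "{c \<in> {c. keys c \<subseteq> Y}. boundary c = 0}
      \<subseteq> boundary ` {c :: 'v set \<Rightarrow>\<^sub>0 'k. keys c \<subseteq> Z}"
    show hom_exact unfolding hom_exact_def
    proof (intro allI impI)
      fix x :: "'v set \<Rightarrow> 'k" assume x: "\<forall>B. (\<Sum>A\<in>Y. incidence A B * x A) = 0"
      have "boundary (to_chain Y x) = 0"
        by (rule poly_mapping_eqI)
           (use x in \<open>simp add: lookup_boundary[OF finite(2) kS[OF finite(2)]] lk[OF finite(2)]\<close>)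
      then have "to_chain Y x \<in> boundary ` {c :: 'v set \<Rightarrow>\<^sub>0 'k. keys c \<subseteq> Z}"
        by (intro subsetD[OF H]) (use kS[OF finite(2)] in blast)
      then obtain d where d: "keys d \<subseteq> Z" "to_chain Y x = boundary d" by blast
      have "x A = (\<Sum>T\<in>Z. incidence T A * lookup d T)" if "A \<in> Y" for A
        using lk[OF finite(2), of x A] that lookup_boundary[OF finite(3) d(1), of A] d(2) by simp
      then show "\<exists>y. \<forall>A\<in>Y. x A = (\<Sum>T\<in>Z. incidence T A * y T)" by blast
    qed
  next
    assume H: hom_exact
    show "{c \<in> {c. keys c \<subseteq> Y}. boundary c = 0}
      \<subseteq> boundary ` {c :: 'v set \<Rightarrow>\<^sub>0 'k. keys c \<subseteq> Z}"
    proof clarify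
      fix c :: "'v set \<Rightarrow>\<^sub>0 'k" assume c: "keys c \<subseteq> Y" "boundary c = 0"
      have "\<forall>B. (\<Sum>A\<in>Y. incidence A B * lookup c A) = 0"
        using lookup_boundary[OF finite(2) c(1)] c(2) by simp
      then obtain y where y: "\<forall>A\<in>Y. lookup c A = (\<Sum>T\<in>Z. incidence T A * y T)"
        using H unfolding hom_exact_def by blast
      have "c = boundary (to_chain Z y)"
      proof (rule poly_mapping_eqI)
        fix A
        have b: "lookup (boundary (to_chain Z y)) A = (\<Sum>T\<in>Z. incidence T A * y T)"
          by (simp add: lookup_boundary[OF finite(3) kS[OF finite(3)]] lk[OF finite(3)])
        show "lookup c A = lookup (boundary (to_chain Z y)) A"
        proof (cases "A \<in> Y")
          case True
          then show ?thesis using b y by simp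
        next
          case False
          have "boundary (to_chain Z y) \<in> chains (int p - 1) \<Gamma>"
            by (rule boundary_chains[OF sub]) (use chZ kS[OF finite(3)] in auto)
          then have "lookup (boundary (to_chain Z y)) A = 0" using False chY by (auto simp: in_keys_iff)
          then show ?thesis using False c(1) by (auto simp: in_keys_iff)
        qed
      qed
      then show "c \<in> boundary ` {c. keys c \<subseteq> Z}" using kS[OF finite(3)] by blast
    qed
  qed
  also have "\<dots> \<longleftrightarrow> coexact TYPE('k) \<Gamma> p"
  proof
    assume H: hom_exact
    show "coexact TYPE('k) \<Gamma> p" unfolding coexact_def
    proof (intro allI impI)
      fix c :: "'v set \<Rightarrow> 'k" assume "\<forall>T\<in>\<Gamma>. card T = Suc p \<longrightarrow> coboundary c T = 0"
      then have coc: "(\<Sum>A\<in>Y. incidence T A * c A) = 0" if "T \<in> Z" for T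
        using cY[OF that, of c] that by (simp add: Z_def)
      have "\<exists>u. \<forall>A\<in>Y. c A = (\<Sum>B\<in>X. incidence A B * u B)"
      proof (rule fredholm_alternative[OF finite(1,2)])
        fix f :: "'v set \<Rightarrow> 'k" assume f: "\<forall>B\<in>X. (\<Sum>A\<in>Y. f A * incidence A B) = 0"
        have "(\<Sum>A\<in>Y. incidence A B * f A) = 0" for B
        proof (cases "B \<in> X")
          case True
          then show ?thesis using f by (simp add: mult.commute)
        next
          case False
          then have "incidence A B = (0 :: 'k)" if "A \<in> Y" for A
            using that by (intro incidence_zero) (auto simp: X_def)
          then show ?thesis by simp
        qed
        then obtain y where y: "\<forall>A\<in>Y. f A = (\<Sum>T\<in>Z. incidence T A * y T)"
          using H unfolding hom_exact_def by blast
        have "(\<Sum>A\<in>Y. f A * c A) = (\<Sum>A\<in>Y. \<Sum>T\<in>Z. y T * (incidence T A * c A))"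
          using y by (intro sum.cong) (auto simp: sum_distrib_right sum_distrib_left mult_ac)
        also have "\<dots> = (\<Sum>T\<in>Z. y T * (\<Sum>A\<in>Y. incidence T A * c A))"
          by (subst sum.swap) (simp add: sum_distrib_left)
        finally show "(\<Sum>A\<in>Y. f A * c A) = 0" using coc by simp
      qed
      then show "\<exists>u. \<forall>T\<in>\<Gamma>. card T = p \<longrightarrow> c T = coboundary u T" using cX by (auto simp: Y_def)
    qed
  next
    assume C: "coexact TYPE('k) \<Gamma> p"
    show hom_exact unfolding hom_exact_def
    proof (intro allI impI)
      fix x :: "'v set \<Rightarrow> 'k" assume x: "\<forall>B. (\<Sum>A\<in>Y. incidence A B * x A) = 0"
      show "\<exists>y. \<forall>A\<in>Y. x A = (\<Sum>T\<in>Z. incidence T A * y T)"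
      proof (rule fredholm_alternative[OF finite(3,2)])
        fix f :: "'v set \<Rightarrow> 'k" assume f: "\<forall>T\<in>Z. (\<Sum>A\<in>Y. f A * incidence T A) = 0"
        have coc: "coboundary f T = 0" if "T \<in> \<Gamma>" "card T = Suc p" for T
          using f cY[of T f] that by (simp add: Z_def mult.commute)
        obtain u where "\<And>T. T \<in> \<Gamma> \<Longrightarrow> card T = p \<Longrightarrow> f T = coboundary u T"
          by (rule coexactD[OF C coc]) (assumption | rule that)+
        then have u: "f A = (\<Sum>B\<in>X. incidence A B * u B)" if "A \<in> Y" for A
          using that cX[OF that, of u] by (simp add: Y_def)
        have "(\<Sum>A\<in>Y. f A * x A) = (\<Sum>A\<in>Y. \<Sum>B\<in>X. u B * (incidence A B * x A))"
          using u by (intro sum.cong) (auto simp: sum_distrib_right sum_distrib_left mult_ac)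
        also have "\<dots> = (\<Sum>B\<in>X. u B * (\<Sum>A\<in>Y. incidence A B * x A))"
          by (subst sum.swap) (simp add: sum_distrib_left)
        finally show "(\<Sum>A\<in>Y. f A * x A) = 0" using x by simp
      qed
    qed
  qed
  finally show ?thesis .
qed

section \<open>Stanley--Reisner rings\<close>

text \<open>The exponent vector of \<open>(\<Prod>v\<in>F. var v) ^ k\<close>.\<close>

definition const_exp :: "'v set \<Rightarrow> nat \<Rightarrow> 'v \<Rightarrow>\<^sub>0 nat" where
  "const_exp F k = (\<Sum>v\<in>F. single v k)"

lemma lookup_const_exp: "finite F \<Longrightarrow> lookup (const_exp F k) v = (if v \<in> F then k else 0)"
  by (simp add: const_exp_def lookup_sum lookup_single when_def)

lemma prod_var_power:
  "finite F \<Longrightarrow> (\<Prod>v\<in>F. var v ^ k) = (single (const_exp F k) 1 :: ('v, 'k::field) mpoly)"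
  by (induction rule: finite_induct) (simp_all add: const_exp_def var_power mult_single)

lemma keys_add_nat: "keys (s + t :: 'v \<Rightarrow>\<^sub>0 nat) = keys s \<union> keys t"
  by (auto simp: in_keys_iff lookup_add)

lemma keys_const_exp: "finite F \<Longrightarrow> k > 0 \<Longrightarrow> keys (const_exp F k) = F"
  by (auto simp: in_keys_iff lookup_const_exp split: if_splits)

lemma poly_ring_diff:
  fixes p q :: "('v, 'k::field) mpoly"
  assumes "q \<in> carrier (poly_ring X)"
  shows "p \<ominus>\<^bsub>poly_ring X\<^esub> q = p - q"
proof -
  interpret cring "poly_ring X :: ('v, 'k) mpoly ring" by (rule cring_poly_ring)
  have "\<ominus>\<^bsub>poly_ring X\<^esub> q = - q"
    using assms by (intro minus_equality) (auto simp: poly_carrier)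
  then show ?thesis by (simp add: a_minus_def)
qed

text \<open>A monomial is divisible by the squarefree monomial of its support, so those with non-faces as
  support span the ideal generated by the squarefree monomials of non-faces.\<close>

theorem stanley_reisner_ideal_eq:
  fixes X :: "'v set"
  assumes X: "finite X" and \<Delta>: "simplicial_complex X \<Delta>"
  shows "(stanley_reisner_ideal X \<Delta> :: ('v, 'k::field) mpoly set)
    = monom_ideal X (\<lambda>t. keys t \<notin> \<Delta>)"
proof -
  let ?S = "poly_ring X :: ('v, 'k) mpoly ring"
  let ?G = "(\<lambda>F. \<Prod>v\<in>F. var v) ` {F. F \<subseteq> X \<and> F \<notin> \<Delta>} :: ('v, 'k) mpoly set"
  let ?I = "monom_ideal X (\<lambda>t. keys t \<notin> \<Delta>) :: ('v, 'k) mpoly set"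
  interpret S: cring ?S by (rule cring_poly_ring)
  have pv: "(\<Prod>v\<in>F. var v) = (single (const_exp F 1) 1 :: ('v, 'k) mpoly)" if "finite F" for F
    using prod_var_power[OF that, of 1] by simp
  have I: "ideal ?I ?S"
    by (rule ideal_monom_ideal) (use \<Delta> in \<open>auto simp: keys_add_nat simplicial_complex_def\<close>)
  have GI: "?G \<subseteq> ?I"
  proof clarify
    fix F assume F: "F \<subseteq> X" "F \<notin> \<Delta>"
    then have "finite F" using X finite_subset by blast
    then show "(\<Prod>v\<in>F. var v) \<in> ?I" using F by (simp add: pv monom_ideal_def poly_carrier keys_const_exp)
  qed
  have GS: "?G \<subseteq> carrier ?S" using GI by (auto simp: monom_ideal_def)
  have idl: "ideal (Idl\<^bsub>?S\<^esub> ?G) ?S" by (rule S.genideal_ideal[OF GS])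
  have mono: "single t c \<in> Idl\<^bsub>?S\<^esub> ?G" if t: "keys t \<subseteq> X" "keys t \<notin> \<Delta>" for t and c :: 'k
  proof -
    let ?F = "keys t"
    let ?s = "t - const_exp ?F 1"
    have ts: "t = ?s + const_exp ?F 1"
      by (rule poly_mapping_eqI) (auto simp: lookup_add lookup_minus lookup_const_exp in_keys_iff)
    have "single ?s c \<in> carrier ?S"
      using t(1) by (auto simp: poly_carrier in_keys_iff lookup_minus subset_iff)
    moreover have "(\<Prod>v\<in>?F. var v) \<in> Idl\<^bsub>?S\<^esub> ?G" using S.genideal_self[OF GS] t by blast
    ultimately have "(\<Prod>v\<in>?F. var v) \<otimes>\<^bsub>?S\<^esub> single ?s c \<in> Idl\<^bsub>?S\<^esub> ?G"
      by (rule ideal.I_r_closed[OF idl, rotated])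
    also have "(\<Prod>v\<in>?F. var v) \<otimes>\<^bsub>?S\<^esub> single ?s c = single (?s + const_exp ?F 1) c"
      by (simp add: pv mult_single add.commute)
    finally show ?thesis using ts by simp
  qed
  have "?I \<subseteq> Idl\<^bsub>?S\<^esub> ?G"
  proof
    fix p assume p: "p \<in> ?I"
    have "(\<Sum>t\<in>F. single t (lookup p t)) \<in> Idl\<^bsub>?S\<^esub> ?G"
      if "finite F" "F \<subseteq> keys p" for F
      using that
    proof (induction F)
      case empty
      then show ?case using additive_subgroup.zero_closed[OF ideal.axioms(1)[OF idl]] by simp
    next
      case (insert t F)
      then have "single t (lookup p t) \<in> Idl\<^bsub>?S\<^esub> ?G"
        using p by (intro mono) (auto simp: monom_ideal_def poly_carrier)
      then show ?case using insert additive_subgroup.a_closed[OF ideal.axioms(1)[OF idl]] by simp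
    qed
    from this[of "keys p"] show "p \<in> Idl\<^bsub>?S\<^esub> ?G" using poly_sum_monomials[of p] by simp
  qed
  then show ?thesis unfolding stanley_reisner_ideal_def using S.genideal_minimal[OF I GI] by blast
qed

text \<open>Cochains with values in \<open>R / I\<close> are replaced by representatives in \<open>R\<close>, and equations by
  congruences modulo \<open>I\<close>.\<close>

lemma cech_vanishes_quotient_iff:
  fixes R :: "('a, 'r) ring_scheme" and y :: "'v \<Rightarrow> 'a"
  assumes R: "cring R" and I: "ideal I R" and y: "\<And>v. y v \<in> carrier R"
  shows "cech_vanishes R (quotient_module R I) y ws i \<longleftrightarrow>
    (\<forall>(k::nat) z. (\<forall>r. z r \<in> carrier R) \<longrightarrow>
       (\<forall>r. subseq r ws \<longrightarrow> length r = Suc i \<longrightarrow> koszul_pow R (regular_module R) y k z r \<in> I) \<longrightarrow>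
       (\<exists>(l::nat) u. (\<forall>r. u r \<in> carrier R) \<and> (\<forall>r. subseq r ws \<longrightarrow> length r = i \<longrightarrow>
          pow_mult R y l r \<otimes>\<^bsub>R\<^esub> z r
            \<ominus>\<^bsub>R\<^esub> koszul_pow R (regular_module R) y (k + l) u r \<in> I)))"
    (is "?lhs \<longleftrightarrow> (\<forall>k z. ?car z \<longrightarrow> ?coc k z \<longrightarrow> ?cob k z)")
proof -
  let ?M = "quotient_module R I" and ?B = "regular_module R"
  interpret R: cring R by (rule R)
  interpret I: ideal I R by (rule I)
  interpret M: module R ?M by (rule module_quotient_module[OF R I])
  interpret B: module R ?B by (rule module_regular[OF R])
  define q where "q p = I +>\<^bsub>R\<^esub> p" for p
  have Bs: "carrier ?B = carrier R" "\<zero>\<^bsub>?B\<^esub> = \<zero>\<^bsub>R\<^esub>" "add ?B = add R" "smult ?B = mult R"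
    by (simp_all add: regular_module_def)
  have q_hom: "q \<in> ring_hom R (R Quot I)" unfolding q_def by (rule I.rcos_ring_hom)
  have q: "q \<in> module_hom R ?B ?M"
    using q_hom by (intro module_homI)
      (auto simp: Bs quotient_module_def ring_hom_def q_def[symmetric] Pi_iff)
  have Mc: "carrier ?M = q ` carrier R"
    by (auto simp: quotient_module_def FactRing_def A_RCOSETS_def' q_def)
  have Mz: "\<zero>\<^bsub>?M\<^esub> = I" by (simp add: quotient_module_def FactRing_def)
  have q0: "q p = \<zero>\<^bsub>?M\<^esub> \<longleftrightarrow> p \<in> I" if "p \<in> carrier R" for p
    unfolding Mz q_def using that I.a_rcos_const I.a_rcos_self by blast
  have yk: "y v [^]\<^bsub>R\<^esub> (k::nat) \<in> carrier R" for v k using y by simp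
  have kq: "koszul_pow R ?M y k (\<lambda>r. q (z r)) r = q (koszul_pow R ?B y k z r)"
    if "\<And>r. z r \<in> carrier R" for k z r
    by (rule koszul_hom[OF B.module_axioms M.module_axioms q yk]) (use that Bs in simp)
  have kc: "koszul_pow R ?B y k z r \<in> carrier R" if "\<And>r. z r \<in> carrier R" for k z r
    using B.koszul_closed[of "\<lambda>v. y v [^]\<^bsub>R\<^esub> k" z r] yk that by (simp add: Bs)
  have pc: "pow_mult R y l r \<in> carrier R" for l r
    by (rule B.list_mult_closed[OF yk])
  have lift: "\<exists>z'. (\<forall>r. z' r \<in> carrier R) \<and> z = (\<lambda>r. q (z' r))" if "\<And>r. z r \<in> carrier ?M" for z :: "'v list \<Rightarrow> 'a set"
  proof -
    have "\<forall>r. \<exists>p. p \<in> carrier R \<and> z r = q p" using that Mc by blast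
    then show ?thesis by (metis ext)
  qed
  have eq: "pow_mult R y l r \<odot>\<^bsub>?M\<^esub> q (z r) = koszul_pow R ?M y (k + l) (\<lambda>r. q (u r)) r
      \<longleftrightarrow> pow_mult R y l r \<otimes>\<^bsub>R\<^esub> z r \<ominus>\<^bsub>R\<^esub> koszul_pow R ?B y (k + l) u r \<in> I"
    if z: "\<And>r. z r \<in> carrier R" and u: "\<And>r. u r \<in> carrier R" for k l z u r
  proof -
    let ?P = "pow_mult R y l r" and ?K = "koszul_pow R ?B y (k + l) u r"
    have Pz: "?P \<otimes>\<^bsub>R\<^esub> z r \<in> carrier R" using pc z by simp
    have "?P \<odot>\<^bsub>?M\<^esub> q (z r) = q (?P \<otimes>\<^bsub>R\<^esub> z r)"
      using module_homD(3)[OF q pc, of "z r" l r] z by (simp add: Bs)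
    moreover have "(q (?P \<otimes>\<^bsub>R\<^esub> z r) = q ?K) \<longleftrightarrow> q (?P \<otimes>\<^bsub>R\<^esub> z r) \<ominus>\<^bsub>?M\<^esub> q ?K = \<zero>\<^bsub>?M\<^esub>"
      using module_homD(1)[OF q] Pz kc[OF u] by (subst M.M.diff_eq_zero_iff) (auto simp: Bs)
    moreover have "q (?P \<otimes>\<^bsub>R\<^esub> z r) \<ominus>\<^bsub>?M\<^esub> q ?K = q (?P \<otimes>\<^bsub>R\<^esub> z r \<ominus>\<^bsub>?B\<^esub> ?K)"
      by (rule module_hom_minus[OF B.module_axioms M.module_axioms q, symmetric]) (use Pz kc[OF u] Bs in auto)
    moreover have "?P \<otimes>\<^bsub>R\<^esub> z r \<ominus>\<^bsub>?B\<^esub> ?K = ?P \<otimes>\<^bsub>R\<^esub> z r \<ominus>\<^bsub>R\<^esub> ?K"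
      by (simp add: a_minus_def a_inv_def regular_module_def m_inv_def)
    ultimately show ?thesis using q0[of "?P \<otimes>\<^bsub>R\<^esub> z r \<ominus>\<^bsub>R\<^esub> ?K"] Pz kc[OF u] by (simp add: kq[OF u])
  qed
  show ?thesis
  proof
    assume V: ?lhs
    show "\<forall>k z. ?car z \<longrightarrow> ?coc k z \<longrightarrow> ?cob k z"
    proof (intro allI impI)
      fix k :: nat and z :: "'v list \<Rightarrow> 'a" assume z: "?car z" and coc: "?coc k z"
      have qz: "q (z r) \<in> carrier ?M" for r using z Mc by blast
      have coc': "koszul_pow R ?M y k (\<lambda>r. q (z r)) r = \<zero>\<^bsub>?M\<^esub>" if "subseq r ws" "length r = Suc i" for r
        using kq[of z] q0 kc[of z] z coc that by simp
      obtain l u where u: "\<And>r. u r \<in> carrier ?M" and zu: "\<And>r. subseq r ws \<Longrightarrow> length r = i \<Longrightarrow>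
         pow_mult R y l r \<odot>\<^bsub>?M\<^esub> q (z r) = koszul_pow R ?M y (k + l) u r"
        by (rule cech_vanishesD[OF V qz coc']) (assumption | rule that)+
      obtain u' where u': "\<forall>r. u' r \<in> carrier R" "u = (\<lambda>r. q (u' r))" using lift[of u, OF u] by (elim exE conjE)
      show "?cob k z"
        using zu u' eq[of z u' l _ k] z by (intro exI[of _ l] exI[of _ u']) auto
    qed
  next
    assume H: "\<forall>k z. ?car z \<longrightarrow> ?coc k z \<longrightarrow> ?cob k z"
    show ?lhs
    proof (rule cech_vanishesI)
      fix k z assume z: "\<And>r. z r \<in> carrier ?M"
        and coc: "\<And>r. subseq r ws \<Longrightarrow> length r = Suc i \<Longrightarrow> koszul_pow R ?M y k z r = \<zero>\<^bsub>?M\<^esub>"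
      obtain z' where z': "\<forall>r. z' r \<in> carrier R" "z = (\<lambda>r. q (z' r))" using lift[of z, OF z] by (elim exE conjE)
      have "?coc k z'" using coc kq[of z'] q0 kc[of z'] z' by auto
      then have "?cob k z'" using H z'(1) by blast
      then obtain l u where u: "\<forall>r. u r \<in> carrier R" and zu: "\<forall>r. subseq r ws \<longrightarrow> length r = i \<longrightarrow>
          pow_mult R y l r \<otimes>\<^bsub>R\<^esub> z' r \<ominus>\<^bsub>R\<^esub> koszul_pow R ?B y (k + l) u r \<in> I" by blast
      show "eventually_coboundary R ?M y ws i k z"
        using u zu z' eq[of z' u l _ k] Mc by (intro exI[of _ l] exI[of _ "\<lambda>r. q (u r)"]) auto
    qed
  qed
qed

text \<open>The Koszul differential of \<open>koszul\<close> on subsets instead of increasing sequences, written as a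
  sum.\<close>

definition monom_coboundary ::
  "nat \<Rightarrow> ('v::linorder set \<Rightarrow> ('v, 'k::field) mpoly) \<Rightarrow> 'v set \<Rightarrow> ('v, 'k) mpoly" where
  "monom_coboundary k Z T = (\<Sum>v\<in>T. pos_sign T v * (var v ^ k * Z (T - {v})))"

lemma koszul_sorted:
  fixes Z :: "'v::linorder set \<Rightarrow> ('v, 'k::field) mpoly"
  assumes W: "W \<subseteq> X"
  shows "sorted_wrt (<) r \<Longrightarrow> set r \<subseteq> W \<Longrightarrow> (\<And>T. Z T \<in> carrier (poly_ring X)) \<Longrightarrow>
    koszul (regular_module (poly_ring X)) (\<lambda>v. vars_on W v ^ k) (\<lambda>s. Z (set s)) r = monom_coboundary k Z (set r)"
proof (induction r arbitrary: Z)
  case Nil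
  show ?case by (simp add: monom_coboundary_def regular_module_def)
next
  case (Cons a r)
  interpret S: cring "poly_ring X :: ('v, 'k) mpoly ring" by (rule cring_poly_ring)
  let ?B = "regular_module (poly_ring X :: ('v, 'k) mpoly ring)"
  interpret B: module "poly_ring X" ?B by (rule module_regular[OF cring_poly_ring])
  have a: "a \<notin> set r" "\<And>v. v \<in> set r \<Longrightarrow> a < v" "a \<in> W" using Cons.prems by auto
  have yk: "(vars_on W v ^ k :: ('v, 'k) mpoly) \<in> carrier (poly_ring X)" for v
    using S.nat_pow_closed[OF vars_on_closed[OF W], of v k] by simp
  have minus: "p \<ominus>\<^bsub>?B\<^esub> q = p - q" if "q \<in> carrier (poly_ring X)" for p q
  proof -
    have "p \<ominus>\<^bsub>?B\<^esub> q = p \<ominus>\<^bsub>poly_ring X\<^esub> q" by (simp add: a_minus_def a_inv_def regular_module_def m_inv_def)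
    then show ?thesis using poly_ring_diff[OF that] by simp
  qed
  have closed: "koszul ?B (\<lambda>v. vars_on W v ^ k) (\<lambda>s. Z (set (a # s))) r \<in> carrier (poly_ring X)"
    using B.koszul_closed[of "\<lambda>v. vars_on W v ^ k" "\<lambda>s. Z (set (a # s))" r] yk Cons.prems(3)
    by (simp add: regular_module_def)
  have IH: "koszul ?B (\<lambda>v. vars_on W v ^ k) (\<lambda>s. Z (set (a # s))) r
     = (\<Sum>v\<in>set r. pos_sign (set r) v * (var v ^ k * Z (insert a (set r - {v}))))"
    using Cons.IH[of "\<lambda>T. Z (insert a T)"] Cons.prems by (simp add: monom_coboundary_def)
  have sgn: "pos_sign (insert a (set r)) v = (- pos_sign (set r) v :: ('v, 'k) mpoly)" if "v \<in> set r" for v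
  proof -
    have "{u \<in> insert a (set r). u < v} = insert a {u \<in> set r. u < v}" using a that by auto
    then show ?thesis using a(1) by (simp add: pos_sign_def)
  qed
  have none: "{u \<in> insert a (set r). u < a} = {}" by (auto dest: a(2) less_asym)
  have sgn_a: "pos_sign (insert a (set r)) a = (1 :: ('v, 'k) mpoly)"
    unfolding pos_sign_def none by simp
  have "monom_coboundary k Z (set (a # r))
     = var a ^ k * Z (set r) + (\<Sum>v\<in>set r. pos_sign (insert a (set r)) v * (var v ^ k * Z (insert a (set r) - {v})))"
    using a(1) sgn_a by (simp add: monom_coboundary_def)
  also have "(\<Sum>v\<in>set r. pos_sign (insert a (set r)) v * (var v ^ k * Z (insert a (set r) - {v})))
     = - (\<Sum>v\<in>set r. pos_sign (set r) v * (var v ^ k * Z (insert a (set r - {v}))))"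
    unfolding sum_negf[symmetric]
  proof (intro sum.cong refl)
    fix v assume v: "v \<in> set r"
    then have "insert a (set r) - {v} = insert a (set r - {v})" using a(1) by auto
    then show "pos_sign (insert a (set r)) v * (var v ^ k * Z (insert a (set r) - {v}))
       = - (pos_sign (set r) v * (var v ^ k * Z (insert a (set r - {v}))))" using sgn[OF v] by simp
  qed
  finally show ?case using IH minus[OF closed] a(3) by (simp add: vars_on_def regular_module_def)
qed

lemma list_mult_vars:
  assumes "distinct r" "set r \<subseteq> W"
  shows "list_mult (poly_ring X) (\<lambda>v. vars_on W v ^ l) r
     = (single (const_exp (set r) l) 1 :: ('v, 'k::field) mpoly)"
proof -
  have "list_mult (poly_ring X) (\<lambda>v. vars_on W v ^ l) r = (\<Prod>v\<in>set r. var v ^ l :: ('v, 'k) mpoly)"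
    using assms by (induction r) (simp_all add: vars_on_def)
  then show ?thesis by (simp add: prod_var_power)
qed

lemma sorted_wrt_subseq: "subseq r s \<Longrightarrow> sorted_wrt P s \<Longrightarrow> sorted_wrt P r"
  by (induction rule: list_emb.induct) (auto dest: subseq_set)

lemma subseq_sorted_list_of_set:
  fixes W :: "'v::linorder set"
  assumes "finite W"
  shows "subseq r (sorted_list_of_set W) \<longleftrightarrow> sorted_wrt (<) r \<and> set r \<subseteq> W"
proof
  assume r: "subseq r (sorted_list_of_set W)"
  have "sorted_wrt (<) r" by (rule sorted_wrt_subseq[OF r]) simp
  then show "sorted_wrt (<) r \<and> set r \<subseteq> W"
    using subseq_set[OF r] assms by (auto simp: strict_sorted_iff)
next
  assume "sorted_wrt (<) r \<and> set r \<subseteq> W"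
  then show "subseq r (sorted_list_of_set W)" using assms
    by (intro sorted_subset_imp_subseq) auto
qed

text \<open>Increasing sequences in \<open>W\<close> correspond to subsets of \<open>W\<close>, with the signs of simplicial
  cochains.\<close>

lemma cech_vanishes_stanley_reisner_iff:
  fixes X :: "'v::linorder set"
  assumes X: "finite X" and W: "W \<subseteq> X" and \<Delta>: "simplicial_complex X \<Delta>"
  defines "I \<equiv> monom_ideal X (\<lambda>t. keys t \<notin> \<Delta>) :: ('v, 'k::field) mpoly set"
  shows "cech_vanishes (poly_ring X) (stanley_reisner X \<Delta> :: (('v, 'k) mpoly, _) module) (vars_on W)
      (sorted_list_of_set W) i \<longleftrightarrow>
    (\<forall>k Z. (\<forall>T. Z T \<in> carrier (poly_ring X)) \<longrightarrow>
       (\<forall>T. T \<subseteq> W \<longrightarrow> card T = Suc i \<longrightarrow> monom_coboundary k Z T \<in> I) \<longrightarrow>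
       (\<exists>l U. (\<forall>T. U T \<in> carrier (poly_ring X)) \<and> (\<forall>T. T \<subseteq> W \<longrightarrow> card T = i \<longrightarrow>
          single (const_exp T l) 1 * Z T - monom_coboundary (k + l) U T \<in> I)))"
proof -
  let ?S = "poly_ring X :: ('v, 'k) mpoly ring"
  let ?ws = "sorted_list_of_set W" and ?B = "regular_module ?S"
  have finW: "finite W" using X W finite_subset by blast
  have I: "ideal I ?S" unfolding I_def
    by (rule ideal_monom_ideal) (use \<Delta> in \<open>auto simp: keys_add_nat simplicial_complex_def\<close>)
  have SR: "stanley_reisner X \<Delta> = quotient_module ?S I"
    by (simp add: stanley_reisner_def stanley_reisner_ideal_eq[OF X \<Delta>] I_def)
  interpret B: module ?S ?B by (rule module_regular[OF cring_poly_ring])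
  note sub = subseq_sorted_list_of_set[OF finW]
  have r: "sorted_list_of_set (set r) = r" "card (set r) = length r" "distinct r" if "subseq r ?ws" for r
    using that by (auto simp: sub strict_sorted_iff sorted_list_of_set.idem_if_sorted_distinct distinct_card)
  have T: "subseq (sorted_list_of_set T) ?ws" "set (sorted_list_of_set T) = T" "length (sorted_list_of_set T) = card T"
    if "T \<subseteq> W" for T
    using finite_subset[OF that finW] that by (auto simp: sub)
  have yk: "(vars_on W v ^ k :: ('v, 'k) mpoly) \<in> carrier ?S" for v k
    using B.R.nat_pow_closed[OF vars_on_closed[OF W], of v k] by simp
  have kos: "koszul ?B (\<lambda>v. vars_on W v ^ k) z r = monom_coboundary k (\<lambda>T. z (sorted_list_of_set T)) (set r)"
    if rw: "subseq r ?ws" and z: "\<And>s. z s \<in> carrier ?S" for r k z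
  proof -
    have "koszul ?B (\<lambda>v. vars_on W v ^ k) z r = koszul ?B (\<lambda>v. vars_on W v ^ k) (\<lambda>s. z (sorted_list_of_set (set s))) r"
      by (rule koszul_cong) (use r(1) rw subseq_order.order_trans in metis)
    then show ?thesis using koszul_sorted[OF W, of r "\<lambda>T. z (sorted_list_of_set T)" k] rw z by (simp add: sub)
  qed
  have kosT: "koszul ?B (\<lambda>v. vars_on W v ^ k) (\<lambda>s. Z (set s)) (sorted_list_of_set T) = monom_coboundary k Z T"
    if "T \<subseteq> W" "\<And>T. Z T \<in> carrier ?S" for T k Z
    using koszul_sorted[OF W, of "sorted_list_of_set T" Z k] T[OF that(1)] that(2) sub by simp
  have kosS: "koszul ?B (\<lambda>v. vars_on W v ^ k) z r \<in> carrier ?S" if "\<And>s. z s \<in> carrier ?S" for z k r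
    using B.koszul_closed[of "\<lambda>v. vars_on W v ^ k" z r] yk that by (simp add: regular_module_def)
  show ?thesis
    unfolding SR cech_vanishes_quotient_iff[OF cring_poly_ring I vars_on_closed[OF W]] poly_ring_pow poly_ring_simps
  proof (intro iffI allI impI)
    fix k and Z :: "'v set \<Rightarrow> ('v, 'k) mpoly"
    assume H: "\<forall>k z. (\<forall>r. z r \<in> carrier ?S) \<longrightarrow>
       (\<forall>r. subseq r ?ws \<longrightarrow> length r = Suc i \<longrightarrow> koszul ?B (\<lambda>v. vars_on W v ^ k) z r \<in> I) \<longrightarrow>
       (\<exists>l u. (\<forall>r. u r \<in> carrier ?S) \<and> (\<forall>r. subseq r ?ws \<longrightarrow> length r = i \<longrightarrow>
          list_mult ?S (\<lambda>v. vars_on W v ^ l) r * z r \<ominus>\<^bsub>?S\<^esub> koszul ?B (\<lambda>v. vars_on W v ^ (k + l)) u r \<in> I))"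
      and Z: "\<forall>T. Z T \<in> carrier ?S" and coc: "\<forall>T. T \<subseteq> W \<longrightarrow> card T = Suc i \<longrightarrow> monom_coboundary k Z T \<in> I"
    have "\<forall>r. subseq r ?ws \<longrightarrow> length r = Suc i \<longrightarrow> koszul ?B (\<lambda>v. vars_on W v ^ k) (\<lambda>s. Z (set s)) r \<in> I"
      using coc Z r kosT by (metis sub)
    then obtain l u where u: "\<forall>r. u r \<in> carrier ?S"
      and zu: "\<And>r. subseq r ?ws \<Longrightarrow> length r = i \<Longrightarrow>
          list_mult ?S (\<lambda>v. vars_on W v ^ l) r * Z (set r) \<ominus>\<^bsub>?S\<^esub> koszul ?B (\<lambda>v. vars_on W v ^ (k + l)) u r \<in> I"
      using H[THEN spec[of _ k], THEN spec[of _ "\<lambda>s. Z (set s)"]] Z by auto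
    have "single (const_exp T l) 1 * Z T - monom_coboundary (k + l) (\<lambda>T. u (sorted_list_of_set T)) T \<in> I"
      if TW: "T \<subseteq> W" "card T = i" for T
    proof -
      let ?r = "sorted_list_of_set T"
      have "list_mult ?S (\<lambda>v. vars_on W v ^ l) ?r * Z (set ?r) \<ominus>\<^bsub>?S\<^esub> koszul ?B (\<lambda>v. vars_on W v ^ (k + l)) u ?r \<in> I"
        by (rule zu) (use T[OF TW(1)] TW in auto)
      then show ?thesis
        using kos[OF T(1)[OF TW(1)], of u "k + l"] u T[OF TW(1)] list_mult_vars[of ?r W X l, where 'k = 'k] TW kosS[of u "k + l" ?r]
        by (simp add: poly_ring_diff)
    qed
    then show "\<exists>l U. (\<forall>T. U T \<in> carrier ?S) \<and> (\<forall>T. T \<subseteq> W \<longrightarrow> card T = i \<longrightarrow>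
          single (const_exp T l) 1 * Z T - monom_coboundary (k + l) U T \<in> I)"
      using u by (intro exI[of _ l] exI[of _ "\<lambda>T. u (sorted_list_of_set T)"]) simp
  next
    fix k and z :: "'v list \<Rightarrow> ('v, 'k) mpoly"
    assume H: "\<forall>k Z. (\<forall>T. Z T \<in> carrier ?S) \<longrightarrow>
       (\<forall>T. T \<subseteq> W \<longrightarrow> card T = Suc i \<longrightarrow> monom_coboundary k Z T \<in> I) \<longrightarrow>
       (\<exists>l U. (\<forall>T. U T \<in> carrier ?S) \<and> (\<forall>T. T \<subseteq> W \<longrightarrow> card T = i \<longrightarrow>
          single (const_exp T l) 1 * Z T - monom_coboundary (k + l) U T \<in> I))"
      and z: "\<forall>r. z r \<in> carrier ?S"
      and coc: "\<forall>r. subseq r ?ws \<longrightarrow> length r = Suc i \<longrightarrow> koszul ?B (\<lambda>v. vars_on W v ^ k) z r \<in> I"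
    let ?Z = "\<lambda>T. z (sorted_list_of_set T)"
    have "\<forall>T. T \<subseteq> W \<longrightarrow> card T = Suc i \<longrightarrow> monom_coboundary k ?Z T \<in> I"
      using coc kos z T by metis
    then obtain l U where U: "\<forall>T. U T \<in> carrier ?S" and zU: "\<And>T. T \<subseteq> W \<Longrightarrow> card T = i \<Longrightarrow>
          single (const_exp T l) 1 * ?Z T - monom_coboundary (k + l) U T \<in> I"
      using H[THEN spec[of _ k], THEN spec[of _ ?Z]] z by auto
    have "list_mult ?S (\<lambda>v. vars_on W v ^ l) s * z s \<ominus>\<^bsub>?S\<^esub> koszul ?B (\<lambda>v. vars_on W v ^ (k + l)) (\<lambda>s. U (set s)) s \<in> I"
      if s: "subseq s ?ws" "length s = i" for s
    proof -
      have sW: "set s \<subseteq> W" using s sub by blast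
      have "single (const_exp (set s) l) 1 * ?Z (set s) - monom_coboundary (k + l) U (set s) \<in> I"
        by (rule zU) (use sW s r in auto)
      then show ?thesis
        using kosT[OF sW, of U "k + l"] U r[OF s(1)] list_mult_vars[of s W X l, where 'k = 'k] sW kosS[of "\<lambda>s. U (set s)" "k + l" s]
        by (simp add: poly_ring_diff)
    qed
    then show "\<exists>l u. (\<forall>r. u r \<in> carrier ?S) \<and> (\<forall>r. subseq r ?ws \<longrightarrow> length r = i \<longrightarrow>
          list_mult ?S (\<lambda>v. vars_on W v ^ l) r * z r \<ominus>\<^bsub>?S\<^esub> koszul ?B (\<lambda>v. vars_on W v ^ (k + l)) u r \<in> I)"
      using U by (intro exI[of _ l] exI[of _ "\<lambda>s. U (set s)"]) simp
  qed
qed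

section \<open>The fine grading\<close>

lemma pos_sign_monomial:
  "pos_sign T v * single e c = (single e (pos_sign T v * c) :: ('v, 'k::field) mpoly)"
  by (cases "even (card {u \<in> T. u < v})") (simp_all add: pos_sign_def single_uminus)

lemma lookup_pos_sign_times:
  "lookup (pos_sign T v * p) t = pos_sign T v * lookup (p :: ('v::linorder, 'k::field) mpoly) t"
  by (cases "even (card {u \<in> T. u < v})") (simp_all add: pos_sign_def)

lemma lookup_var_power_times:
  fixes p :: "('v, 'k::field) mpoly"
  shows "lookup (var v ^ k * p) t =
    (if k \<le> lookup t v then lookup p (t - single v k) else 0)"
proof (cases "k \<le> lookup t v")
  case True
  have "t = single v k + (t - single v k)"
    by (rule poly_mapping_eqI) (use True in \<open>auto simp: lookup_add lookup_minus lookup_single when_def\<close>)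
  then show ?thesis using True lookup_monom_times[of "single v k" 1 p "t - single v k"]
    by (simp add: var_power)
next
  case False
  have "t \<notin> keys (var v ^ k * p)"
    using keys_monom_times[of t "single v k" 1 p] False by (auto simp: var_power lookup_add lookup_single)
  then show ?thesis using False by (simp add: in_keys_iff)
qed

lemma keys_sum_single:
  assumes "t \<in> keys (\<Sum>i\<in>A. single (e i) (f i))"
  obtains i where "i \<in> A" "t = e i" "f i \<noteq> 0"
  using assms keys_sum[of "\<lambda>i. single (e i) (f i)" A] by (force split: if_splits)

context
  fixes V W :: "'v::linorder set" and \<Delta> :: "'v set set"
  assumes V: "finite V" and W: "finite W" and VW: "V \<inter> W = {}" and \<Delta>: "simplicial_complex (V \<union> W) \<Delta>"
begin

lemma complex_sub: "F \<in> \<Delta> \<Longrightarrow> G \<subseteq> F \<Longrightarrow> G \<in> \<Delta>"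
  using \<Delta> unfolding simplicial_complex_def by blast

lemma restricted_link_eq:
  "F \<subseteq> W \<Longrightarrow> G \<subseteq> V \<Longrightarrow> restriction (link \<Delta> (F \<union> G)) W = {T. T \<subseteq> W - F \<and> F \<union> G \<union> T \<in> \<Delta>}"
  using VW complex_sub by (auto simp: restriction_def link_def)

text \<open>The part of the Koszul complex in one degree of the fine grading, for an exponent vector that
  is negative on \<open>F\<close>, positive on \<open>G\<close> and \<open>H\<close>, and zero elsewhere. Components at \<open>T\<close> are
  present if \<open>F \<subseteq> T\<close> and \<open>T \<union> G \<union> H\<close> is a face. If \<open>H\<close> is non-empty it is a cone; otherwise it
  is a shifted complex of the restricted link.\<close>

lemma solve_multidegree:
  fixes c :: "'v set \<Rightarrow> 'k::field"
  assumes co: "\<And>F G. F \<in> \<Delta> \<Longrightarrow> F \<subseteq> W \<Longrightarrow> G \<subseteq> V \<Longrightarrow> card F \<le> i \<Longrightarrow>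
      coexact TYPE('k) (restriction (link \<Delta> (F \<union> G)) W) (i - card F)"
    and F: "F \<subseteq> W" and G: "G \<subseteq> V" and H: "H \<subseteq> W - F"
    and coc: "\<And>T. F \<subseteq> T \<Longrightarrow> T \<subseteq> W \<Longrightarrow> card T = Suc i \<Longrightarrow> T \<union> G \<union> H \<in> \<Delta> \<Longrightarrow>
      (\<Sum>v\<in>T - F. pos_sign T v * c (T - {v})) = 0"
  shows "\<exists>u. \<forall>T. F \<subseteq> T \<longrightarrow> T \<subseteq> W \<longrightarrow> card T = i \<longrightarrow> T \<union> G \<union> H \<in> \<Delta> \<longrightarrow>
      c T = (\<Sum>v\<in>T - F. pos_sign T v * u (T - {v}))"
proof (cases "\<exists>T. F \<subseteq> T \<and> T \<subseteq> W \<and> card T = i \<and> T \<union> G \<union> H \<in> \<Delta>")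
  case True
  then obtain T0 where T0: "F \<subseteq> T0" "T0 \<subseteq> W" "card T0 = i" "T0 \<union> G \<union> H \<in> \<Delta>" by blast
  have finF: "finite F" using F W finite_subset by blast
  have cF: "card F \<le> i" using card_mono[OF finite_subset[OF T0(2) W] T0(1)] T0(3) by simp
  have F\<Delta>: "F \<in> \<Delta>" using complex_sub[OF T0(4)] T0(1) by blast
  define \<Gamma> where "\<Gamma> = {T. T \<subseteq> W - F \<and> F \<union> T \<union> G \<union> H \<in> \<Delta>}"
  have fin: "finite T \<and> T \<inter> F = {}" if "T \<in> \<Gamma>" for T
    using that W finite_subset[of T W] by (auto simp: \<Gamma>_def)
  have sub: "T - {v} \<in> \<Gamma>" if "T \<in> \<Gamma>" for T v
    using that complex_sub[of "F \<union> T \<union> G \<union> H" "F \<union> (T - {v}) \<union> G \<union> H"] by (auto simp: \<Gamma>_def)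
  have "coexact TYPE('k) \<Gamma> (i - card F)"
  proof (cases "H = {}")
    case True
    have "\<Gamma> = restriction (link \<Delta> (F \<union> G)) W"
      using True by (simp add: \<Gamma>_def restricted_link_eq[OF F G] Un_ac)
    then show ?thesis using co[OF F\<Delta> F G cF] by simp
  next
    case False
    then obtain w where w: "w \<in> H" by blast
    have "insert w T \<in> \<Gamma>" if "T \<in> \<Gamma>" for T
    proof -
      have "F \<union> insert w T \<union> G \<union> H = F \<union> T \<union> G \<union> H" using w by blast
      then show ?thesis using that w H by (auto simp: \<Gamma>_def)
    qed
    then show ?thesis using fin sub by (intro cone_coexact[of \<Gamma> w]) auto
  qed
  then have co\<Gamma>: "coexact TYPE('k) \<Gamma> (i - card F)" .
  have rel: "(\<forall>T\<in>\<Gamma>. card T = Suc (i - card F) \<longrightarrow> (\<Sum>v\<in>T. pos_sign (F \<union> T) v * c (F \<union> (T - {v}))) = 0) \<longrightarrow>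
     (\<exists>u. \<forall>T\<in>\<Gamma>. card T = i - card F \<longrightarrow> c (F \<union> T) = (\<Sum>v\<in>T. pos_sign (F \<union> T) v * u (F \<union> (T - {v}))))"
    by (rule coexact_translate[THEN iffD1, THEN spec, OF finF]) (use fin sub co\<Gamma> in blast)+
  have un: "(F \<union> T) - F = T" "card (F \<union> T) = card F + card T" "\<And>v. v \<in> T \<Longrightarrow> F \<union> T - {v} = F \<union> (T - {v})"
    if "T \<in> \<Gamma>" for T
    using fin[OF that] finF by (auto simp: card_Un_disjoint Int_commute)
  have "\<forall>T\<in>\<Gamma>. card T = Suc (i - card F) \<longrightarrow> (\<Sum>v\<in>T. pos_sign (F \<union> T) v * c (F \<union> (T - {v}))) = 0"
  proof (intro ballI impI)
    fix T assume T: "T \<in> \<Gamma>" "card T = Suc (i - card F)"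
    have "(\<Sum>v\<in>(F \<union> T) - F. pos_sign (F \<union> T) v * c (F \<union> T - {v})) = 0"
      by (rule coc) (use T cF un[OF T(1)] F in \<open>auto simp: \<Gamma>_def\<close>)
    then show "(\<Sum>v\<in>T. pos_sign (F \<union> T) v * c (F \<union> (T - {v}))) = 0"
      using un[OF T(1)] by (simp cong: sum.cong)
  qed
  then obtain u where u: "\<forall>T\<in>\<Gamma>. card T = i - card F \<longrightarrow> c (F \<union> T) = (\<Sum>v\<in>T. pos_sign (F \<union> T) v * u (F \<union> (T - {v})))"
    using rel by blast
  have "c T = (\<Sum>v\<in>T - F. pos_sign T v * u (T - {v}))"
    if T: "F \<subseteq> T" "T \<subseteq> W" "card T = i" "T \<union> G \<union> H \<in> \<Delta>" for T
  proof -
    have FT: "F \<union> (T - F) = T" using T(1) by blast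
    then have "T - F \<in> \<Gamma>" using T by (auto simp: \<Gamma>_def)
    moreover have "card (T - F) = i - card F" using T finF by (simp add: card_Diff_subset)
    ultimately have "c T = (\<Sum>v\<in>T - F. pos_sign T v * u (F \<union> (T - F - {v})))"
      using u FT by force
    also have "\<dots> = (\<Sum>v\<in>T - F. pos_sign T v * u (T - {v}))"
    proof (rule sum.cong[OF refl])
      fix v assume "v \<in> T - F"
      then have "F \<union> (T - F - {v}) = T - {v}" using T(1) by blast
      then show "pos_sign T v * u (F \<union> (T - F - {v})) = pos_sign T v * u (T - {v})" by simp
    qed
    finally show ?thesis .
  qed
  then show ?thesis by blast
qed blast

text \<open>The condition of \<open>cech_vanishes_stanley_reisner_iff\<close> for the complex at hand.\<close>

definition poly_acyclic :: "'k::field itself \<Rightarrow> nat \<Rightarrow> bool" where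
  "poly_acyclic K i \<longleftrightarrow> (\<forall>k (Z :: 'v set \<Rightarrow> ('v, 'k) mpoly).
     (\<forall>T. Z T \<in> carrier (poly_ring (V \<union> W))) \<longrightarrow>
     (\<forall>T. T \<subseteq> W \<longrightarrow> card T = Suc i \<longrightarrow>
        monom_coboundary k Z T \<in> monom_ideal (V \<union> W) (\<lambda>t. keys t \<notin> \<Delta>)) \<longrightarrow>
     (\<exists>l U. (\<forall>T. U T \<in> carrier (poly_ring (V \<union> W))) \<and> (\<forall>T. T \<subseteq> W \<longrightarrow> card T = i \<longrightarrow>
        single (const_exp T l) 1 * Z T - monom_coboundary (k + l) U T
          \<in> monom_ideal (V \<union> W) (\<lambda>t. keys t \<notin> \<Delta>))))"

text \<open>The cocycle is decomposed into its multigraded parts. To have natural numbers as exponents, the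
  degree of a part is recorded as a vector \<open>\<beta>\<close>, which is the integral degree plus \<open>k\<close> on \<open>W\<close>: the
  part lives in the monomial \<open>\<beta> - k\<close> on \<open>W - T\<close> at the component \<open>T\<close>, and is absent if this is
  negative somewhere. Each part is a coboundary by \<open>solve_multidegree\<close>, and only finitely many
  parts occur. Raising the exponent by one is enough.\<close>

lemma coexact_imp_poly_acyclic:
  assumes co: "\<And>F G. F \<in> \<Delta> \<Longrightarrow> F \<subseteq> W \<Longrightarrow> G \<subseteq> V \<Longrightarrow> card F \<le> i \<Longrightarrow>
      coexact TYPE('k::field) (restriction (link \<Delta> (F \<union> G)) W) (i - card F)"
  shows "poly_acyclic TYPE('k) i"
  unfolding poly_acyclic_def
proof (intro allI impI)
  let ?S = "poly_ring (V \<union> W) :: ('v, 'k) mpoly ring"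
  let ?I = "monom_ideal (V \<union> W) (\<lambda>t. keys t \<notin> \<Delta>) :: ('v, 'k) mpoly set"
  fix k and Z :: "'v set \<Rightarrow> ('v, 'k) mpoly"
  assume Z: "\<forall>T. Z T \<in> carrier ?S"
    and coc: "\<forall>T. T \<subseteq> W \<longrightarrow> card T = Suc i \<longrightarrow> monom_coboundary k Z T \<in> ?I"
  \<comment> \<open>the supports of the negative part, and of the positive part in \<open>V\<close> and in \<open>W\<close>\<close>
  define F where "F \<beta> = {v \<in> W. lookup \<beta> v < k}" for \<beta> :: "'v \<Rightarrow>\<^sub>0 nat"
  define G where "G \<beta> = {v \<in> V. 0 < lookup \<beta> v}" for \<beta> :: "'v \<Rightarrow>\<^sub>0 nat"
  define H where "H \<beta> = {v \<in> W. k < lookup \<beta> v}" for \<beta> :: "'v \<Rightarrow>\<^sub>0 nat"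
  \<comment> \<open>the monomials of degree \<open>\<beta>\<close> at the component \<open>T\<close>, for the exponents \<open>k\<close> and \<open>k + 1\<close>\<close>
  define e where "e \<beta> T = \<beta> - const_exp (W - T) k" for \<beta> T
  define e' where "e' \<beta> T = \<beta> + const_exp W 1 - const_exp (W - T) (Suc k)" for \<beta> T
  define c where "c \<beta> T = lookup (Z T) (e \<beta> T)" for \<beta> T
  have le: "lookup (e \<beta> T) v = lookup \<beta> v - (if v \<in> W - T then k else 0)" for \<beta> T v
    using W by (simp add: e_def lookup_minus lookup_const_exp)
  have le': "lookup (e' \<beta> T) v = lookup \<beta> v + (if v \<in> W then 1 else 0)
      - (if v \<in> W - T then Suc k else 0)" for \<beta> T v
    using W by (simp add: e'_def lookup_minus lookup_add lookup_const_exp)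
  \<comment> \<open>the degrees that occur in the cocycle\<close>
  define Bs where "Bs = (\<Union>T\<in>Pow W. (\<lambda>t. t + const_exp (W - T) k) ` keys (Z T))"
  have finB: "finite Bs" unfolding Bs_def using W by auto
  have BX: "keys \<beta> \<subseteq> V \<union> W" if \<beta>: "\<beta> \<in> Bs" for \<beta>
  proof
    fix v assume v: "v \<in> keys \<beta>"
    obtain T t where t: "T \<subseteq> W" "\<beta> = t + const_exp (W - T) k" "t \<in> keys (Z T)"
      using \<beta> by (auto simp: Bs_def)
    have "keys t \<subseteq> V \<union> W" using Z t(3) by (simp add: poly_carrier)
    moreover have "keys (const_exp (W - T) k) \<subseteq> W"
      using W by (auto simp: in_keys_iff lookup_const_exp split: if_splits)
    ultimately show "v \<in> V \<union> W" using v unfolding t(2) keys_add_nat by blast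
  qed
  have solve: "\<exists>u. \<forall>T. F \<beta> \<subseteq> T \<longrightarrow> T \<subseteq> W \<longrightarrow> card T = i \<longrightarrow> T \<union> G \<beta> \<union> H \<beta> \<in> \<Delta> \<longrightarrow>
      c \<beta> T = (\<Sum>v\<in>T - F \<beta>. pos_sign T v * u (T - {v}))" if \<beta>: "\<beta> \<in> Bs" for \<beta>
  proof (rule solve_multidegree[OF co])
    show "F \<beta> \<subseteq> W" "G \<beta> \<subseteq> V" "H \<beta> \<subseteq> W - F \<beta>" by (auto simp: F_def G_def H_def)
    fix T assume T: "F \<beta> \<subseteq> T" "T \<subseteq> W" "card T = Suc i" "T \<union> G \<beta> \<union> H \<beta> \<in> \<Delta>"
    have finT: "finite T" using T W finite_subset by blast
    have "keys (e \<beta> T) \<subseteq> T \<union> G \<beta> \<union> H \<beta>"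
      using BX[OF \<beta>] by (auto simp: in_keys_iff le G_def H_def subset_iff split: if_splits)
    then have "keys (e \<beta> T) \<in> \<Delta>" using complex_sub[OF T(4)] by blast
    moreover have "monom_coboundary k Z T \<in> ?I" using coc T by blast
    ultimately have "lookup (monom_coboundary k Z T) (e \<beta> T) = 0"
      by (auto simp: monom_ideal_def in_keys_iff)
    moreover have "lookup (monom_coboundary k Z T) (e \<beta> T)
        = (\<Sum>v\<in>T. if v \<in> F \<beta> then 0 else pos_sign T v * c \<beta> (T - {v}))"
      unfolding monom_coboundary_def lookup_sum lookup_pos_sign_times lookup_var_power_times
    proof (rule sum.cong[OF refl])
      fix v assume v: "v \<in> T"
      have "e \<beta> T - single v k = e \<beta> (T - {v})"
        by (rule poly_mapping_eqI) (use v T(2) in \<open>auto simp: le lookup_minus lookup_single when_def\<close>)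
      then show "pos_sign T v * (if k \<le> lookup (e \<beta> T) v
           then lookup (Z (T - {v})) (e \<beta> T - single v k) else 0)
         = (if v \<in> F \<beta> then 0 else pos_sign T v * c \<beta> (T - {v}))"
        using v T(2) by (auto simp: F_def le c_def)
    qed
    ultimately have "(\<Sum>v\<in>T. if v \<in> F \<beta> then 0 else pos_sign T v * c \<beta> (T - {v})) = 0" by simp
    moreover have "(\<Sum>v\<in>T. if v \<in> F \<beta> then 0 else pos_sign T v * c \<beta> (T - {v}))
       = (\<Sum>v\<in>T - F \<beta>. pos_sign T v * c \<beta> (T - {v}))"
      using finT by (intro sum.mono_neutral_cong_right) auto
    ultimately show "(\<Sum>v\<in>T - F \<beta>. pos_sign T v * c \<beta> (T - {v})) = 0" by simp
  qed auto
  then have "\<forall>\<beta>\<in>Bs. \<exists>u. \<forall>T. F \<beta> \<subseteq> T \<longrightarrow> T \<subseteq> W \<longrightarrow> card T = i \<longrightarrow> T \<union> G \<beta> \<union> H \<beta> \<in> \<Delta> \<longrightarrow>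
      c \<beta> T = (\<Sum>v\<in>T - F \<beta>. pos_sign T v * u (T - {v}))" by (intro ballI)
  then obtain u where u: "\<forall>\<beta>\<in>Bs. \<forall>T. F \<beta> \<subseteq> T \<longrightarrow> T \<subseteq> W \<longrightarrow> card T = i \<longrightarrow> T \<union> G \<beta> \<union> H \<beta> \<in> \<Delta> \<longrightarrow>
      c \<beta> T = (\<Sum>v\<in>T - F \<beta>. pos_sign T v * u \<beta> (T - {v}))"
    by (rule bchoice[THEN exE])
  define U where "U T = (if T \<subseteq> W then (\<Sum>\<beta> | \<beta> \<in> Bs \<and> F \<beta> \<subseteq> T. single (e' \<beta> T) (u \<beta> T)) else 0)" for T
  have e'X: "keys (e' \<beta> T) \<subseteq> V \<union> W" if "\<beta> \<in> Bs" for \<beta> T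
    using BX[OF that] by (auto simp: in_keys_iff le' subset_iff split: if_splits)
  have US: "U T \<in> carrier ?S" for T
    unfolding poly_carrier
  proof
    fix t assume "t \<in> keys (U T)"
    then show "keys t \<subseteq> V \<union> W"
      by (cases "T \<subseteq> W") (auto simp: U_def elim!: keys_sum_single dest: e'X)
  qed
  have step: "single (const_exp T 1) 1 * Z T - monom_coboundary (Suc k) U T \<in> ?I"
    if T: "T \<subseteq> W" "card T = i" for T
  proof -
    let ?BT = "{\<beta> \<in> Bs. F \<beta> \<subseteq> T}"
    have finT: "finite T" using T W finite_subset by blast
    have finBT: "finite ?BT" using finB by simp
    have Zsum: "Z T = (\<Sum>\<beta>\<in>?BT. single (e \<beta> T) (c \<beta> T))"
    proof (rule poly_mapping_eqI)
      fix t
      let ?b = "t + const_exp (W - T) k"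
      have eb: "e ?b T = t" by (rule poly_mapping_eqI) (use W in \<open>simp add: le lookup_add lookup_const_exp\<close>)
      have eq: "e \<beta> T = t \<longleftrightarrow> \<beta> = ?b" if "\<beta> \<in> ?BT" for \<beta>
      proof
        assume t: "e \<beta> T = t"
        show "\<beta> = ?b"
        proof (rule poly_mapping_eqI)
          fix v
          have "k \<le> lookup \<beta> v" if "v \<in> W - T"
            using that \<open>\<beta> \<in> ?BT\<close> by (force simp: F_def not_less)
          then show "lookup \<beta> v = lookup ?b v"
            using W by (auto simp: t[symmetric] lookup_add lookup_const_exp le)
        qed
      qed (simp add: eb)
      have "lookup (\<Sum>\<beta>\<in>?BT. single (e \<beta> T) (c \<beta> T)) t
          = (\<Sum>\<beta>\<in>?BT. if \<beta> = ?b then c ?b T else 0)"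
        unfolding lookup_sum by (intro sum.cong) (auto simp: lookup_single when_def eq)
      also have "\<dots> = (if ?b \<in> ?BT then lookup (Z T) t else 0)"
        using finBT by (simp add: c_def eb)
      also have "\<dots> = lookup (Z T) t"
      proof (cases "t \<in> keys (Z T)")
        case True
        then have "?b \<in> Bs" using T by (auto simp: Bs_def)
        moreover have "F ?b \<subseteq> T" using W by (auto simp: F_def lookup_add lookup_const_exp)
        ultimately show ?thesis by simp
      qed (simp add: in_keys_iff)
      finally show "lookup (Z T) t = lookup (\<Sum>\<beta>\<in>?BT. single (e \<beta> T) (c \<beta> T)) t" ..
    qed
    have shift: "const_exp T 1 + e \<beta> T = e' \<beta> T" if "\<beta> \<in> ?BT" for \<beta>
    proof (rule poly_mapping_eqI)
      fix v
      have "k \<le> lookup \<beta> v" if "v \<in> W - T"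
        using that \<open>\<beta> \<in> ?BT\<close> by (force simp: F_def not_less)
      then show "lookup (const_exp T 1 + e \<beta> T) v = lookup (e' \<beta> T) v"
        using T finT by (auto simp: lookup_add lookup_const_exp le le')
    qed
    have part1: "single (const_exp T 1) 1 * Z T = (\<Sum>\<beta>\<in>?BT. single (e' \<beta> T) (c \<beta> T))"
      unfolding Zsum sum_distrib_left by (intro sum.cong) (simp_all add: mult_single shift[unfolded One_nat_def])
    have "monom_coboundary (Suc k) U T
       = (\<Sum>v\<in>T. \<Sum>\<beta> | \<beta> \<in> Bs \<and> F \<beta> \<subseteq> T - {v}. single (e' \<beta> T) (pos_sign T v * u \<beta> (T - {v})))"
      unfolding monom_coboundary_def
    proof (rule sum.cong[OF refl])
      fix v assume v: "v \<in> T"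
      have ev: "single v (Suc k) + e' \<beta> (T - {v}) = e' \<beta> T" if "F \<beta> \<subseteq> T - {v}" for \<beta>
      proof (rule poly_mapping_eqI)
        fix w
        have "k \<le> lookup \<beta> v" using v T that by (force simp: F_def not_less)
        then show "lookup (single v (Suc k) + e' \<beta> (T - {v})) w = lookup (e' \<beta> T) w"
          using v T by (auto simp: lookup_add lookup_single when_def le')
      qed
      have TW: "T - {v} \<subseteq> W" using T by blast
      show "pos_sign T v * (var v ^ Suc k * U (T - {v}))
         = (\<Sum>\<beta> | \<beta> \<in> Bs \<and> F \<beta> \<subseteq> T - {v}. single (e' \<beta> T) (pos_sign T v * u \<beta> (T - {v})))"
        unfolding U_def if_P[OF TW] sum_distrib_left var_power
        by (intro sum.cong) (simp_all add: mult_single pos_sign_monomial ev)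
    qed
    also have "\<dots> = (\<Sum>v\<in>T. \<Sum>\<beta>\<in>?BT. if v \<in> F \<beta> then 0 else single (e' \<beta> T) (pos_sign T v * u \<beta> (T - {v})))"
    proof (rule sum.cong[OF refl])
      fix v assume v: "v \<in> T"
      show "(\<Sum>\<beta> | \<beta> \<in> Bs \<and> F \<beta> \<subseteq> T - {v}. single (e' \<beta> T) (pos_sign T v * u \<beta> (T - {v})))
        = (\<Sum>\<beta>\<in>?BT. if v \<in> F \<beta> then 0 else single (e' \<beta> T) (pos_sign T v * u \<beta> (T - {v})))"
        using finBT by (intro sum.mono_neutral_cong_left) auto
    qed
    also have "\<dots> = (\<Sum>\<beta>\<in>?BT. \<Sum>v\<in>T. if v \<in> F \<beta> then 0 else single (e' \<beta> T) (pos_sign T v * u \<beta> (T - {v})))"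
      by (rule sum.swap)
    also have "\<dots> = (\<Sum>\<beta>\<in>?BT. single (e' \<beta> T) (\<Sum>v\<in>T - F \<beta>. pos_sign T v * u \<beta> (T - {v})))"
    proof (rule sum.cong[OF refl])
      fix \<beta>
      have "(\<Sum>v\<in>T. if v \<in> F \<beta> then 0 else single (e' \<beta> T) (pos_sign T v * u \<beta> (T - {v})))
         = (\<Sum>v\<in>T - F \<beta>. single (e' \<beta> T) (pos_sign T v * u \<beta> (T - {v})))"
        using finT by (intro sum.mono_neutral_cong_right) auto
      also have "\<dots> = single (e' \<beta> T) (\<Sum>v\<in>T - F \<beta>. pos_sign T v * u \<beta> (T - {v}))"
        by (rule poly_mapping_eqI) (simp add: lookup_sum lookup_single when_def)
      finally show "(\<Sum>v\<in>T. if v \<in> F \<beta> then 0 else single (e' \<beta> T) (pos_sign T v * u \<beta> (T - {v})))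
         = single (e' \<beta> T) (\<Sum>v\<in>T - F \<beta>. pos_sign T v * u \<beta> (T - {v}))" .
    qed
    finally have part2: "monom_coboundary (Suc k) U T
       = (\<Sum>\<beta>\<in>?BT. single (e' \<beta> T) (\<Sum>v\<in>T - F \<beta>. pos_sign T v * u \<beta> (T - {v})))" .
    have diff: "single (const_exp T 1) 1 * Z T - monom_coboundary (Suc k) U T
       = (\<Sum>\<beta>\<in>?BT. single (e' \<beta> T) (c \<beta> T - (\<Sum>v\<in>T - F \<beta>. pos_sign T v * u \<beta> (T - {v}))))"
      unfolding part1 part2 by (simp add: sum_subtractf single_diff)
    have "keys (e' \<beta> T) \<notin> \<Delta>"
      if \<beta>: "\<beta> \<in> ?BT" and ne: "c \<beta> T - (\<Sum>v\<in>T - F \<beta>. pos_sign T v * u \<beta> (T - {v})) \<noteq> 0" for \<beta>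
    proof -
      have "T \<union> G \<beta> \<union> H \<beta> \<subseteq> keys (e' \<beta> T)"
        using T VW by (auto simp: in_keys_iff le' G_def H_def)
      moreover have "T \<union> G \<beta> \<union> H \<beta> \<notin> \<Delta>" using u \<beta> T ne by auto
      ultimately show ?thesis using complex_sub by blast
    qed
    note nonface = this
    have "keys t \<subseteq> V \<union> W \<and> keys t \<notin> \<Delta>"
      if t: "t \<in> keys (\<Sum>\<beta>\<in>?BT. single (e' \<beta> T)
        (c \<beta> T - (\<Sum>v\<in>T - F \<beta>. pos_sign T v * u \<beta> (T - {v}))))" for t
      using t by (rule keys_sum_single) (use nonface e'X in blast)
    then show ?thesis unfolding diff monom_ideal_def poly_carrier by blast
  qed
  show "\<exists>l U. (\<forall>T. U T \<in> carrier ?S) \<and> (\<forall>T. T \<subseteq> W \<longrightarrow> card T = i \<longrightarrow>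
        single (const_exp T l) 1 * Z T - monom_coboundary (k + l) U T \<in> ?I)"
    using US step by (intro exI[of _ 1] exI[of _ U]) simp
qed

text \<open>A cocycle of the restricted link is put into the single degree that is \<open>1\<close> on \<open>G\<close> and \<open>-1\<close>
  on \<open>F\<close>. In the Koszul complex for the exponent \<open>2\<close> this degree lives in the monomials
  \<open>e T 2\<close>, which are \<open>1\<close> on \<open>G\<close> and \<open>F\<close> and \<open>2\<close> on \<open>T - F\<close>, so that their supports are
  \<open>T \<union> G\<close>; with the exponent \<open>1\<close> the set \<open>F\<close> would be missing from the support. The coefficients
  of a bounding cochain in this degree bound the given cocycle.\<close>

lemma poly_acyclic_imp_coexact:
  assumes P: "poly_acyclic TYPE('k::field) i"
    and F: "F \<in> \<Delta>" "F \<subseteq> W" and G: "G \<subseteq> V" and cF: "card F \<le> i"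
  shows "coexact TYPE('k) (restriction (link \<Delta> (F \<union> G)) W) (i - card F)"
proof -
  let ?S = "poly_ring (V \<union> W) :: ('v, 'k) mpoly ring"
  let ?I = "monom_ideal (V \<union> W) (\<lambda>t. keys t \<notin> \<Delta>) :: ('v, 'k) mpoly set"
  define \<Gamma> where "\<Gamma> = restriction (link \<Delta> (F \<union> G)) W"
  have \<Gamma>: "\<Gamma> = {T. T \<subseteq> W - F \<and> F \<union> G \<union> T \<in> \<Delta>}" unfolding \<Gamma>_def by (rule restricted_link_eq[OF F(2) G])
  have finF: "finite F" and finG: "finite G" using F G W V finite_subset by blast+
  have fin: "finite T \<and> T \<inter> F = {}" if "T \<in> \<Gamma>" for T using that W finite_subset[of T W] by (auto simp: \<Gamma>)
  have sub: "T - {v} \<in> \<Gamma>" if "T \<in> \<Gamma>" for T v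
    using that complex_sub[of "F \<union> G \<union> T" "F \<union> G \<union> (T - {v})"] by (auto simp: \<Gamma>)
  have "\<forall>c :: 'v set \<Rightarrow> 'k.
     (\<forall>T\<in>\<Gamma>. card T = Suc (i - card F) \<longrightarrow> (\<Sum>v\<in>T. pos_sign (F \<union> T) v * c (F \<union> (T - {v}))) = 0) \<longrightarrow>
     (\<exists>u. \<forall>T\<in>\<Gamma>. card T = i - card F \<longrightarrow> c (F \<union> T) = (\<Sum>v\<in>T. pos_sign (F \<union> T) v * u (F \<union> (T - {v}))))"
  proof (intro allI impI)
    fix c :: "'v set \<Rightarrow> 'k"
    assume coc: "\<forall>T\<in>\<Gamma>. card T = Suc (i - card F) \<longrightarrow> (\<Sum>v\<in>T. pos_sign (F \<union> T) v * c (F \<union> (T - {v}))) = 0"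
    define e where "e T k = const_exp G 1 + const_exp T k - const_exp F 1" for T k
    have le: "lookup (e T k) v = (if v \<in> G then 1 else 0) + (if v \<in> T then k else 0) - (if v \<in> F then 1 else 0)"
      if "T \<subseteq> W" for T k v
      using finF finG finite_subset[OF that W] by (simp add: e_def lookup_add lookup_minus lookup_const_exp)
    have ke: "keys (e T k) = G \<union> T" if "T \<subseteq> W" "F \<subseteq> T" "2 \<le> k" for T k
      using that G F VW by (auto simp: in_keys_iff le split: if_splits)
    define face where "face T \<longleftrightarrow> F \<subseteq> T \<and> T \<subseteq> W \<and> T \<union> G \<in> \<Delta>" for T
    define Z where "Z T = (if face T then single (e T 2) (c T) else 0)" for T
    have Z: "\<forall>T. Z T \<in> carrier ?S"
      using ke[of _ 2] G by (auto simp: poly_carrier Z_def face_def)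
    have esum: "single v k + e (T - {v}) k = e T k" if "v \<in> T - F" "T \<subseteq> W" for v T k
    proof (rule poly_mapping_eqI)
      fix w
      have "T - {v} \<subseteq> W" using that by blast
      then show "lookup (single v k + e (T - {v}) k) w = lookup (e T k) w"
        using that le[of "T - {v}" k w] le[of T k w] F G VW
        by (auto simp: lookup_add lookup_single when_def)
    qed
    have cocZ: "\<forall>T. T \<subseteq> W \<longrightarrow> card T = Suc i \<longrightarrow> monom_coboundary 2 Z T \<in> ?I"
    proof (intro allI impI)
      fix T assume T: "T \<subseteq> W" "card T = Suc i"
      have finT: "finite T" using T W finite_subset by blast
      show "monom_coboundary 2 Z T \<in> ?I"
      proof (cases "F \<subseteq> T")
        case False
        then have "Z (T - {v}) = 0" for v by (auto simp: Z_def face_def)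
        then show ?thesis by (simp add: monom_coboundary_def monom_ideal_def poly_carrier)
      next
        case True
        let ?x = "\<Sum>v\<in>T. if face (T - {v}) then pos_sign T v * c (T - {v}) else 0"
        have "monom_coboundary 2 Z T
           = (\<Sum>v\<in>T. single (e T 2) (if face (T - {v}) then pos_sign T v * c (T - {v}) else 0))"
          unfolding monom_coboundary_def
        proof (rule sum.cong[OF refl])
          fix v assume v: "v \<in> T"
          have "v \<notin> F" if "face (T - {v})" using that by (auto simp: face_def)
          then show "pos_sign T v * (var v ^ 2 * Z (T - {v}))
             = single (e T 2) (if face (T - {v}) then pos_sign T v * c (T - {v}) else 0)"
            using esum[of v T 2] v T by (auto simp: Z_def var_power mult_single pos_sign_monomial)
        qed
        also have "\<dots> = single (e T 2) ?x"
          by (rule poly_mapping_eqI) (simp add: lookup_sum lookup_single when_def)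
        finally have eq: "monom_coboundary 2 Z T = single (e T 2) ?x" .
        show ?thesis
        proof (cases "T \<union> G \<in> \<Delta>")
          case False
          then show ?thesis unfolding eq using ke[OF T(1) True, of 2] T G
            by (auto simp: monom_ideal_def poly_carrier Un_commute)
        next
          case face: True
          have FT: "F \<union> (T - F) = T" using True by blast
          have "F \<union> G \<union> (T - F) = T \<union> G" using True by blast
          then have mem: "T - F \<in> \<Gamma>" using T face by (auto simp: \<Gamma>)
          have "?x = (\<Sum>v\<in>T - F. pos_sign T v * c (F \<union> (T - F - {v})))"
          proof (rule sum.mono_neutral_cong_right[OF finT])
            show "\<forall>v\<in>T - (T - F). (if face (T - {v}) then pos_sign T v * c (T - {v}) else 0) = 0"
              by (auto simp: face_def)
            fix v assume v: "v \<in> T - F"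
            have "T - {v} \<union> G \<in> \<Delta>" by (rule complex_sub[OF face]) blast
            then have "face (T - {v})" using v True T by (auto simp: face_def)
            moreover have "F \<union> (T - F - {v}) = T - {v}" using v True by blast
            ultimately show "(if face (T - {v}) then pos_sign T v * c (T - {v}) else 0) = pos_sign T v * c (F \<union> (T - F - {v}))"
              by simp
          qed simp
          also have "\<dots> = 0"
            using coc[rule_format, OF mem, unfolded FT] T True finF cF by (simp add: card_Diff_subset Suc_diff_le)
          finally show ?thesis unfolding eq by (simp add: monom_ideal_def poly_carrier)
        qed
      qed
    qed
    obtain l U where U: "\<And>T. T \<subseteq> W \<Longrightarrow> card T = i \<Longrightarrow>
        single (const_exp T l) 1 * Z T - monom_coboundary (2 + l) U T \<in> ?I"
      using P[unfolded poly_acyclic_def, THEN spec[of _ 2], THEN spec[of _ Z]] Z cocZ by auto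
    define u where "u T = lookup (U T) (e T (2 + l))" for T
    have "c (F \<union> T') = (\<Sum>v\<in>T'. pos_sign (F \<union> T') v * u (F \<union> (T' - {v})))"
      if T': "T' \<in> \<Gamma>" "card T' = i - card F" for T'
    proof -
      let ?T = "F \<union> T'"
      have TW: "?T \<subseteq> W" and TG: "?T \<union> G \<in> \<Delta>" using T' F by (auto simp: \<Gamma> Un_ac)
      have finT: "finite ?T" using TW W finite_subset by blast
      have cT: "card ?T = i" using T' cF fin[OF T'(1)] finF by (simp add: card_Un_disjoint Int_commute)
      have "keys (e ?T (2 + l)) \<in> \<Delta>" using ke[of ?T "2 + l"] TW TG by (simp add: Un_ac)
      then have "lookup (single (const_exp ?T l) 1 * Z ?T - monom_coboundary (2 + l) U ?T) (e ?T (2 + l)) = 0"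
        using U[OF TW cT] by (auto simp: monom_ideal_def in_keys_iff)
      then have eq: "lookup (single (const_exp ?T l) 1 * Z ?T) (e ?T (2 + l))
         = lookup (monom_coboundary (2 + l) U ?T) (e ?T (2 + l))" by (simp add: lookup_minus)
      have "e ?T (2 + l) = const_exp ?T l + e ?T 2"
        by (rule poly_mapping_eqI) (use le[OF TW] finT in \<open>auto simp: lookup_add lookup_const_exp\<close>)
      then have "lookup (single (const_exp ?T l) 1 * Z ?T) (e ?T (2 + l)) = c ?T"
        using TW TG by (simp add: lookup_monom_times Z_def face_def)
      moreover have "lookup (monom_coboundary (2 + l) U ?T) (e ?T (2 + l))
         = (\<Sum>v\<in>T'. pos_sign ?T v * u (F \<union> (T' - {v})))"
        unfolding monom_coboundary_def lookup_sum lookup_pos_sign_times lookup_var_power_times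
      proof (rule sum.mono_neutral_cong_right[OF finT])
        show "\<forall>v\<in>?T - T'. pos_sign ?T v * (if 2 + l \<le> lookup (e ?T (2 + l)) v
            then lookup (U (?T - {v})) (e ?T (2 + l) - single v (2 + l)) else 0) = 0"
          using le[OF TW, of "2 + l"] F G VW by auto
        fix v assume v: "v \<in> T'"
        then have vF: "v \<in> ?T - F" "?T - {v} = F \<union> (T' - {v})" "v \<notin> F" using fin[OF T'(1)] by auto
        have "e ?T (2 + l) - single v (2 + l) = e (?T - {v}) (2 + l)"
          using esum[OF vF(1) TW, of "2 + l"] by (metis add_diff_cancel_left')
        moreover have "2 + l \<le> lookup (e ?T (2 + l)) v" using le[OF TW, of "2 + l" v] v vF by simp
        ultimately show "pos_sign ?T v * (if 2 + l \<le> lookup (e ?T (2 + l)) v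
            then lookup (U (?T - {v})) (e ?T (2 + l) - single v (2 + l)) else 0)
           = pos_sign ?T v * u (F \<union> (T' - {v}))"
          using vF by (simp add: u_def)
      qed auto
      ultimately show ?thesis using eq by simp
    qed
    then show "\<exists>u. \<forall>T\<in>\<Gamma>. card T = i - card F \<longrightarrow> c (F \<union> T) = (\<Sum>v\<in>T. pos_sign (F \<union> T) v * u (F \<union> (T - {v})))" by blast
  qed
  then show ?thesis unfolding \<Gamma>_def[symmetric]
    by (intro coexact_translate[THEN iffD2, OF finF]) (use fin sub in blast)+
qed

end

section \<open>Purity and the criterion\<close>

lemma coexact_vacuous: "(\<And>T. T \<in> \<Gamma> \<Longrightarrow> card T \<noteq> p) \<Longrightarrow> coexact K \<Gamma> p"
  by (auto simp: coexact_def)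

text \<open>The class in degree \<open>-1\<close> that each largest face of \<open>\<Delta>\<^sub>W\<close> contributes to local cohomology.\<close>

lemma not_coexact_empty_face: "\<not> coexact TYPE('k::field) {{} :: 'v::linorder set} 0"
  unfolding coexact_def by (auto simp: coboundary_def intro!: exI[of _ "\<lambda>_. 1"])

definition facet :: "'v set set \<Rightarrow> 'v set \<Rightarrow> bool" where
  "facet \<Gamma> A \<longleftrightarrow> A \<in> \<Gamma> \<and> (\<forall>B\<in>\<Gamma>. A \<subseteq> B \<longrightarrow> B = A)"

lemma face_in_facet:
  assumes "finite \<Gamma>" "F \<in> \<Gamma>"
  obtains A where "facet \<Gamma> A" "F \<subseteq> A"
  using finite_has_maximal2[OF assms] unfolding facet_def by metis

lemma card_le_link_dim:
  assumes "finite \<Gamma>" "H \<in> link \<Gamma> F"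
  shows "int (card H) - 1 \<le> complex_dim (link \<Gamma> F)"
  unfolding complex_dim_def using assms by (intro Max_ge) (auto simp: link_def)

text \<open>Two facets containing \<open>F\<close> are compared through the link of \<open>F\<close>. For a vertex \<open>v\<close> of the link, all facets
  containing \<open>F\<close> and \<open>v\<close> have the same size by induction. The function that tells whether this size is that of
  \<open>A\<close> takes equal values at the ends of an edge, as an edge lies in a facet; so it is a cocycle
  of degree \<open>0\<close>, and vanishing of reduced cohomology makes it constant. Links of dimension at most
  \<open>0\<close> leave no choice for the size.\<close>

lemma coexact_links_imp_pure:
  fixes \<Gamma> :: "'v::linorder set set"
  assumes fin: "finite \<Gamma>" "\<And>F. F \<in> \<Gamma> \<Longrightarrow> finite F"
    and sub: "\<And>F G. F \<in> \<Gamma> \<Longrightarrow> G \<subseteq> F \<Longrightarrow> G \<in> \<Gamma>"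
    and co: "\<And>F p. F \<in> \<Gamma> \<Longrightarrow> int p - 1 < complex_dim (link \<Gamma> F) \<Longrightarrow> coexact TYPE('k::field) (link \<Gamma> F) p"
  shows "F \<in> \<Gamma> \<Longrightarrow> facet \<Gamma> A \<Longrightarrow> facet \<Gamma> B \<Longrightarrow> F \<subseteq> A \<Longrightarrow> F \<subseteq> B \<Longrightarrow> card A = card B"
proof (induction "card A - card F" arbitrary: F A B rule: less_induct)
  case less
  have AB: "A \<in> \<Gamma>" "B \<in> \<Gamma>" using less.prems by (auto simp: facet_def)
  note finA = fin(2)[OF AB(1)] and finB = fin(2)[OF AB(2)]
  show ?case
  proof (cases "A = F \<or> B = F")
    case True
    then show ?thesis using less.prems unfolding facet_def by metis
  next
    case False
    obtain a b where a: "a \<in> A" "a \<notin> F" and b: "b \<in> B" "b \<notin> F" using False less.prems by blast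
    have cF: "card F < card A" "card F < card B"
      using False less.prems finA finB by (auto intro!: psubset_card_mono)
    have vertex: "insert v F \<in> \<Gamma> \<and> {v} \<in> link \<Gamma> F" if "v \<in> C" "v \<notin> F" "F \<subseteq> C" "C \<in> \<Gamma>" for v C
      using sub[OF that(4), of "insert v F"] sub[OF that(4), of "{v}"] that by (auto simp: link_def)
    define P where "P v \<longleftrightarrow> (\<exists>C. facet \<Gamma> C \<and> insert v F \<subseteq> C \<and> card C = card A)" for v
    have PD: "card C = card A" if P: "P v" and v: "v \<notin> F" and C: "facet \<Gamma> C" "insert v F \<subseteq> C" for v C
    proof -
      obtain C' where C': "facet \<Gamma> C'" "insert v F \<subseteq> C'" "card C' = card A" using P by (auto simp: P_def)
      have "insert v F \<in> \<Gamma>" using C sub by (auto simp: facet_def)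
      moreover have "card C' - card (insert v F) < card A - card F"
        using C'(3) cF v fin(2)[OF less.prems(1)] by simp
      ultimately have "card C' = card C" using less.hyps[of C' "insert v F" C] C C' by blast
      then show ?thesis using C' by simp
    qed
    \<comment> \<open>the indicator of \<open>P\<close> as a cochain of degree \<open>0\<close>\<close>
    define c :: "'v set \<Rightarrow> 'k" where "c T = (if \<exists>v. T = {v} \<and> P v then 1 else 0)" for T
    have c1: "c {v} = (if P v then 1 else 0)" for v by (auto simp: c_def)
    show ?thesis
    proof (cases "0 < complex_dim (link \<Gamma> F)")
      case True
      have "coboundary c T = 0" if T: "T \<in> link \<Gamma> F" "card T = Suc 1" for T
      proof -
        obtain x y where xy: "T = {x, y}" "x < y"
          using T(2) by (auto simp: card_Suc_eq) (metis insert_commute neq_iff)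
        have FT: "F \<union> T \<in> \<Gamma>" "x \<notin> F" "y \<notin> F" using T(1) xy by (auto simp: link_def)
        obtain C where C: "facet \<Gamma> C" "F \<union> T \<subseteq> C" using face_in_facet[OF fin(1) FT(1)] by blast
        have "P x \<longleftrightarrow> P y"
          using PD[of x C] PD[of y C] C FT xy unfolding P_def by blast
        moreover have below: "{u \<in> {x, y}. u < x} = {}" "{u \<in> {x, y}. u < y} = {x}" using xy(2) by auto
        have "pos_sign T x = (1 :: 'k)" "pos_sign T y = (- 1 :: 'k)"
          unfolding xy(1) pos_sign_def below by simp_all
        moreover have "T - {x} = {y}" "T - {y} = {x}" using xy by auto
        moreover have "coboundary c T = pos_sign T x * c (T - {x}) + pos_sign T y * c (T - {y})"
          unfolding coboundary_def using xy by (simp add: xy(1))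
        ultimately show ?thesis by (simp add: c1)
      qed
      moreover have "coexact TYPE('k) (link \<Gamma> F) 1" using co[OF less.prems(1), of 1] True by simp
      ultimately obtain u where u: "\<And>T. T \<in> link \<Gamma> F \<Longrightarrow> card T = 1 \<Longrightarrow> c T = coboundary u T"
        unfolding coexact_def by (metis One_nat_def)
      have const: "c {v} = u {}" if "{v} \<in> link \<Gamma> F" for v
      proof -
        have below: "{w \<in> {v}. w < v} = {}" by auto
        have "pos_sign {v} v = (1 :: 'k)" unfolding pos_sign_def below by simp
        then show ?thesis using u[OF that] by (simp add: coboundary_def)
      qed
      have "P a" unfolding P_def using less.prems a by blast
      then have "c {a} = 1" by (simp add: c1)
      then have "c {b} = 1" using const vertex[OF a less.prems(4) AB(1)] vertex[OF b less.prems(5) AB(2)] by metis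
      then have "P b" by (simp add: c1 split: if_splits)
      then show ?thesis using PD[of b B] b less.prems by auto
    next
      case False
      have "A - F \<in> link \<Gamma> F" "B - F \<in> link \<Gamma> F"
        using less.prems AB sub by (auto simp: link_def Un_absorb1)
      then have "card (A - F) \<le> 1" "card (B - F) \<le> 1" using card_le_link_dim[OF fin(1), of _ F] False by force+
      then show ?thesis using cF less.prems finA finB fin(2)[OF less.prems(1)] by (simp add: card_Diff_subset)
    qed
  qed
qed

theorem theorem4p7:
  fixes V W :: "'v::linorder set"
    and \<Delta> :: "'v set set"
    and S :: "(('v \<Rightarrow>\<^sub>0 nat) \<Rightarrow>\<^sub>0 'k::field) ring"
    and Q :: "(('v \<Rightarrow>\<^sub>0 nat) \<Rightarrow>\<^sub>0 'k) set"
    and q :: nat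
  assumes "finite V" and "finite W" and "V \<inter> W = {}"
    and "simplicial_complex (V \<union> W) \<Delta>"
    and "S = poly_ring (V \<union> W)"
    and "Q = Idl\<^bsub>S\<^esub> (var ` W)"
    and "q = cd S Q (stanley_reisner (V \<union> W) \<Delta>)"
  shows "(relative_CM S Q (stanley_reisner (V \<union> W) \<Delta>) \<and>
            cd S Q (stanley_reisner (V \<union> W) \<Delta>) = q) \<longleftrightarrow>
         (\<forall>F \<in> restriction \<Delta> W. \<forall>G \<subseteq> V. \<forall>i < complex_dim (link (restriction \<Delta> W) F).
            trivial_group (reduced_homology TYPE('k) i (restriction (link \<Delta> (F \<union> G)) W)))"
proof -
  let ?X = "V \<union> W" and ?\<Gamma> = "restriction \<Delta> W"
  let ?M = "stanley_reisner ?X \<Delta> :: (('v, 'k) mpoly, _) module"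
  let ?L = "\<lambda>F G. restriction (link \<Delta> (F \<union> G)) W"
  note VW = assms(1-4)
  have \<Gamma>: "F \<in> ?\<Gamma> \<longleftrightarrow> F \<in> \<Delta> \<and> F \<subseteq> W" for F by (auto simp: restriction_def)
  have fin\<Gamma>: "finite ?\<Gamma>" using assms(2) by (auto simp: restriction_def intro: finite_subset[of _ "Pow W"])
  have finF: "finite F" if "F \<in> ?\<Gamma>" for F using that \<Gamma> assms(2) finite_subset by blast
  have sub\<Gamma>: "G \<in> ?\<Gamma>" if "F \<in> ?\<Gamma>" "G \<subseteq> F" for F G
    using that complex_sub[OF VW, of F G] by (auto simp: \<Gamma>)
  have empty\<Gamma>: "{} \<in> ?\<Gamma>" using assms(4) by (simp add: \<Gamma> simplicial_complex_def)
  have L: "?L F G = {T. T \<subseteq> W - F \<and> F \<union> G \<union> T \<in> \<Delta>}" if "F \<subseteq> W" "G \<subseteq> V" for F G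
    by (rule restricted_link_eq[OF VW that])
  have L_face: "F \<union> T \<in> ?\<Gamma> \<and> F \<inter> T = {} \<and> T \<in> ?\<Gamma>" if "F \<in> ?\<Gamma>" "G \<subseteq> V" "T \<in> ?L F G" for F G T
    using that L[of F G] complex_sub[OF VW, of "F \<union> G \<union> T" "F \<union> T"] complex_sub[OF VW, of "F \<union> G \<union> T" T]
    by (auto simp: \<Gamma>)
  have L_sub: "T - {v} \<in> ?L F G" if "F \<in> ?\<Gamma>" "G \<subseteq> V" "T \<in> ?L F G" for F G T v
    using that L[of F G] complex_sub[OF VW, of "F \<union> G \<union> T" "F \<union> G \<union> (T - {v})"] by (auto simp: \<Gamma>)
  have L_empty: "?L F {} = link ?\<Gamma> F" if "F \<in> ?\<Gamma>" for F
    using that by (auto simp: restriction_def link_def)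
  \<comment> \<open>\<open>d\<close> will turn out to be the cohomological dimension\<close>
  define d where "d = Max (card ` ?\<Gamma>)"
  have d_le: "card F \<le> d" if "F \<in> ?\<Gamma>" for F unfolding d_def using that fin\<Gamma> by simp
  have "d \<in> card ` ?\<Gamma>" unfolding d_def using fin\<Gamma> empty\<Gamma> by (intro Max_in) auto
  then obtain D where D: "D \<in> ?\<Gamma>" "card D = d" by blast
  \<comment> \<open>the degrees with non-zero local cohomology\<close>
  define N where "N i \<longleftrightarrow> \<not> trivial_group (local_cohomology S Q ?M i)" for i
  have N: "N i \<longleftrightarrow> (\<exists>F\<in>?\<Gamma>. \<exists>G\<subseteq>V. card F \<le> i \<and> \<not> coexact TYPE('k) (?L F G) (i - card F))" for i
  proof -
    have "ideal (stanley_reisner_ideal ?X \<Delta> :: ('v, 'k) mpoly set) (poly_ring ?X)"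
      unfolding stanley_reisner_ideal_eq[OF finite_UnI[OF assms(1,2)] assms(4)]
      by (rule ideal_monom_ideal) (use assms(4) in \<open>auto simp: keys_add_nat simplicial_complex_def\<close>)
    then have M: "module (poly_ring ?X) ?M"
      unfolding stanley_reisner_def by (rule module_quotient_module[OF cring_poly_ring])
    have "\<not> N i \<longleftrightarrow> cech_vanishes (poly_ring ?X) ?M (vars_on W) (sorted_list_of_set W) i"
      unfolding N_def assms(5)
      using local_cohomology_vars_trivial_iff[OF M, of "sorted_list_of_set W" Q i] assms(2,5,6) by simp
    also have "\<dots> \<longleftrightarrow> poly_acyclic V W \<Delta> TYPE('k) i"
      unfolding poly_acyclic_def[OF VW]
      by (rule cech_vanishes_stanley_reisner_iff[OF finite_UnI[OF assms(1,2)] _ assms(4)]) simp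
    also have "\<dots> \<longleftrightarrow> (\<forall>F\<in>?\<Gamma>. \<forall>G\<subseteq>V. card F \<le> i \<longrightarrow> coexact TYPE('k) (?L F G) (i - card F))"
      using coexact_imp_poly_acyclic[OF VW, of i, where 'k = 'k] poly_acyclic_imp_coexact[OF VW, of i, where 'k = 'k]
      by (auto simp: \<Gamma>)
    finally show ?thesis by blast
  qed
  have Nd: "N d"
  proof -
    have "?L D {} = {{}}"
    proof (intro equalityI subsetI)
      fix T assume T: "T \<in> ?L D {}"
      note DT = L_face[OF D(1) _ T]
      have "card (D \<union> T) = card D + card T" using DT finF D(1) by (intro card_Un_disjoint) auto
      then have "card T = 0" using d_le[of "D \<union> T"] DT D(2) by simp
      then show "T \<in> {{}}" using finF DT by simp
    qed (use D empty\<Gamma> in \<open>auto simp: restriction_def link_def\<close>)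
    then show ?thesis unfolding N using not_coexact_empty_face[where 'k = 'k] D by (intro bexI[of _ D] exI[of _ "{}"]) auto
  qed
  have N_le: "i \<le> d" if "N i" for i
  proof -
    obtain F G where FG: "F \<in> ?\<Gamma>" "G \<subseteq> V" "card F \<le> i" "\<not> coexact TYPE('k) (?L F G) (i - card F)"
      using \<open>N i\<close> N by blast
    then obtain T where T: "T \<in> ?L F G" "card T = i - card F" using coexact_vacuous by blast
    note FT = L_face[OF FG(1,2) T(1)]
    have "card (F \<union> T) = i" using FT finF FG(1,3) T(2) by (subst card_Un_disjoint) auto
    then show ?thesis using d_le FT by metis
  qed
  have cd: "cd S Q ?M = d"
    unfolding cd_def N_def[symmetric] using Nd N_le by (rule Greatest_equality)
  have grade: "grade S Q ?M = d \<longleftrightarrow> (\<forall>i<d. \<not> N i)"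
    unfolding grade_def N_def[symmetric] using Nd by (metis LeastI Least_le not_less not_less_Least order.antisym)
  have "relative_CM S Q ?M \<longleftrightarrow> (\<forall>F\<in>?\<Gamma>. \<forall>G\<subseteq>V. \<forall>p. card F + p < d \<longrightarrow> coexact TYPE('k) (?L F G) p)"
    unfolding relative_CM_def cd grade N
    by (metis add_diff_cancel_left' le_add1 le_add_diff_inverse)
  also have "\<dots> \<longleftrightarrow> (\<forall>F\<in>?\<Gamma>. \<forall>G\<subseteq>V. \<forall>p. int p - 1 < complex_dim (link ?\<Gamma> F) \<longrightarrow> coexact TYPE('k) (?L F G) p)"
    (is "?A \<longleftrightarrow> ?B")
  proof
    assume A: ?A
    show ?B
    proof (intro ballI allI impI)
      fix F G p assume F: "F \<in> ?\<Gamma>" and G: "G \<subseteq> V" and p: "int p - 1 < complex_dim (link ?\<Gamma> F)"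
      have "{} \<in> link ?\<Gamma> F" using F empty\<Gamma> by (simp add: link_def)
      then have ne: "link ?\<Gamma> F \<noteq> {}" by blast
      have "complex_dim (link ?\<Gamma> F) \<in> (\<lambda>H. int (card H) - 1) ` link ?\<Gamma> F"
        unfolding complex_dim_def using fin\<Gamma> ne by (intro Max_in) (auto simp: link_def)
      then obtain H where H: "H \<in> link ?\<Gamma> F" "complex_dim (link ?\<Gamma> F) = int (card H) - 1" by blast
      have "card (F \<union> H) = card F + card H"
        using H finF F by (intro card_Un_disjoint) (auto simp: link_def)
      then have "card F + card H \<le> d" using d_le[of "F \<union> H"] H(1) by (simp add: link_def)
      then show "coexact TYPE('k) (?L F G) p" using A F G p H(2) by auto
    qed
  next
    assume B: ?B
    have pure: "card A = d" if A: "facet ?\<Gamma> A" for A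
    proof -
      have "facet ?\<Gamma> D" unfolding facet_def
        using D d_le finF by (metis card_seteq)
      moreover have "coexact TYPE('k) (link ?\<Gamma> F) p" if "F \<in> ?\<Gamma>" "int p - 1 < complex_dim (link ?\<Gamma> F)" for F p
        using B that L_empty by force
      ultimately show ?thesis
        using coexact_links_imp_pure[where 'k = 'k, of ?\<Gamma> "{}" A D] A fin\<Gamma> finF sub\<Gamma> empty\<Gamma> D(2) by auto
    qed
    show ?A
    proof (intro ballI allI impI)
      fix F G p assume F: "F \<in> ?\<Gamma>" and G: "G \<subseteq> V" and p: "card F + p < d"
      obtain A where A: "facet ?\<Gamma> A" "F \<subseteq> A" using face_in_facet[OF fin\<Gamma> F] by blast
      have A\<Gamma>: "A \<in> ?\<Gamma>" using A by (simp add: facet_def)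
      then have "A - F \<in> link ?\<Gamma> F" using A(2) sub\<Gamma>[of A "A - F"] by (auto simp: link_def Un_absorb1)
      then have "int (card (A - F)) - 1 \<le> complex_dim (link ?\<Gamma> F)" by (rule card_le_link_dim[OF fin\<Gamma>])
      moreover have "card (A - F) = d - card F" using pure[OF A(1)] A(2) finF[OF F] by (simp add: card_Diff_subset)
      ultimately show "coexact TYPE('k) (?L F G) p" using B F G p by auto
    qed
  qed
  also have "\<dots> \<longleftrightarrow> (\<forall>F\<in>?\<Gamma>. \<forall>G\<subseteq>V. \<forall>i < complex_dim (link ?\<Gamma> F).
            trivial_group (reduced_homology TYPE('k) i (?L F G)))"
  proof -
    have "(\<forall>p. int p - 1 < m \<longrightarrow> coexact TYPE('k) (?L F G) p) \<longleftrightarrow>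
        (\<forall>i<m. trivial_group (reduced_homology TYPE('k) i (?L F G)))" if FG: "F \<in> ?\<Gamma>" "G \<subseteq> V" for F G m
    proof -
      have Lf: "finite (?L F G)" "\<And>T. T \<in> ?L F G \<Longrightarrow> finite T"
        using L_face[OF FG] finF fin\<Gamma> finite_subset[of "?L F G" ?\<Gamma>] by blast+
      have iff: "trivial_group (reduced_homology TYPE('k) (int p - 1) (?L F G)) \<longleftrightarrow> coexact TYPE('k) (?L F G) p" for p
        by (rule reduced_homology_trivial_iff_coexact[OF Lf L_sub[OF FG]])
      have "trivial_group (reduced_homology TYPE('k) i (?L F G))"
        if H: "\<forall>p. int p - 1 < m \<longrightarrow> coexact TYPE('k) (?L F G) p" and i: "i < m" for i
      proof (cases "i < -1")
        case True
        then show ?thesis by (intro reduced_homology_below L_sub[OF FG])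
      next
        case False
        then have "i = int (nat (i + 1)) - 1" by simp
        then show ?thesis using H iff i by metis
      qed
      then show ?thesis by (intro iffI allI impI) (simp_all add: iff[symmetric])
    qed
    then show ?thesis by (intro ball_cong iff_allI imp_cong refl)
  qed
  finally show ?thesis using assms(7) by simp
qed

end
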